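(* Let $(Q,L_d,\mathcal{D},\mathcal{D}_d)$ be a nonholonomic discrete mechanical system with symmetry group $G$, with connection $\mathcal{A}$ and affine discrete connection $\mathcal{A}_d$ on $\pi:Q\to Q/G$ as in the context. Let $q_\cdot=(q_0,\dots,q_N)$ be a discrete curve in $Q$ and $r_k:=\pi(q_k)$, $w_k:=\mathcal{A}_d(q_k,q_{k+1})$, $v_k:=\rho(q_k,w_k)$. Each of the following four (mutually equivalent) conditions (1) $(q_k,q_{k+1})\in\mathcal{D}_d$ for all $k$ and $dS_d(q_\cdot)(\delta q_\cdot)=0$ for all vanishing end points variations $\delta q_\cdot$ with $\delta q_k\in\mathcal{D}_{q_k}$ for all $k$; (2) $D_1L_d(q_k,q_{k+1})+D_2L_d(q_{k-1},q_k)\in\mathcal{D}_{q_k}^\circ$ for $1\le k\le N-1$ and $(q_k,q_{k+1})\in\mathcal{D}_d$ for $0\le k\le N-1$; (3) $(v_k,r_{k+1})\in\hat{\mathcal{D}}_d$ for all $k$ and $d\hat{S}_d(v_\cdot,r_\cdot)(\delta v_\cdot,\delta r_\cdot)=0$ for all variations with vanishing end points ($\delta r_0=0$, $\delta r_N=0$, $\xi_0=\xi_N=0$) such that $\delta r_k\in\hat{\mathcal{D}}_{r_k}$ and $$\delta v_k=d\rho(q_k,w_k)\big(h^{q_k}(\delta r_k),d\mathcal{A}_d(q_k,q_{k+1})(h^{q_k}(\delta r_k),h^{q_{k+1}}(\delta r_{k+1}))\big)+d\rho(q_k,w_k)\big((\xi_k)_Q(q_k),d\mathcal{A}_d(q_k,q_{k+1})((\xi_k)_Q(q_k),(\xi_{k+1})_Q(q_{k+1}))\big)$$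 with $(q_k,\xi_k)\in\mathfrak{g}^{\mathcal{D}}$; (4) $(v_k,r_{k+1})\in\hat{\mathcal{D}}_d$ for all $k$ and, for all $1\le k\le N-1$, $D_1\check{L}_d(q_k,w_k,r_{k+1})\circ h^{q_k}+D_3\check{L}_d(q_{k-1},w_{k-1},r_k)+\hat{F}_d^-(v_k,r_{k+1})+\hat{F}_d^+(v_{k-1},r_k)\in\hat{\mathcal{D}}_{r_k}^\circ$ and $D_2\check{L}_d(q_{k-1},w_{k-1},r_k)w_{k-1}^{-1}-D_2\check{L}_d(q_k,w_k,r_{k+1})w_k^{-1}\in(\mathfrak{g}^{\mathcal{D}}_{q_k})^\circ$ is equivalent to the following condition: (5) $(v_k,r_{k+1})\in\hat{\mathcal{D}}_d$ for all $k$, and for all $1\le k\le N-1$ the intrinsic horizontal condition $$\bar{\phi}|_{p_2^*\hat{\mathcal{D}}}=0$$ and the intrinsic vertical condition $$\bar{\psi}|_{(F_1^*\mathfrak{g}^{\mathcal{D}})/G}=0$$ hold at the point $(v_{k-1},r_k,v_k,r_{k+1})$ of $Q^{(2)}_G$.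
   Context: All manifolds and maps are smooth. $G$ is a Lie group with Lie algebra $\mathfrak{g}$ and identity $e$, acting on the left, freely and properly on a manifold $Q$ by $l^Q_g(q)$, so that the quotient map $\pi:Q\to Q/G$ is a principal bundle. Notation: $\xi_Q(q)=\frac{d}{dt}\big|_{t=0}l^Q_{\exp(t\xi)}(q)$; $l^{TQ}_g=dl^Q_g$ (lifted action); $l^{Q\times Q}_g(q_0,q_1)=(l^Q_g(q_0),l^Q_g(q_1))$ (diagonal action); $l^G_g(h)=ghg^{-1}$; $\mathcal{V}^G_q=T_q(l^Q_G(\{q\}))$; $D_j$ is differentiation with respect to the $j$-th factor of a Cartesian product; $p_j$ is the projection on the $j$-th factor; $^\circ$ denotes annihilator. Systems. A nonholonomic discrete mechanical system is $(Q,L_d,\mathcal{D},\mathcal{D}_d)$ with $L_d:Q\times Q\to\mathbb{R}$ smooth, $\mathcal{D}$ a subbundle of $TQ$ and $\mathcal{D}_d\subset Q\times Q$ a submanifold. $G$ is a symmetry group of it if $G$ acts on the left, freely and properly on $Q$ by $l^Q$ (so that $\pi:Q\to Q/G$ is a principal bundle), $L_d$ and $\mathcal{D}_d$ are invariant under the diagonal action and $\mathcal{D}$ is invariant under the lifted action. A discrete curve is a map $q_\cdot:\{0,\dots,N\}\to Q$; a variation is $\delta q_\cdot$ with $\delta q_k\in T_{q_k}Q$; it has vanishing end points if $\delta q_0=0$, $\delta q_N=0$; $S_d(q_\cdot)=\sum_{k=0}^{N-1}L_d(q_k,q_{k+1})$. Connection. It is assumed that $\mathcal{S}_q:=\mathcal{V}^G_q\cap\mathcal{D}_q$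 has locally constant rank and that $G$-invariant subbundles $\mathcal{H},\mathcal{U},\mathcal{W}$ of $TQ$ are fixed with $\mathcal{D}=\mathcal{S}\oplus\mathcal{H}$, $\mathcal{V}^G=\mathcal{S}\oplus\mathcal{U}$, $TQ=\mathcal{W}\oplus\mathcal{U}\oplus\mathcal{S}\oplus\mathcal{H}$. $\mathcal{A}$ is the principal connection on $\pi$ with horizontal bundle $\mathcal{W}\oplus\mathcal{H}$, and $h^q:T_{\pi(q)}(Q/G)\to T_qQ$ is its horizontal lift. $\mathfrak{g}^{\mathcal{D}}=\{(q,\xi)\in Q\times\mathfrak{g}:\xi_Q(q)\in\mathcal{D}_q\}$, with fiber $\mathfrak{g}^{\mathcal{D}}_q\subset\mathfrak{g}$ over $q$. Affine discrete connection. Let $\gamma:Q\to G$ be smooth and $G$-equivariant for $l^Q$ and $l^G$, $\Gamma=\{(q,l^Q_{\gamma(q)}(q)):q\in Q\}$, and $Hor\subset Q\times Q$ a $G$-invariant submanifold with $\Gamma\subset Hor$; put $Hor^2(q)=p_2(Hor\cap(\{q\}\times Q))$. $Hor$ defines an affine discrete connection $\mathcal{A}_d$ of level $\gamma$ if for each $q\in Q$, $Hor^2(q)$ is a submanifold of $Q$ and $T_{q_1}Q=T_{q_1}(l^Q_G(\{q\}))\oplus T_{q_1}Hor^2(q)$ for all $q_1\in l^Q_G(\{q\})\cap Hor^2(q)$. Then there are a $G$-invariant open neighborhood $U$ of $\Gamma$ and an open neighborhood $\mathcal{O}$ of the diagonal in $(Q/G)\times(Q/G)$ such that for all $(q_0,q_1)\in\mathfrak{U}:=(\pi\times\pi)^{-1}(\mathcal{O})$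 there is a unique $g\in G$ with $(q_0,l^Q_{g^{-1}}(q_1))\in Hor\cap U$; fix such $U,\mathcal{O}$ and set $\mathcal{A}_d(q_0,q_1):=g$ (discrete connection 1-form, smooth on $\mathfrak{U}$). For $(\pi(q_0),r_1)\in\mathcal{O}$, $\overline{h_d^{q_0}}(r_1)$ is the unique $q_1$ with $\pi(q_1)=r_1$ and $\mathcal{A}_d(q_0,q_1)=e$. Convention: the notation treats $\mathcal{A}_d$ as defined everywhere; all pairs at which $\mathcal{A}_d$ is evaluated (in particular all $(q_k,q_{k+1})$) are assumed to be in $\mathfrak{U}$, subsets of $Q\times Q$ are intersected with $\mathfrak{U}$ where needed, and $Q\times G\times(Q/G)$, $\tilde{G}\times(Q/G)$ stand for the open subsets where $(\pi(q_0),r_1)\in\mathcal{O}$. Reduced objects. $\tilde{G}=(Q\times G)/G$ for the action $g\cdot(q,w)=(l^Q_g(q),gwg^{-1})$, with quotient map $\rho:Q\times G\to\tilde{G}$ and $p^{Q/G}:\tilde{G}\to Q/G$, $p^{Q/G}(\rho(q,w))=\pi(q)$. $\Phi_{\mathcal{A}_d}:(Q\times Q)/G\to\tilde{G}\times(Q/G)$ is the map induced by $(q_0,q_1)\mapsto(\rho(q_0,\mathcal{A}_d(q_0,q_1)),\pi(q_1))$. $\tilde{F}_1(q_0,w_0,r_1)=l^Q_{w_0}(\overline{h_d^{q_0}}(r_1))$; $\check{L}_d(q_0,w_0,r_1)=L_d(q_0,\tilde{F}_1(q_0,w_0,r_1))$; $\hat{L}_d(\rho(q_0,w_0),r_1)=\check{L}_d(q_0,w_0,r_1)$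 (well defined); $\hat{S}_d(v_\cdot,r_\cdot)=\sum_{k=0}^{N-1}\hat{L}_d(v_k,r_{k+1})$; $\hat{\mathcal{D}}_d=\Phi_{\mathcal{A}_d}(\mathcal{D}_d/G)$; $\hat{\mathcal{D}}\subset T(Q/G)$ has fibers $\hat{\mathcal{D}}_{\pi(q)}=d\pi(q)(\mathcal{D}_q)$. The reduced discrete forces are, for $v_0=\rho(q_0,w_0)$ and $q_1=\tilde{F}_1(q_0,w_0,r_1)$, $\hat{F}_d^+(v_0,r_1)(\delta r_1)=D_2\check{L}_d(q_0,w_0,r_1)\,D_2\mathcal{A}_d(q_0,q_1)(h^{q_1}(\delta r_1))$ and $\hat{F}_d^-(v_0,r_1)(\delta r_0)=D_2\check{L}_d(q_0,w_0,r_1)\,D_1\mathcal{A}_d(q_0,q_1)(h^{q_0}(\delta r_0))$ (independent of the representative $(q_0,w_0)$). For $\alpha\in T^*_wG$, $\alpha w^{-1}\in\mathfrak{g}^*$ is the right translate: $(\alpha w^{-1})(\xi)=\alpha(dR_w(e)(\xi))$, $R_w$ being right multiplication by $w$. Intrinsic conditions. $Q^{(2)}_G=\{(v_0,r_1,v_1,r_2): (v_0,r_1),(v_1,r_2)\in\tilde{G}\times(Q/G),\ p^{Q/G}(v_1)=r_1\}$, which is the quotient by $G$ of $\check{Q}^{(2)}_G=\{(q_0,w_0,r_1,v_1,r_2): p^{Q/G}(v_1)=r_1\}$ with action $g\cdot(q_0,w_0,r_1,v_1,r_2)=(l^Q_g(q_0),l^G_g(w_0),r_1,v_1,r_2)$.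 For $(q_0,w_0,r_1,v_1,r_2)\in\check{Q}^{(2)}_G$ let $q_1=F_1(q_0,w_0,r_1,v_1,r_2):=\tilde{F}_1(q_0,w_0,r_1)$, and let $w_1\in G$ be the unique element with $\rho(q_1,w_1)=v_1$. Then $\bar{\phi}:p_2^*T(Q/G)\to\mathbb{R}$ (bundle over $Q^{(2)}_G$, $p_2(v_0,r_1,v_1,r_2)=r_1$) and $\bar{\psi}:(\check{Q}^{(2)}_G\times\mathfrak{g})/G\to\mathbb{R}$ ($G$ acting on $\mathfrak{g}$ by the adjoint action) are the well-defined fiberwise linear maps given, for any $(q_0,w_0)\in\rho^{-1}(v_0)$, by $\bar{\phi}(v_0,r_1,v_1,r_2,\delta r_1)=\big(D_1\check{L}_d(q_1,w_1,r_2)\circ h^{q_1}+D_3\check{L}_d(q_0,w_0,r_1)+\hat{F}_d^-(v_1,r_2)+\hat{F}_d^+(v_0,r_1)\big)(\delta r_1)$ and $\bar{\psi}([(q_0,w_0,r_1,v_1,r_2,\xi_1)])=\big(D_2\check{L}_d(q_0,w_0,r_1)w_0^{-1}-D_2\check{L}_d(q_1,w_1,r_2)w_1^{-1}\big)(\xi_1)$. The horizontal condition at a point says $\bar{\phi}(v_0,r_1,v_1,r_2,\delta r_1)=0$ for all $\delta r_1\in\hat{\mathcal{D}}_{r_1}$; the vertical condition says $\bar{\psi}([(q_0,w_0,r_1,v_1,r_2,\xi_1)])=0$ whenever $(q_1,\xi_1)\in\mathfrak{g}^{\mathcal{D}}$. *)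

theory Defs
  imports "HOL-Analysis.Analysis" "HOL-Library.Function_Algebras" "HOL-Algebra.Group_Action"
begin

section \<open>Smooth manifolds\<close>

primrec Ck_on :: "nat \<Rightarrow> 'a set \<Rightarrow> ('a::real_normed_vector \<Rightarrow> 'b::real_normed_vector) \<Rightarrow> bool" where
  "Ck_on 0 A f \<longleftrightarrow> continuous_on A f"
| "Ck_on (Suc k) A f \<longleftrightarrow> (\<forall>x\<in>A. f differentiable (at x)) \<and>
     (\<forall>v. Ck_on k A (\<lambda>x. frechet_derivative f (at x) v))"

definition C_infinity_on :: "'a set \<Rightarrow> ('a::real_normed_vector \<Rightarrow> 'b::real_normed_vector) \<Rightarrow> bool" where
  "C_infinity_on A f \<longleftrightarrow> (\<forall>k. Ck_on k A f)"

text \<open>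
  Charts take values in relatively open subsets of a linear subspace (\<open>model\<close>) of a Euclidean
  space, because a Euclidean space type has positive dimension: with a proper subspace every
  dimension, including 0 (discrete Lie groups), is covered. A map defined on
  a relatively open subset of the subspace is smooth if it extends locally to a smooth map on
  an open subset of the ambient space.
\<close>

record ('a, 'e) manifold =
  mtop :: "'a topology"
  model :: "'e set"
  atlas :: "('a set \<times> ('a \<Rightarrow> 'e)) set"

definition smooth_manifold :: "('a, 'e::euclidean_space) manifold \<Rightarrow> bool" where
  "smooth_manifold M \<longleftrightarrow>
     Hausdorff_space (mtop M) \<and> second_countable (mtop M) \<and> subspace (model M) \<and>
     topspace (mtop M) = \<Union>(fst ` atlas M) \<and>
     (\<forall>(U, \<phi>)\<in>atlas M. openin (mtop M) U \<and> openin (top_of_set (model M)) (\<phi> ` U) \<and>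
        homeomorphic_map (subtopology (mtop M) U) (top_of_set (\<phi> ` U)) \<phi>) \<and>
     (\<forall>(U, \<phi>)\<in>atlas M. \<forall>(V, \<psi>)\<in>atlas M. \<forall>x\<in>U \<inter> V.
        \<exists>A F. open A \<and> \<phi> x \<in> A \<and> C_infinity_on A F \<and>
          (\<forall>y\<in>U \<inter> V. \<phi> y \<in> A \<longrightarrow> \<psi> y = F (\<phi> y)))"

definition prod_manifold :: "('a, 'e) manifold \<Rightarrow> ('b, 'f) manifold \<Rightarrow> ('a \<times> 'b, 'e \<times> 'f) manifold" where
  "prod_manifold M N =
     \<lparr>mtop = prod_topology (mtop M) (mtop N), model = model M \<times> model N,
      atlas = {(U \<times> V, map_prod \<phi> \<psi>) | U \<phi> V \<psi>. (U, \<phi>) \<in> atlas M \<and> (V, \<psi>) \<in> atlas N}\<rparr>"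

text \<open>Embedded submanifolds, via adapted charts of the maximal atlas: the condition on
  \<open>insert (U, \<phi>)\<close> says that \<open>(U, \<phi>)\<close> is compatible with the given atlas.\<close>

definition submanifold :: "('a, 'e::euclidean_space) manifold \<Rightarrow> 'a set \<Rightarrow> bool" where
  "submanifold M Z \<longleftrightarrow> Z \<subseteq> topspace (mtop M) \<and>
     (\<exists>k. \<forall>p\<in>Z. \<exists>U \<phi> E. p \<in> U \<and>
        smooth_manifold (M\<lparr>atlas := insert (U, \<phi>) (atlas M)\<rparr>) \<and>
        subspace E \<and> E \<subseteq> model M \<and> dim E = k \<and> \<phi> ` (U \<inter> Z) = \<phi> ` U \<inter> E)"


section \<open>Smooth functions, smooth maps, quotients\<close>

text \<open>
  A smooth structure is handled through its real valued functions: \<open>germs M p\<close> is the set of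
  functions that are smooth on some neighbourhood of \<open>p\<close> (their values elsewhere are
  irrelevant). For the orbit space of a free and proper action, the functions whose pullback is
  smooth are exactly the smooth functions of the quotient manifold.
\<close>

record 'a smooth_space =
  topo :: "'a topology"
  germs :: "'a \<Rightarrow> ('a \<Rightarrow> real) set"

definition pts :: "'a smooth_space \<Rightarrow> 'a set" where
  "pts M = topspace (topo M)"

definition mspace :: "('a, 'e::euclidean_space) manifold \<Rightarrow> 'a smooth_space" where
  "mspace M = \<lparr>topo = mtop M,
     germs = (\<lambda>p. {f. \<exists>U \<phi> A F. (U, \<phi>) \<in> atlas M \<and> p \<in> U \<and> open A \<and> \<phi> p \<in> A \<and>
        C_infinity_on A F \<and> (\<forall>x\<in>U. \<phi> x \<in> A \<longrightarrow> f x = F (\<phi> x))})\<rparr>"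

definition real_line :: "real smooth_space" where
  "real_line = \<lparr>topo = euclidean, germs = (\<lambda>t. {f. \<exists>A. open A \<and> t \<in> A \<and> C_infinity_on A f})\<rparr>"

definition quotient_space :: "('g, 'z) monoid_scheme \<Rightarrow> ('g \<Rightarrow> 'a \<Rightarrow> 'a) \<Rightarrow> 'a smooth_space \<Rightarrow> 'a set smooth_space" where
  "quotient_space G l M = \<lparr>
     topo = topology (\<lambda>V. V \<subseteq> orbits G (pts M) l \<and> openin (topo M) {x \<in> pts M. orbit G l x \<in> V}),
     germs = (\<lambda>r. {f. \<forall>x\<in>r. (\<lambda>y. f (orbit G l y)) \<in> germs M x})\<rparr>"

text \<open>Smoothness on an open subset \<open>U\<close> of \<open>M\<close>.\<close>

definition smooth_map_on :: "'a smooth_space \<Rightarrow> 'a set \<Rightarrow> 'b smooth_space \<Rightarrow> ('a \<Rightarrow> 'b) \<Rightarrow> bool" where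
  "smooth_map_on M U N f \<longleftrightarrow> continuous_map (subtopology (topo M) U) (topo N) f \<and>
     (\<forall>x\<in>U. \<forall>g\<in>germs N (f x). (\<lambda>y. g (f y)) \<in> germs M x)"


section \<open>Tangent vectors\<close>

text \<open>
  A tangent vector at \<open>p\<close> is the velocity of a smooth curve through \<open>p\<close>, represented
  by the operator it induces on the functions that are smooth near \<open>p\<close> (and set to 0 on all
  other functions, so that equal tangent vectors are equal operators). The base point is not
  part of the vector, so it is always carried along. Addition and scaling are pointwise.
\<close>

instantiation "fun" :: (type, scaleR) scaleR
begin
definition scaleR_fun :: "real \<Rightarrow> ('a \<Rightarrow> 'b) \<Rightarrow> 'a \<Rightarrow> 'b" where
  "scaleR_fun c f = (\<lambda>x. c *\<^sub>R f x)"
instance ..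
end

instance "fun" :: (type, real_vector) real_vector
  by standard (auto simp: scaleR_fun_def fun_eq_iff scaleR_add_right scaleR_add_left)

type_synonym 'a tangent = "('a \<Rightarrow> real) \<Rightarrow> real"

definition velocity :: "'a smooth_space \<Rightarrow> (real \<Rightarrow> 'a) \<Rightarrow> 'a tangent" where
  "velocity M c = (\<lambda>f. if f \<in> germs M (c 0) then deriv (\<lambda>t. f (c t)) 0 else 0)"

definition smooth_curve :: "'a smooth_space \<Rightarrow> (real \<Rightarrow> 'a) \<Rightarrow> bool" where
  "smooth_curve M c \<longleftrightarrow> (\<exists>\<epsilon>>0. smooth_map_on real_line {-\<epsilon><..<\<epsilon>} M c)"

definition tangent_space :: "'a smooth_space \<Rightarrow> 'a \<Rightarrow> 'a tangent set" where
  "tangent_space M p = {velocity M c | c. smooth_curve M c \<and> c 0 = p}"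

text \<open>The tangent space of a submanifold \<open>Z\<close> at \<open>p\<close>, as a subset of that of \<open>M\<close>.\<close>

definition tangent_sub :: "'a smooth_space \<Rightarrow> 'a set \<Rightarrow> 'a \<Rightarrow> 'a tangent set" where
  "tangent_sub M Z p = {velocity M c | c. smooth_curve M c \<and> c 0 = p \<and>
     (\<exists>\<epsilon>>0. \<forall>t\<in>{-\<epsilon><..<\<epsilon>}. c t \<in> Z)}"

text \<open>
  \<open>dmap N f p\<close> is the differential at \<open>p\<close> of a map \<open>f\<close> into \<open>N\<close>. The differential of a
  real valued function \<open>f\<close> is \<open>v \<mapsto> v f\<close>; hence the partial differentials of a
  function of several variables are written by applying \<open>v\<close> to the function of the variable
  in question, the other ones being fixed.
\<close>

definition dmap :: "'b smooth_space \<Rightarrow> ('a \<Rightarrow> 'b) \<Rightarrow> 'a \<Rightarrow> 'a tangent \<Rightarrow> 'b tangent" where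
  "dmap N f p v = (\<lambda>g. if g \<in> germs N (f p) then v (\<lambda>x. g (f x)) else 0)"

text \<open>The canonical isomorphism from the product of the tangent spaces at \<open>p\<close> and \<open>q\<close> to the
  tangent space at \<open>(p, q)\<close> of the product \<open>P\<close>.\<close>

definition tangent_pair :: "('a \<times> 'b) smooth_space \<Rightarrow> 'a \<Rightarrow> 'b \<Rightarrow> 'a tangent \<Rightarrow> 'b tangent \<Rightarrow> ('a \<times> 'b) tangent" where
  "tangent_pair P p q v w =
     (\<lambda>f. if f \<in> germs P (p, q) then v (\<lambda>x. f (x, q)) + w (\<lambda>y. f (p, y)) else 0)"

definition annihilator :: "'a tangent set \<Rightarrow> ('a tangent \<Rightarrow> real) set" where
  "annihilator E = {\<alpha>. \<forall>v\<in>E. \<alpha> v = 0}"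

text \<open>Internal direct sum: every element of \<open>V\<close> is uniquely a sum of elements of the members of
  the list.\<close>

definition direct_sum :: "'a tangent set list \<Rightarrow> 'a tangent set \<Rightarrow> bool" where
  "direct_sum Es V \<longleftrightarrow> bij_betw sum_list (listset Es) V"

definition smooth_vector_field :: "'a smooth_space \<Rightarrow> 'a set \<Rightarrow> ('a \<Rightarrow> 'a tangent) \<Rightarrow> bool" where
  "smooth_vector_field M U X \<longleftrightarrow>
     (\<forall>x\<in>U. X x \<in> tangent_space M x \<and> (\<forall>f\<in>germs M x. (\<lambda>y. X y f) \<in> germs M x))"

definition subbundle :: "'a smooth_space \<Rightarrow> ('a \<Rightarrow> 'a tangent set) \<Rightarrow> bool" where
  "subbundle M E \<longleftrightarrow>
     (\<forall>p\<in>pts M. subspace (E p) \<and> E p \<subseteq> tangent_space M p) \<and>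
     (\<forall>p\<in>pts M. \<exists>U k X. openin (topo M) U \<and> p \<in> U \<and>
        (\<forall>i<k::nat. smooth_vector_field M U (X i)) \<and>
        (\<forall>x\<in>U. inj_on (\<lambda>i. X i x) {..<k} \<and> independent ((\<lambda>i. X i x) ` {..<k}) \<and>
           span ((\<lambda>i. X i x) ` {..<k}) = E x))"


section \<open>Lie groups and actions\<close>

definition lie_group :: "'g monoid \<Rightarrow> ('g, 'h::euclidean_space) manifold \<Rightarrow> bool" where
  "lie_group G M \<longleftrightarrow> group G \<and> smooth_manifold M \<and> topspace (mtop M) = carrier G \<and>
     smooth_map_on (mspace (prod_manifold M M)) (carrier G \<times> carrier G) (mspace M)
       (\<lambda>(a, b). a \<otimes>\<^bsub>G\<^esub> b) \<and>
     smooth_map_on (mspace M) (carrier G) (mspace M) (\<lambda>a. inv\<^bsub>G\<^esub> a)"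

definition one_parameter_subgroup :: "'g monoid \<Rightarrow> 'g smooth_space \<Rightarrow> (real \<Rightarrow> 'g) \<Rightarrow> bool" where
  "one_parameter_subgroup G M c \<longleftrightarrow> smooth_map_on real_line UNIV M c \<and>
     (\<forall>s t. c (s + t) = c s \<otimes>\<^bsub>G\<^esub> c t)"

definition lie_exp :: "'g monoid \<Rightarrow> 'g smooth_space \<Rightarrow> 'g tangent \<Rightarrow> 'g" where
  "lie_exp G M \<xi> = (THE c. one_parameter_subgroup G M c \<and> velocity M c = \<xi>) 1"

definition smooth_free_proper_action ::
  "'g monoid \<Rightarrow> ('g, 'h::euclidean_space) manifold \<Rightarrow> ('q, 'e::euclidean_space) manifold \<Rightarrow> ('g \<Rightarrow> 'q \<Rightarrow> 'q) \<Rightarrow> bool" where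
  "smooth_free_proper_action G GM M l \<longleftrightarrow>
     group_action G (topspace (mtop M)) l \<and>
     smooth_map_on (mspace (prod_manifold GM M)) (carrier G \<times> topspace (mtop M)) (mspace M)
       (\<lambda>(g, q). l g q) \<and>
     (\<forall>g\<in>carrier G. \<forall>q\<in>topspace (mtop M). l g q = q \<longrightarrow> g = \<one>\<^bsub>G\<^esub>) \<and>
     proper_map (prod_topology (mtop GM) (mtop M)) (prod_topology (mtop M) (mtop M))
       (\<lambda>(g, q). (l g q, q))"


section \<open>Nonholonomic discrete mechanical systems with symmetry\<close>

text \<open>\<open>cstr\<close> is the constraint distribution \<open>D\<close> (given by its fibers) and \<open>kin\<close> the discrete
  kinematic constraint \<open>D\<^sub>d\<close>.\<close>

record ('q, 'e) nh_system =
  config :: "('q, 'e) manifold"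
  lagr :: "'q \<times> 'q \<Rightarrow> real"
  cstr :: "'q \<Rightarrow> 'q tangent set"
  kin :: "('q \<times> 'q) set"

record ('q, 'e, 'g, 'h) nh_symmetric_system = "('q, 'e) nh_system" +
  grp :: "'g monoid"
  grp_mfd :: "('g, 'h) manifold"
  act :: "'g \<Rightarrow> 'q \<Rightarrow> 'q"

text \<open>
  \<open>bdl_W\<close>, \<open>bdl_U\<close>, \<open>bdl_H\<close> are the subbundles that determine the principal connection;
  \<open>lev\<close> is the level of the affine discrete connection \<open>hor\<close>, \<open>nbhd\<close> is the neighbourhood of
  the graph of \<open>lev\<close> and \<open>diag_nbhd\<close> the neighbourhood of the diagonal of the orbit space
  fixed in order to define the discrete connection form.
\<close>

record ('q, 'e, 'g, 'h) nh_reduction_data = "('q, 'e, 'g, 'h) nh_symmetric_system" +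
  bdl_W :: "'q \<Rightarrow> 'q tangent set"
  bdl_U :: "'q \<Rightarrow> 'q tangent set"
  bdl_H :: "'q \<Rightarrow> 'q tangent set"
  lev :: "'q \<Rightarrow> 'g"
  hor :: "('q \<times> 'q) set"
  nbhd :: "('q \<times> 'q) set"
  diag_nbhd :: "('q set \<times> 'q set) set"

abbreviation "QS S \<equiv> mspace (config S)"
abbreviation "QQS S \<equiv> mspace (prod_manifold (config S) (config S))"
abbreviation "GS S \<equiv> mspace (grp_mfd S)"
abbreviation "QGS S \<equiv> mspace (prod_manifold (config S) (grp_mfd S))"

definition nh_discrete_system :: "('q, 'e::euclidean_space, 'z) nh_system_scheme \<Rightarrow> bool" where
  "nh_discrete_system S \<longleftrightarrow> smooth_manifold (config S) \<and>
     smooth_map_on (QQS S) (pts (QQS S)) real_line (lagr S) \<and>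
     subbundle (QS S) (cstr S) \<and>
     submanifold (prod_manifold (config S) (config S)) (kin S)"

definition diag_act where
  "diag_act S g = (\<lambda>(q0, q1). (act S g q0, act S g q1))"

definition conj_by where
  "conj_by S g w = g \<otimes>\<^bsub>grp S\<^esub> w \<otimes>\<^bsub>grp S\<^esub> inv\<^bsub>grp S\<^esub> g"

definition invariant_set where
  "invariant_set S Z \<longleftrightarrow> (\<forall>g\<in>carrier (grp S). \<forall>z\<in>Z. diag_act S g z \<in> Z)"

definition invariant_distr where
  "invariant_distr S E \<longleftrightarrow> (\<forall>g\<in>carrier (grp S). \<forall>q\<in>pts (QS S).
     dmap (QS S) (act S g) q ` E q = E (act S g q))"

definition symmetry_group ::
  "('q, 'e::euclidean_space, 'g, 'h::euclidean_space, 'z) nh_symmetric_system_scheme \<Rightarrow> bool" where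
  "symmetry_group S \<longleftrightarrow> lie_group (grp S) (grp_mfd S) \<and>
     smooth_free_proper_action (grp S) (grp_mfd S) (config S) (act S) \<and>
     (\<forall>g\<in>carrier (grp S). \<forall>z\<in>pts (QQS S). lagr S (diag_act S g z) = lagr S z) \<and>
     invariant_set S (kin S) \<and> invariant_distr S (cstr S)"

definition base where
  "base S = quotient_space (grp S) (act S) (QS S)"

definition qproj where
  "qproj S q = orbit (grp S) (act S) q"

definition lie_alg where
  "lie_alg S = tangent_space (GS S) \<one>\<^bsub>grp S\<^esub>"

definition inf_gen where
  "inf_gen S \<xi> q = velocity (QS S) (\<lambda>t. act S (lie_exp (grp S) (GS S) (t *\<^sub>R \<xi>)) q)"

definition vert where
  "vert S q = tangent_sub (QS S) (orbit (grp S) (act S) q) q"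

definition vert_distr where
  "vert_distr S q = vert S q \<inter> cstr S q"

definition gD where
  "gD S = {(q, \<xi>). q \<in> pts (QS S) \<and> \<xi> \<in> lie_alg S \<and> inf_gen S \<xi> q \<in> cstr S q}"

definition gD_fiber where
  "gD_fiber S q = {\<xi>. (q, \<xi>) \<in> gD S}"


section \<open>The connections\<close>

definition connection_data ::
  "('q, 'e::euclidean_space, 'g, 'h::euclidean_space, 'z) nh_reduction_data_scheme \<Rightarrow> bool" where
  "connection_data S \<longleftrightarrow>
     (\<forall>q\<in>pts (QS S). \<exists>V. openin (topo (QS S)) V \<and> q \<in> V \<and>
        (\<forall>x\<in>V. dim (vert_distr S x) = dim (vert_distr S q))) \<and>
     (\<forall>E\<in>{bdl_W S, bdl_U S, bdl_H S}. subbundle (QS S) E \<and> invariant_distr S E) \<and>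
     (\<forall>q\<in>pts (QS S).
        direct_sum [vert_distr S q, bdl_H S q] (cstr S q) \<and>
        direct_sum [vert_distr S q, bdl_U S q] (vert S q) \<and>
        direct_sum [bdl_W S q, bdl_U S q, vert_distr S q, bdl_H S q] (tangent_space (QS S) q))"

text \<open>The principal connection enters only through its horizontal bundle
  \<open>W \<oplus> H\<close> and the horizontal lift \<open>h\<^sup>q\<close>.\<close>

definition horizontal where
  "horizontal S q = {w + h | w h. w \<in> bdl_W S q \<and> h \<in> bdl_H S q}"

definition hlift where
  "hlift S q u = (THE v. v \<in> horizontal S q \<and> dmap (base S) (qproj S) q v = u)"

definition hor2 where
  "hor2 S q = {q1. (q, q1) \<in> hor S}"

definition Udom where
  "Udom S = {(q0, q1). q0 \<in> pts (QS S) \<and> q1 \<in> pts (QS S) \<and> (qproj S q0, qproj S q1) \<in> diag_nbhd S}"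

definition Adisc where
  "Adisc S = (\<lambda>(q0, q1). THE g. g \<in> carrier (grp S) \<and>
     (q0, act S (inv\<^bsub>grp S\<^esub> g) q1) \<in> hor S \<inter> nbhd S)"

text \<open>Smoothness of \<open>Adisc\<close> on \<open>Udom\<close> is part of the choice of the neighbourhoods: the
  uniqueness clause alone does not imply it far from the graph of the level.\<close>

definition affine_discrete_connection ::
  "('q, 'e::euclidean_space, 'g, 'h::euclidean_space, 'z) nh_reduction_data_scheme \<Rightarrow> bool" where
  "affine_discrete_connection S \<longleftrightarrow>
     smooth_map_on (QS S) (pts (QS S)) (GS S) (lev S) \<and>
     (\<forall>g\<in>carrier (grp S). \<forall>q\<in>pts (QS S). lev S (act S g q) = conj_by S g (lev S q)) \<and>
     submanifold (prod_manifold (config S) (config S)) (hor S) \<and> invariant_set S (hor S) \<and>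
     (\<forall>q\<in>pts (QS S). (q, act S (lev S q) q) \<in> hor S) \<and>
     (\<forall>q\<in>pts (QS S). submanifold (config S) (hor2 S q) \<and>
        (\<forall>q1\<in>orbit (grp S) (act S) q \<inter> hor2 S q.
           direct_sum [tangent_sub (QS S) (orbit (grp S) (act S) q) q1,
                       tangent_sub (QS S) (hor2 S q) q1] (tangent_space (QS S) q1))) \<and>
     openin (topo (QQS S)) (nbhd S) \<and> invariant_set S (nbhd S) \<and>
     (\<forall>q\<in>pts (QS S). (q, act S (lev S q) q) \<in> nbhd S) \<and>
     openin (prod_topology (topo (base S)) (topo (base S))) (diag_nbhd S) \<and>
     (\<forall>r\<in>pts (base S). (r, r) \<in> diag_nbhd S) \<and>
     (\<forall>(q0, q1)\<in>Udom S. \<exists>!g. g \<in> carrier (grp S) \<and>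
        (q0, act S (inv\<^bsub>grp S\<^esub> g) q1) \<in> hor S \<inter> nbhd S) \<and>
     smooth_map_on (QQS S) (Udom S) (GS S) (Adisc S)"

definition hdisc where
  "hdisc S q0 r1 = (THE q1. q1 \<in> pts (QS S) \<and> qproj S q1 = r1 \<and> Adisc S (q0, q1) = \<one>\<^bsub>grp S\<^esub>)"

definition dA where
  "dA S q0 q1 v0 v1 = dmap (GS S) (Adisc S) (q0, q1) (tangent_pair (QQS S) q0 q1 v0 v1)"

definition D1A where
  "D1A S q0 q1 v = dmap (GS S) (\<lambda>x. Adisc S (x, q1)) q0 v"

definition D2A where
  "D2A S q0 q1 v = dmap (GS S) (\<lambda>x. Adisc S (q0, x)) q1 v"


section \<open>Reduced objects\<close>

definition conj_act where
  "conj_act S g = (\<lambda>(q, w). (act S g q, conj_by S g w))"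

definition Gtilde where
  "Gtilde S = quotient_space (grp S) (conj_act S) (QGS S)"

definition rho where
  "rho S = (\<lambda>(q, w). orbit (grp S) (conj_act S) (q, w))"

text \<open>Maps on a quotient that are defined through representatives are given by \<open>the_elem\<close> of the
  image of the class: for a well defined map this image is a singleton.\<close>

definition Gtilde_proj where
  "Gtilde_proj S v = the_elem ((\<lambda>(q, w). qproj S q) ` v)"

definition Phi where
  "Phi S X = the_elem ((\<lambda>(q0, q1). (rho S (q0, Adisc S (q0, q1)), qproj S q1)) ` X)"

definition F1tilde where
  "F1tilde S q0 w0 r1 = act S w0 (hdisc S q0 r1)"

definition Lcheck where
  "Lcheck S q0 w0 r1 = lagr S (q0, F1tilde S q0 w0 r1)"

definition Lhat where
  "Lhat S v r1 = the_elem ((\<lambda>(q0, w0). Lcheck S q0 w0 r1) ` v)"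

definition kin_hat where
  "kin_hat S = Phi S ` orbit (grp S) (diag_act S) ` (kin S \<inter> Udom S)"

definition cstr_hat where
  "cstr_hat S r = {dmap (base S) (qproj S) q v | q v. q \<in> r \<and> v \<in> cstr S q}"

definition D1L where
  "D1L S q0 q1 = (\<lambda>v. v (\<lambda>x. lagr S (x, q1)))"

definition D2L where
  "D2L S q0 q1 = (\<lambda>v. v (\<lambda>x. lagr S (q0, x)))"

definition D1Lcheck where
  "D1Lcheck S q0 w0 r1 = (\<lambda>v. v (\<lambda>x. Lcheck S x w0 r1))"

definition D2Lcheck where
  "D2Lcheck S q0 w0 r1 = (\<lambda>v. v (\<lambda>x. Lcheck S q0 x r1))"

definition D3Lcheck where
  "D3Lcheck S q0 w0 r1 = (\<lambda>v. v (\<lambda>x. Lcheck S q0 w0 x))"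

definition Fplus where
  "Fplus S v0 r1 \<delta>r1 = the_elem ((\<lambda>(q0, w0). let q1 = F1tilde S q0 w0 r1 in
     D2Lcheck S q0 w0 r1 (D2A S q0 q1 (hlift S q1 \<delta>r1))) ` v0)"

definition Fminus where
  "Fminus S v0 r1 \<delta>r0 = the_elem ((\<lambda>(q0, w0). let q1 = F1tilde S q0 w0 r1 in
     D2Lcheck S q0 w0 r1 (D1A S q0 q1 (hlift S q0 \<delta>r0))) ` v0)"

text \<open>\<open>\<alpha>w\<^sup>-\<^sup>1\<close> for a covector \<open>\<alpha>\<close> at \<open>w\<close>.\<close>

definition right_translate where
  "right_translate S \<alpha> w \<xi> = \<alpha> (dmap (GS S) (\<lambda>g. g \<otimes>\<^bsub>grp S\<^esub> w) \<one>\<^bsub>grp S\<^esub> \<xi>)"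


section \<open>Discrete actions\<close>

definition Sd where
  "Sd S N q = (\<Sum>k<N. lagr S (q k, q (Suc k)))"

definition Shat where
  "Shat S N v r = (\<Sum>k<N. Lhat S (v k) (r (Suc k)))"

text \<open>Differentials of functions on a finite product of manifolds, on whose tangent space (the
  product of the tangent spaces) the differential is the sum of the partial differentials. The
  entries of a reduced curve are \<open>v 0, \<dots>, v (N - 1)\<close> and \<open>r 0, \<dots>, r N\<close>.\<close>

definition dSd where
  "dSd S N q \<delta>q = (\<Sum>j\<le>N. \<delta>q j (\<lambda>x. Sd S N (q(j := x))))"

definition dShat where
  "dShat S N v r \<delta>v \<delta>r =
     (\<Sum>j<N. \<delta>v j (\<lambda>x. Shat S N (v(j := x)) r)) + (\<Sum>j\<le>N. \<delta>r j (\<lambda>x. Shat S N v (r(j := x))))"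


section \<open>The intrinsic conditions\<close>

definition Q2G where
  "Q2G S = {(v0, r1, v1, r2). v0 \<in> pts (Gtilde S) \<and> r1 \<in> pts (base S) \<and> (Gtilde_proj S v0, r1) \<in> diag_nbhd S \<and>
     v1 \<in> pts (Gtilde S) \<and> r2 \<in> pts (base S) \<and> (Gtilde_proj S v1, r2) \<in> diag_nbhd S \<and>
     Gtilde_proj S v1 = r1}"

definition Q2G_check where
  "Q2G_check S = {(q0, w0, r1, v1, r2). q0 \<in> pts (QS S) \<and> w0 \<in> carrier (grp S) \<and>
     r1 \<in> pts (base S) \<and> (qproj S q0, r1) \<in> diag_nbhd S \<and>
     v1 \<in> pts (Gtilde S) \<and> r2 \<in> pts (base S) \<and> (Gtilde_proj S v1, r2) \<in> diag_nbhd S \<and>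
     Gtilde_proj S v1 = r1}"

definition F1 where
  "F1 S = (\<lambda>(q0, w0, r1, v1, r2). F1tilde S q0 w0 r1)"

definition w1_of where
  "w1_of S q1 v1 = (THE w1. w1 \<in> carrier (grp S) \<and> rho S (q1, w1) = v1)"

definition phi_bar where
  "phi_bar S = (\<lambda>(v0, r1, v1, r2) \<delta>r1. the_elem ((\<lambda>(q0, w0).
     let q1 = F1 S (q0, w0, r1, v1, r2); w1 = w1_of S q1 v1 in
     D1Lcheck S q1 w1 r2 (hlift S q1 \<delta>r1) + D3Lcheck S q0 w0 r1 \<delta>r1 +
     Fminus S v1 r2 \<delta>r1 + Fplus S v0 r1 \<delta>r1) ` v0))"

definition adjoint where
  "adjoint S g \<xi> = dmap (GS S) (conj_by S g) \<one>\<^bsub>grp S\<^esub> \<xi>"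

definition check_act where
  "check_act S g = (\<lambda>((q0, w0, r1, v1, r2), \<xi>).
     ((act S g q0, conj_by S g w0, r1, v1, r2), adjoint S g \<xi>))"

definition psi_bar where
  "psi_bar S X = the_elem ((\<lambda>((q0, w0, r1, v1, r2), \<xi>).
     let q1 = F1 S (q0, w0, r1, v1, r2); w1 = w1_of S q1 v1 in
     right_translate S (D2Lcheck S q0 w0 r1) w0 \<xi> - right_translate S (D2Lcheck S q1 w1 r2) w1 \<xi>) ` X)"

definition pullback_cstr_hat where
  "pullback_cstr_hat S = {((v0, r1, v1, r2), \<delta>r1). (v0, r1, v1, r2) \<in> Q2G S \<and> \<delta>r1 \<in> cstr_hat S r1}"

definition pullback_gD where
  "pullback_gD S = {(x, \<xi>). x \<in> Q2G_check S \<and> (F1 S x, \<xi>) \<in> gD S}"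

definition horizontal_condition where
  "horizontal_condition S y \<longleftrightarrow> (\<forall>\<delta>r1. (y, \<delta>r1) \<in> pullback_cstr_hat S \<longrightarrow> phi_bar S y \<delta>r1 = 0)"

definition vertical_condition where
  "vertical_condition S = (\<lambda>(v0, r1, v1, r2). \<forall>q0 w0 \<xi>.
     rho S (q0, w0) = v0 \<and> ((q0, w0, r1, v1, r2), \<xi>) \<in> pullback_gD S \<longrightarrow>
     psi_bar S (orbit (grp S) (check_act S) ((q0, w0, r1, v1, r2), \<xi>)) = 0)"

end

theory Submission
  imports Defs
begin

text \<open>
  Apart from the kinematic constraints, all five conditions say the same thing about consecutive
  points \<open>q0\<close>, \<open>q1\<close>, \<open>q2\<close> of the curve: the discrete Euler-Lagrange covector
  \<open>EL q0 q1 q2 = D1L q1 q2 + D2L q0 q1\<close> annihilates the admissible velocities \<open>cstr q1\<close>. The proof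
  translates each condition into this one.

  For the unreduced conditions this is summation by parts (\<open>dSd_eq_dS\<close>, \<open>dS_zero_iff_EL\<close>). For the
  reduced ones the starting point is the factorization
  \<open>L (x, y) = Lcheck x (Ad (x, y)) (\<pi> y)\<close>, where \<open>Ad\<close> is the discrete connection form. The product
  rule \<open>tangent_Pair\<close> applied to it splits \<open>D1L\<close> and \<open>D2L\<close> into partial differentials of \<open>Lcheck\<close>
  (\<open>D1L_split\<close>, \<open>D2L_split\<close>), and the terms in which \<open>Ad\<close> is differentiated are the reduced
  discrete forces. So on a horizontal lift \<open>EL\<close> is the expression in the horizontal condition
  (\<open>horizontal_EL\<close>). On an infinitesimal symmetry \<open>\<xi>\<^sub>Q\<close> it is the expression in the vertical condition
  (\<open>vertical_EL\<close>), because \<open>Ad (x, g y) = g Ad (x, y)\<close> and because the invariance of \<open>L\<close> turns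
  \<open>D1L (\<xi>\<^sub>Q)\<close> into \<open>- D2L (\<xi>\<^sub>Q)\<close>. Since every admissible velocity is the sum of a horizontal lift and an
  infinitesimal symmetry (\<open>cstr_decompose\<close>), the two conditions together say that \<open>EL\<close> vanishes on
  \<open>cstr q1\<close>. The intrinsic conditions quantify over all representatives of a point of the reduced
  space; they reduce to one representative because \<open>EL\<close> is equivariant (\<open>EL_act\<close>). For the
  variational condition on the reduced curve, the reduced variations are the images of the admissible
  ones, and the reduced action has the same differential along them (\<open>dShat_eq_dS\<close>). The kinematic constraints
  agree because a pair \<open>(x, y)\<close> can be recovered up to the diagonal action from
  \<open>(\<rho> (x, Ad (x, y)), \<pi> y)\<close> (\<open>kin_hat_iff\<close>).

  Two facts about Lie groups and quotients enter. First, \<open>\<xi>\<^sub>Q\<close> is defined by the exponential map, so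
  one-parameter subgroups with a given velocity have to exist and be unique; they are integral
  curves of left invariant vector fields, extended to all times by the group law. Second, the kernel
  of \<open>d\<pi>\<close> consists of the vertical vectors, and vertical vectors are values of infinitesimal
  generators. The discrete connection form provides both statements, because it yields smooth
  coordinates along the orbits: \<open>x \<mapsto> Ad (q, x) Ad (q, q)\<^sup>-\<^sup>1\<close> inverts the orbit map \<open>g \<mapsto> g q\<close>
  (\<open>vert_if_dpi_zero\<close>, \<open>vertE\<close>).
\<close>

section \<open>Smooth functions on open subsets of Euclidean spaces\<close>

lemma Ck_on_subset: "Ck_on k A f \<Longrightarrow> B \<subseteq> A \<Longrightarrow> Ck_on k B f"
  by (induction k arbitrary: f) (auto intro: continuous_on_subset)

lemma Ck_on_cong:
  assumes "open A" "\<And>x. x \<in> A \<Longrightarrow> f x = g x" "Ck_on k A f"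
  shows "Ck_on k A g"
  using assms(2,3)
proof (induction k arbitrary: f g)
  case 0
  then show ?case by (simp cong: continuous_on_cong)
next
  case (Suc k)
  have d: "(g has_derivative frechet_derivative f (at x)) (at x)" if "x \<in> A" for x
    using Suc.prems that assms(1)
    by (auto intro: has_derivative_transform_within_open simp: frechet_derivative_works)
  have eq: "frechet_derivative g (at x) = frechet_derivative f (at x)" if "x \<in> A" for x
    using frechet_derivative_at[OF d[OF that]] by simp
  show ?case
    using Suc.prems(2) d Suc.IH[of "\<lambda>x. frechet_derivative f (at x) v" "\<lambda>x. frechet_derivative g (at x) v" for v] eq
    by (auto simp: differentiable_def)
qed

lemma Ck_on_SucI:
  assumes "open A" "\<And>x. x \<in> A \<Longrightarrow> (f has_derivative f' x) (at x)"
    and "\<And>v. Ck_on k A (\<lambda>x. f' x v)"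
  shows "Ck_on (Suc k) A f"
proof -
  have eq: "f' x = frechet_derivative f (at x)" if "x \<in> A" for x
    using frechet_derivative_at[OF assms(2)[OF that]] .
  have "Ck_on k A (\<lambda>x. frechet_derivative f (at x) v)" for v
    by (rule Ck_on_cong[OF assms(1) _ assms(3)[of v]]) (simp add: eq)
  then show ?thesis using assms(2) by (auto simp: differentiable_def)
qed

lemma Ck_on_SucD:
  assumes "Ck_on (Suc k) A f"
  shows "x \<in> A \<Longrightarrow> (f has_derivative frechet_derivative f (at x)) (at x)"
    and "Ck_on k A (\<lambda>x. frechet_derivative f (at x) v)"
  using assms by (auto simp: frechet_derivative_works)

lemma Ck_on_Suc_imp: "Ck_on (Suc k) A f \<Longrightarrow> Ck_on k A f"
proof (induction k arbitrary: f)
  case 0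
  then show ?case by (auto intro!: continuous_at_imp_continuous_on differentiable_imp_continuous_within)
next
  case (Suc k)
  then show ?case by (metis Ck_on.simps(2))
qed

lemma Ck_on_const: "Ck_on k A (\<lambda>x. c)"
  by (induction k arbitrary: c) (auto simp: frechet_derivative_const)

lemma Ck_on_bounded_linear:
  assumes "open A" "bounded_linear f" shows "Ck_on k A f"
proof (cases k)
  case 0
  then show ?thesis using assms by (simp add: linear_continuous_on)
next
  case (Suc n)
  then show ?thesis using assms
    by (auto intro!: Ck_on_SucI[where f' = "\<lambda>x. f"] Ck_on_const bounded_linear_imp_has_derivative simp del: Ck_on.simps)
qed

lemma Ck_on_add:
  assumes "open A" shows "Ck_on k A f \<Longrightarrow> Ck_on k A g \<Longrightarrow> Ck_on k A (\<lambda>x. f x + g x)"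
proof (induction k arbitrary: f g)
  case 0
  then show ?case by (auto intro: continuous_intros)
next
  case (Suc k)
  then show ?case using assms
    by (auto intro!: Ck_on_SucI derivative_intros dest: Ck_on_SucD simp del: Ck_on.simps)
qed

lemma Ck_on_sum:
  assumes "open A" "finite I" "\<And>i. i \<in> I \<Longrightarrow> Ck_on k A (f i)"
  shows "Ck_on k A (\<lambda>x. \<Sum>i\<in>I. f i x)"
  using assms(2,3) by (induction rule: finite_induct) (auto intro: Ck_on_const Ck_on_add[OF assms(1)])

lemma Ck_on_scaleR:
  assumes "open A"
  shows "Ck_on k A f \<Longrightarrow> Ck_on k A g \<Longrightarrow> Ck_on k A (\<lambda>x. f x *\<^sub>R g x)"
proof (induction k arbitrary: f g)
  case 0
  then show ?case by (auto intro: continuous_intros)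
next
  case (Suc k)
  note [simp del] = Ck_on.simps
  show ?case
  proof (rule Ck_on_SucI[OF assms])
    show "((\<lambda>x. f x *\<^sub>R g x) has_derivative
        (\<lambda>v. f x *\<^sub>R frechet_derivative g (at x) v + frechet_derivative f (at x) v *\<^sub>R g x)) (at x)" if "x \<in> A" for x
      using that by (intro has_derivative_scaleR Ck_on_SucD(1)[OF Suc.prems(1)] Ck_on_SucD(1)[OF Suc.prems(2)])
    show "Ck_on k A (\<lambda>x. f x *\<^sub>R frechet_derivative g (at x) v + frechet_derivative f (at x) v *\<^sub>R g x)" for v
      using Suc.prems by (intro Ck_on_add[OF assms] Suc.IH Ck_on_SucD(2)) (auto intro: Ck_on_Suc_imp)
  qed
qed

lemma Ck_on_bounded_linear_compose:
  assumes "open A" "bounded_linear h" shows "Ck_on k A f \<Longrightarrow> Ck_on k A (\<lambda>x. h (f x))"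
proof (induction k arbitrary: f)
  case 0
  then show ?case using bounded_linear.continuous_on[OF assms(2)] by auto
next
  case (Suc k)
  then show ?case using assms
    by (auto intro!: Ck_on_SucI bounded_linear.has_derivative[OF assms(2)] dest: Ck_on_SucD simp del: Ck_on.simps)
qed

text \<open>In an orthonormal basis the chain rule expresses the derivative of a composite as a sum of products
  of functions that are one order less smooth, one factor being again a composite with the same
  inner function.\<close>

lemma Ck_on_compose:
  fixes f :: "'a::real_normed_vector \<Rightarrow> 'b::euclidean_space"
  assumes "open A" "open B" "f ` A \<subseteq> B"
  shows "Ck_on k B g \<Longrightarrow> Ck_on k A f \<Longrightarrow> Ck_on k A (\<lambda>x. g (f x))"
proof (induction k arbitrary: g)
  case 0
  then show ?case using assms by (auto intro: continuous_on_compose2)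
next
  case (Suc k)
  note [simp del] = Ck_on.simps
  let ?D = "\<lambda>x v. \<Sum>b\<in>Basis. (frechet_derivative f (at x) v \<bullet> b) *\<^sub>R frechet_derivative g (at (f x)) b"
  show ?case
  proof (rule Ck_on_SucI[OF assms(1)])
    fix x assume "x \<in> A"
    then have f: "(f has_derivative frechet_derivative f (at x)) (at x)"
      and g: "(g has_derivative frechet_derivative g (at (f x))) (at (f x))"
      using Suc.prems assms(3) by (auto dest: Ck_on_SucD)
    have "frechet_derivative g (at (f x)) (frechet_derivative f (at x) v) = ?D x v" for v
    proof -
      have "linear (frechet_derivative g (at (f x)))" using g by (rule has_derivative_linear)
      then have "?D x v = frechet_derivative g (at (f x)) (\<Sum>b\<in>Basis. (frechet_derivative f (at x) v \<bullet> b) *\<^sub>R b)"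
        by (simp add: linear_sum linear_scale)
      then show ?thesis by (simp add: euclidean_representation)
    qed
    then show "((\<lambda>x. g (f x)) has_derivative ?D x) (at x)"
      using has_derivative_compose[OF f g] by (simp add: fun_eq_iff)
  next
    fix v
    show "Ck_on k A (\<lambda>x. ?D x v)"
      using Suc.prems
      by (intro Ck_on_sum Ck_on_scaleR assms(1) finite_Basis Suc.IH Ck_on_SucD(2)
          Ck_on_bounded_linear_compose[OF assms(1) bounded_linear_inner_left])
         (auto intro: Ck_on_Suc_imp Ck_on_SucD(2))
  qed
qed

lemma C_infinity_on_subset: "C_infinity_on A f \<Longrightarrow> B \<subseteq> A \<Longrightarrow> C_infinity_on B f"
  by (auto simp: C_infinity_on_def intro: Ck_on_subset)

lemma C_infinity_on_cong:
  "open A \<Longrightarrow> (\<And>x. x \<in> A \<Longrightarrow> f x = g x) \<Longrightarrow> C_infinity_on A f \<Longrightarrow> C_infinity_on A g"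
  unfolding C_infinity_on_def using Ck_on_cong[of A f g] by blast

lemma C_infinity_on_const: "C_infinity_on A (\<lambda>x. c)"
  by (simp add: C_infinity_on_def Ck_on_const)

lemma C_infinity_on_bounded_linear: "open A \<Longrightarrow> bounded_linear f \<Longrightarrow> C_infinity_on A f"
  by (simp add: C_infinity_on_def Ck_on_bounded_linear)

lemma C_infinity_on_bounded_linear_compose:
  "open A \<Longrightarrow> bounded_linear h \<Longrightarrow> C_infinity_on A f \<Longrightarrow> C_infinity_on A (\<lambda>x. h (f x))"
  by (simp add: C_infinity_on_def Ck_on_bounded_linear_compose)

lemma C_infinity_on_add:
  "open A \<Longrightarrow> C_infinity_on A f \<Longrightarrow> C_infinity_on A g \<Longrightarrow> C_infinity_on A (\<lambda>x. f x + g x)"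
  by (simp add: C_infinity_on_def Ck_on_add)

lemma C_infinity_on_sum:
  "open A \<Longrightarrow> finite I \<Longrightarrow> (\<And>i. i \<in> I \<Longrightarrow> C_infinity_on A (f i)) \<Longrightarrow> C_infinity_on A (\<lambda>x. \<Sum>i\<in>I. f i x)"
  by (simp add: C_infinity_on_def Ck_on_sum)

lemma C_infinity_on_compose:
  fixes f :: "'a::real_normed_vector \<Rightarrow> 'b::euclidean_space"
  shows "open A \<Longrightarrow> open B \<Longrightarrow> f ` A \<subseteq> B \<Longrightarrow> C_infinity_on B g \<Longrightarrow> C_infinity_on A f \<Longrightarrow>
    C_infinity_on A (\<lambda>x. g (f x))"
  unfolding C_infinity_on_def using Ck_on_compose[of A B f] by blast

lemma C_infinity_on_Pair:
  fixes f :: "'a::real_normed_vector \<Rightarrow> 'b::real_normed_vector" and g :: "'a \<Rightarrow> 'c::real_normed_vector"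
  assumes "open A" "C_infinity_on A f" "C_infinity_on A g"
  shows "C_infinity_on A (\<lambda>x. (f x, g x))"
proof -
  have "bounded_linear (\<lambda>y::'b. (y, 0::'c))" "bounded_linear (\<lambda>y::'c. (0::'b, y))"
    by (auto intro: bounded_linear_Pair bounded_linear_ident bounded_linear_zero)
  then have "C_infinity_on A (\<lambda>x. (f x, 0) + (0, g x))"
    using assms by (intro C_infinity_on_add C_infinity_on_bounded_linear_compose[of A "\<lambda>y. (y, 0)"]
        C_infinity_on_bounded_linear_compose[of A "\<lambda>y. (0, y)"])
  then show ?thesis by simp
qed

lemma C_infinity_on_continuous: "C_infinity_on A f \<Longrightarrow> continuous_on A f"
  unfolding C_infinity_on_def by (metis Ck_on.simps(1))

lemma C_infinity_on_differentiable: "C_infinity_on A f \<Longrightarrow> x \<in> A \<Longrightarrow> f differentiable (at x)"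
  unfolding C_infinity_on_def by (metis Ck_on.simps(2))

lemma C_infinity_on_frechet_derivative:
  "C_infinity_on A f \<Longrightarrow> C_infinity_on A (\<lambda>x. frechet_derivative f (at x) v)"
  unfolding C_infinity_on_def by (metis Ck_on.simps(2))


section \<open>Germs of smooth functions on manifolds\<close>

text \<open>The local properties of charts on which the calculus below rests. They pass to products of
  manifolds, so that functions of several points are functions on one manifold.\<close>

definition smooth_atlas :: "('a, 'e::euclidean_space) manifold \<Rightarrow> bool" where
  "smooth_atlas M \<longleftrightarrow>
     topspace (mtop M) = \<Union>(fst ` atlas M) \<and>
     (\<forall>(U, \<phi>)\<in>atlas M.
        (\<forall>A. open A \<longrightarrow> openin (mtop M) {x\<in>U. \<phi> x \<in> A}) \<and>
        (\<forall>W. \<forall>x\<in>U \<inter> W. openin (mtop M) W \<longrightarrow> (\<exists>A. open A \<and> \<phi> x \<in> A \<and> (\<forall>y\<in>U. \<phi> y \<in> A \<longrightarrow> y \<in> W)))) \<and>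
     (\<forall>(U, \<phi>)\<in>atlas M. \<forall>(V, \<psi>)\<in>atlas M. \<forall>x\<in>U \<inter> V.
        \<exists>A F. open A \<and> \<phi> x \<in> A \<and> C_infinity_on A F \<and>
          (\<forall>y\<in>U \<inter> V. \<phi> y \<in> A \<longrightarrow> \<psi> y = F (\<phi> y)))"

lemma smooth_manifold_imp_smooth_atlas:
  assumes "smooth_manifold M" shows "smooth_atlas M"
proof -
  have chart: "(\<forall>A. open A \<longrightarrow> openin (mtop M) {x\<in>U. \<phi> x \<in> A}) \<and>
        (\<forall>W. \<forall>x\<in>U \<inter> W. openin (mtop M) W \<longrightarrow> (\<exists>A. open A \<and> \<phi> x \<in> A \<and> (\<forall>y\<in>U. \<phi> y \<in> A \<longrightarrow> y \<in> W)))"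
    if c: "(U, \<phi>) \<in> atlas M" for U \<phi>
  proof (intro conjI allI ballI impI)
    have U: "openin (mtop M) U" and h: "homeomorphic_map (subtopology (mtop M) U) (top_of_set (\<phi> ` U)) \<phi>"
      using assms c unfolding smooth_manifold_def by auto
    have ts: "topspace (subtopology (mtop M) U) = U" using openin_subset[OF U] by auto
    show "openin (mtop M) {x \<in> U. \<phi> x \<in> A}" if A: "open A" for A
    proof -
      have "openin (top_of_set (\<phi> ` U)) (\<phi> ` U \<inter> A)" using A by (simp add: openin_open_Int)
      then have "openin (subtopology (mtop M) U) {x \<in> U. \<phi> x \<in> \<phi> ` U \<inter> A}"
        using openin_continuous_map_preimage[OF homeomorphic_imp_continuous_map[OF h]] ts by metis
      moreover have "{x \<in> U. \<phi> x \<in> \<phi> ` U \<inter> A} = {x \<in> U. \<phi> x \<in> A}"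
        by (intro Collect_cong) (metis IntD2 IntI imageI)
      ultimately show ?thesis using U by (metis openin_trans_full)
    qed
    show "\<exists>A. open A \<and> \<phi> x \<in> A \<and> (\<forall>y\<in>U. \<phi> y \<in> A \<longrightarrow> y \<in> W)" if x: "x \<in> U \<inter> W" and W: "openin (mtop M) W" for W x
    proof -
      have "openin (subtopology (mtop M) U) (U \<inter> W)" using W by (simp add: openin_subtopology_Int2)
      then have "openin (top_of_set (\<phi> ` U)) (\<phi> ` (U \<inter> W))"
        using homeomorphic_imp_open_map[OF h] by (auto simp: open_map_def)
      then obtain A where A: "open A" "\<phi> ` (U \<inter> W) = \<phi> ` U \<inter> A" by (auto simp: openin_open)
      have inj: "inj_on \<phi> U" using homeomorphic_imp_injective_map[OF h] ts by simp
      have "y \<in> W" if y: "y \<in> U" "\<phi> y \<in> A" for y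
      proof -
        have "\<phi> y \<in> \<phi> ` (U \<inter> W)" using y A(2) by blast
        then obtain z where "z \<in> U \<inter> W" "\<phi> y = \<phi> z" by blast
        then show ?thesis using inj y(1) by (metis IntD1 IntD2 inj_onD)
      qed
      then show ?thesis using A x by blast
    qed
  qed
  show ?thesis unfolding smooth_atlas_def
  proof (intro conjI)
    show "\<forall>(U, \<phi>)\<in>atlas M.
        (\<forall>A. open A \<longrightarrow> openin (mtop M) {x\<in>U. \<phi> x \<in> A}) \<and>
        (\<forall>W. \<forall>x\<in>U \<inter> W. openin (mtop M) W \<longrightarrow> (\<exists>A. open A \<and> \<phi> x \<in> A \<and> (\<forall>y\<in>U. \<phi> y \<in> A \<longrightarrow> y \<in> W)))"
      by (intro ballI case_prodI2 chart) simp
  qed (use assms in \<open>simp_all add: smooth_manifold_def\<close>)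
qed

lemma smooth_atlasD:
  assumes "smooth_atlas M"
  shows "x \<in> topspace (mtop M) \<Longrightarrow> \<exists>U \<phi>. (U, \<phi>) \<in> atlas M \<and> x \<in> U"
    and "(U, \<phi>) \<in> atlas M \<Longrightarrow> U \<subseteq> topspace (mtop M)"
    and "(U, \<phi>) \<in> atlas M \<Longrightarrow> open A \<Longrightarrow> openin (mtop M) {x\<in>U. \<phi> x \<in> A}"
    and "(U, \<phi>) \<in> atlas M \<Longrightarrow> x \<in> U \<Longrightarrow> x \<in> W \<Longrightarrow> openin (mtop M) W \<Longrightarrow>
          \<exists>A. open A \<and> \<phi> x \<in> A \<and> (\<forall>y\<in>U. \<phi> y \<in> A \<longrightarrow> y \<in> W)"
    and "(U, \<phi>) \<in> atlas M \<Longrightarrow> (V, \<psi>) \<in> atlas M \<Longrightarrow> x \<in> U \<Longrightarrow> x \<in> V \<Longrightarrow>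
          \<exists>A F. open A \<and> \<phi> x \<in> A \<and> C_infinity_on A F \<and> (\<forall>y\<in>U \<inter> V. \<phi> y \<in> A \<longrightarrow> \<psi> y = F (\<phi> y))"
proof -
  note * = assms[unfolded smooth_atlas_def, THEN conjunct1]
  show "x \<in> topspace (mtop M) \<Longrightarrow> \<exists>U \<phi>. (U, \<phi>) \<in> atlas M \<and> x \<in> U" using * by force
  show "(U, \<phi>) \<in> atlas M \<Longrightarrow> U \<subseteq> topspace (mtop M)" using * by force
  have c: "(\<forall>A. open A \<longrightarrow> openin (mtop M) {x\<in>U. \<phi> x \<in> A}) \<and>
        (\<forall>W. \<forall>x\<in>U \<inter> W. openin (mtop M) W \<longrightarrow> (\<exists>A. open A \<and> \<phi> x \<in> A \<and> (\<forall>y\<in>U. \<phi> y \<in> A \<longrightarrow> y \<in> W)))"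
    if "(U, \<phi>) \<in> atlas M"
    using bspec[OF assms[unfolded smooth_atlas_def, THEN conjunct2, THEN conjunct1] that] unfolding prod.case .
  show "(U, \<phi>) \<in> atlas M \<Longrightarrow> open A \<Longrightarrow> openin (mtop M) {x\<in>U. \<phi> x \<in> A}"
    using c by blast
  show "(U, \<phi>) \<in> atlas M \<Longrightarrow> x \<in> U \<Longrightarrow> x \<in> W \<Longrightarrow> openin (mtop M) W \<Longrightarrow>
          \<exists>A. open A \<and> \<phi> x \<in> A \<and> (\<forall>y\<in>U. \<phi> y \<in> A \<longrightarrow> y \<in> W)"
    using c by blast
  show "\<exists>A F. open A \<and> \<phi> x \<in> A \<and> C_infinity_on A F \<and> (\<forall>y\<in>U \<inter> V. \<phi> y \<in> A \<longrightarrow> \<psi> y = F (\<phi> y))"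
    if "(U, \<phi>) \<in> atlas M" "(V, \<psi>) \<in> atlas M" "x \<in> U" "x \<in> V"
    using bspec[OF bspec[OF assms[unfolded smooth_atlas_def, THEN conjunct2, THEN conjunct2] that(1), unfolded prod.case] that(2),
        unfolded prod.case] that(3,4) by simp
qed

lemma chart_open:
  assumes "smooth_atlas M" "(U, \<phi>) \<in> atlas M" shows "openin (mtop M) U"
  using smooth_atlasD(3)[OF assms, of UNIV] by simp

lemma smooth_atlas_prod:
  assumes M: "smooth_atlas M" and N: "smooth_atlas N"
  shows "smooth_atlas (prod_manifold M N)"
  unfolding smooth_atlas_def
proof (intro conjI)
  show "topspace (mtop (prod_manifold M N)) = \<Union> (fst ` atlas (prod_manifold M N))"
  proof
    show "topspace (mtop (prod_manifold M N)) \<subseteq> \<Union> (fst ` atlas (prod_manifold M N))"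
    proof
      fix z assume "z \<in> topspace (mtop (prod_manifold M N))"
      then obtain U \<phi> V \<psi> where "(U, \<phi>) \<in> atlas M" "fst z \<in> U" "(V, \<psi>) \<in> atlas N" "snd z \<in> V"
        using smooth_atlasD(1)[OF M] smooth_atlasD(1)[OF N]
        by (auto simp: prod_manifold_def) metis
      then have "(U \<times> V, map_prod \<phi> \<psi>) \<in> atlas (prod_manifold M N)" "z \<in> U \<times> V"
        by (auto simp: prod_manifold_def mem_Times_iff)
      then show "z \<in> \<Union> (fst ` atlas (prod_manifold M N))" by force
    qed
    show "\<Union> (fst ` atlas (prod_manifold M N)) \<subseteq> topspace (mtop (prod_manifold M N))"
      using smooth_atlasD(2)[OF M] smooth_atlasD(2)[OF N] by (fastforce simp: prod_manifold_def)
  qed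
next
  have 1: "openin (mtop (prod_manifold M N)) {x \<in> U \<times> V. map_prod \<phi> \<psi> x \<in> A}"
    if c: "(U, \<phi>) \<in> atlas M" "(V, \<psi>) \<in> atlas N" and A: "open A" for U \<phi> V \<psi> A
    unfolding prod_manifold_def manifold.simps openin_prod_topology_alt
  proof (intro allI impI)
    fix x y assume "(x, y) \<in> {x \<in> U \<times> V. map_prod \<phi> \<psi> x \<in> A}"
    then have xy: "x \<in> U" "y \<in> V" "(\<phi> x, \<psi> y) \<in> A" by auto
    then obtain B C where BC: "open B" "open C" "(\<phi> x, \<psi> y) \<in> B \<times> C" "B \<times> C \<subseteq> A"
      using A by (metis open_prod_elim)
    show "\<exists>Ua Va. openin (mtop M) Ua \<and> openin (mtop N) Va \<and> x \<in> Ua \<and> y \<in> Va \<and>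
        Ua \<times> Va \<subseteq> {x \<in> U \<times> V. map_prod \<phi> \<psi> x \<in> A}"
      using smooth_atlasD(3)[OF M c(1) BC(1)] smooth_atlasD(3)[OF N c(2) BC(2)] xy BC
      by (intro exI[of _ "{x \<in> U. \<phi> x \<in> B}"] exI[of _ "{x \<in> V. \<psi> x \<in> C}"]) auto
  qed
  have 2: "\<exists>A. open A \<and> map_prod \<phi> \<psi> z \<in> A \<and> (\<forall>y\<in>U \<times> V. map_prod \<phi> \<psi> y \<in> A \<longrightarrow> y \<in> W)"
    if c: "(U, \<phi>) \<in> atlas M" "(V, \<psi>) \<in> atlas N" and z: "z \<in> (U \<times> V) \<inter> W"
      and W: "openin (mtop (prod_manifold M N)) W" for U \<phi> V \<psi> W z
  proof -
    obtain x y where xy: "z = (x, y)" "x \<in> U" "y \<in> V" using z by auto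
    have W': "openin (prod_topology (mtop M) (mtop N)) W" using W by (simp add: prod_manifold_def)
    obtain W1 W2 where W12: "openin (mtop M) W1" "openin (mtop N) W2" "x \<in> W1" "y \<in> W2" "W1 \<times> W2 \<subseteq> W"
      using W'[unfolded openin_prod_topology_alt, rule_format, of x y] z xy by auto
    obtain A B where "open A" "\<phi> x \<in> A" "\<forall>y\<in>U. \<phi> y \<in> A \<longrightarrow> y \<in> W1"
      "open B" "\<psi> y \<in> B" "\<forall>z\<in>V. \<psi> z \<in> B \<longrightarrow> z \<in> W2"
      using smooth_atlasD(4)[OF M c(1) xy(2) W12(3,1)] smooth_atlasD(4)[OF N c(2) xy(3) W12(4,2)] by blast
    then show ?thesis using W12 xy by (intro exI[of _ "A \<times> B"]) (auto simp: open_Times)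
  qed
  show "\<forall>(U, \<phi>)\<in>atlas (prod_manifold M N).
       (\<forall>A. open A \<longrightarrow> openin (mtop (prod_manifold M N)) {x \<in> U. \<phi> x \<in> A}) \<and>
       (\<forall>W. \<forall>x\<in>U \<inter> W. openin (mtop (prod_manifold M N)) W \<longrightarrow>
          (\<exists>A. open A \<and> \<phi> x \<in> A \<and> (\<forall>y\<in>U. \<phi> y \<in> A \<longrightarrow> y \<in> W)))"
  proof safe
    fix U' \<kappa> assume "(U', \<kappa>) \<in> atlas (prod_manifold M N)"
    then obtain U \<phi> V \<psi> where *: "U' = U \<times> V" "\<kappa> = map_prod \<phi> \<psi>" "(U, \<phi>) \<in> atlas M" "(V, \<psi>) \<in> atlas N"
      by (auto simp: prod_manifold_def)
    show "openin (mtop (prod_manifold M N)) {x \<in> U'. \<kappa> x \<in> A}" if "open A" for A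
      using 1[OF *(3,4) that] * by simp
    show "\<exists>A. open A \<and> \<kappa> x \<in> A \<and> (\<forall>y\<in>U'. \<kappa> y \<in> A \<longrightarrow> y \<in> W)"
      if "openin (mtop (prod_manifold M N)) W" "x \<in> U'" "x \<in> W" for W x
      using 2[OF *(3,4) _ that(1), of x] * that by blast
  qed
next
  have 3: "\<exists>A F. open A \<and> map_prod \<phi> \<psi> z \<in> A \<and> C_infinity_on A F \<and>
          (\<forall>y\<in>(U \<times> V) \<inter> (U' \<times> V'). map_prod \<phi> \<psi> y \<in> A \<longrightarrow> map_prod \<phi>' \<psi>' y = F (map_prod \<phi> \<psi> y))"
    if c: "(U, \<phi>) \<in> atlas M" "(V, \<psi>) \<in> atlas N" "(U', \<phi>') \<in> atlas M" "(V', \<psi>') \<in> atlas N"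
      and z: "z \<in> (U \<times> V) \<inter> (U' \<times> V')" for U \<phi> V \<psi> U' \<phi>' V' \<psi>' z
  proof -
    obtain A F where A: "open A" "\<phi> (fst z) \<in> A" "C_infinity_on A F" "\<forall>y\<in>U \<inter> U'. \<phi> y \<in> A \<longrightarrow> \<phi>' y = F (\<phi> y)"
      using smooth_atlasD(5)[OF M c(1) c(3), of "fst z"] z by auto
    obtain B G where B: "open B" "\<psi> (snd z) \<in> B" "C_infinity_on B G" "\<forall>y\<in>V \<inter> V'. \<psi> y \<in> B \<longrightarrow> \<psi>' y = G (\<psi> y)"
      using smooth_atlasD(5)[OF N c(2) c(4), of "snd z"] z by auto
    have "C_infinity_on (A \<times> B) (\<lambda>x. (F (fst x), G (snd x)))"
      by (rule C_infinity_on_Pair[OF _ C_infinity_on_compose[OF _ A(1) _ A(3) C_infinity_on_bounded_linear[OF _ bounded_linear_fst]]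
            C_infinity_on_compose[OF _ B(1) _ B(3) C_infinity_on_bounded_linear[OF _ bounded_linear_snd]]])
        (auto simp: open_Times A(1) B(1))
    then show ?thesis using A B
      by (intro exI[of _ "A \<times> B"] exI[of _ "\<lambda>x. (F (fst x), G (snd x))"])
         (auto simp: open_Times map_prod_def split_beta)
  qed
  show "\<forall>(U, \<phi>)\<in>atlas (prod_manifold M N). \<forall>(V, \<psi>)\<in>atlas (prod_manifold M N). \<forall>x\<in>U \<inter> V.
        \<exists>A F. open A \<and> \<phi> x \<in> A \<and> C_infinity_on A F \<and> (\<forall>y\<in>U \<inter> V. \<phi> y \<in> A \<longrightarrow> \<psi> y = F (\<phi> y))"
  proof (safe)
    fix U1 \<kappa>1 U2 \<kappa>2 x
    assume "(U1, \<kappa>1) \<in> atlas (prod_manifold M N)" and 2: "(U2, \<kappa>2) \<in> atlas (prod_manifold M N)"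
      and x: "x \<in> U1" "x \<in> U2"
    then obtain U \<phi> V \<psi> where *: "U1 = U \<times> V" "\<kappa>1 = map_prod \<phi> \<psi>" "(U, \<phi>) \<in> atlas M" "(V, \<psi>) \<in> atlas N"
      by (auto simp: prod_manifold_def)
    obtain U' \<phi>' V' \<psi>' where **: "U2 = U' \<times> V'" "\<kappa>2 = map_prod \<phi>' \<psi>'" "(U', \<phi>') \<in> atlas M" "(V', \<psi>') \<in> atlas N"
      using 2 by (auto simp: prod_manifold_def)
    show "\<exists>A F. open A \<and> \<kappa>1 x \<in> A \<and> C_infinity_on A F \<and> (\<forall>y\<in>U1 \<inter> U2. \<kappa>1 y \<in> A \<longrightarrow> \<kappa>2 y = F (\<kappa>1 y))"
      using 3[OF *(3,4) **(3,4), of x] * ** x by simp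
  qed
qed

lemma pts_mspace [simp]: "pts (mspace M) = topspace (mtop M)"
  by (simp add: pts_def mspace_def)

lemma topo_mspace [simp]: "topo (mspace M) = mtop M"
  by (simp add: mspace_def)

lemma topspace_prod_manifold [simp]:
  "topspace (mtop (prod_manifold M N)) = topspace (mtop M) \<times> topspace (mtop N)"
  by (simp add: prod_manifold_def)

lemma mtop_prod_manifold: "mtop (prod_manifold M N) = prod_topology (mtop M) (mtop N)"
  by (simp add: prod_manifold_def)

lemma germI:
  assumes "(U, \<phi>) \<in> atlas M" "p \<in> U" "open A" "\<phi> p \<in> A" "C_infinity_on A F"
    "\<And>x. x \<in> U \<Longrightarrow> \<phi> x \<in> A \<Longrightarrow> f x = F (\<phi> x)"
  shows "f \<in> germs (mspace M) p"
proof -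
  have "\<exists>U \<phi> A F. (U, \<phi>) \<in> atlas M \<and> p \<in> U \<and> open A \<and> \<phi> p \<in> A \<and> C_infinity_on A F \<and>
      (\<forall>x\<in>U. \<phi> x \<in> A \<longrightarrow> f x = F (\<phi> x))"
    using assms by blast
  then show ?thesis by (simp add: mspace_def)
qed

lemma germE:
  assumes "f \<in> germs (mspace M) p"
  obtains U \<phi> A F where "(U, \<phi>) \<in> atlas M" "p \<in> U" "open A" "\<phi> p \<in> A" "C_infinity_on A F"
    "\<And>x. x \<in> U \<Longrightarrow> \<phi> x \<in> A \<Longrightarrow> f x = F (\<phi> x)"
  using assms by (auto simp: mspace_def)

text \<open>Coordinate changes allow smoothness to be tested in a prescribed chart.\<close>

lemma germ_chart:
  assumes M: "smooth_atlas M" and f: "f \<in> germs (mspace M) p" and c: "(U, \<phi>) \<in> atlas M" "p \<in> U"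
  obtains A F where "open A" "\<phi> p \<in> A" "C_infinity_on A F" "\<And>x. x \<in> U \<Longrightarrow> \<phi> x \<in> A \<Longrightarrow> f x = F (\<phi> x)"
proof -
  obtain V \<psi> B G where V: "(V, \<psi>) \<in> atlas M" "p \<in> V" "open B" "\<psi> p \<in> B" "C_infinity_on B G"
    and G: "\<And>x. x \<in> V \<Longrightarrow> \<psi> x \<in> B \<Longrightarrow> f x = G (\<psi> x)"
    using f by (elim germE) blast
  obtain A0 T where T: "open A0" "\<phi> p \<in> A0" "C_infinity_on A0 T" "\<forall>y\<in>U \<inter> V. \<phi> y \<in> A0 \<longrightarrow> \<psi> y = T (\<phi> y)"
    using smooth_atlasD(5)[OF M c(1) V(1) c(2) V(2)] by auto
  obtain A1 where A1: "open A1" "\<phi> p \<in> A1" "\<forall>y\<in>U. \<phi> y \<in> A1 \<longrightarrow> y \<in> V"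
    using smooth_atlasD(4)[OF M c(1) c(2) V(2) chart_open[OF M V(1)]] by auto
  let ?A = "A1 \<inter> (A0 \<inter> T -` B)"
  have "open (A0 \<inter> T -` B)"
    using T V by (intro continuous_open_preimage C_infinity_on_continuous)
  then have o: "open ?A" using A1 by auto
  have "C_infinity_on ?A (\<lambda>x. G (T x))"
    by (rule C_infinity_on_compose[OF o V(3) _ V(5) C_infinity_on_subset[OF T(3)]]) auto
  moreover have "\<phi> p \<in> ?A" using A1 T V c by auto
  moreover have "f x = G (T (\<phi> x))" if "x \<in> U" "\<phi> x \<in> ?A" for x
    using that A1 T G by auto
  ultimately show thesis using o that by blast
qed

lemma germ_local:
  assumes M: "smooth_atlas M" and f: "f \<in> germs (mspace M) p"
    and W: "openin (mtop M) W" "p \<in> W" "\<And>x. x \<in> W \<Longrightarrow> f x = g x"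
  shows "g \<in> germs (mspace M) p"
proof -
  obtain U \<phi> A F where c: "(U, \<phi>) \<in> atlas M" "p \<in> U" "open A" "\<phi> p \<in> A" "C_infinity_on A F"
    and F: "\<And>x. x \<in> U \<Longrightarrow> \<phi> x \<in> A \<Longrightarrow> f x = F (\<phi> x)" using f by (elim germE) blast
  obtain B where B: "open B" "\<phi> p \<in> B" "\<forall>y\<in>U. \<phi> y \<in> B \<longrightarrow> y \<in> W"
    using smooth_atlasD(4)[OF M c(1,2) W(2,1)] by auto
  have "g x = F (\<phi> x)" if "x \<in> U" "\<phi> x \<in> A \<inter> B" for x
    using that B(3) W(3)[of x] F[of x] by auto
  then show ?thesis
    using c B by (intro germI[of U \<phi> M p "A \<inter> B" F]) (auto intro: C_infinity_on_subset)
qed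

lemma germ_const: "smooth_atlas M \<Longrightarrow> p \<in> topspace (mtop M) \<Longrightarrow> (\<lambda>x. k) \<in> germs (mspace M) p"
  using smooth_atlasD(1)[of M p] by (auto intro!: germI[of _ _ M p UNIV "\<lambda>x. k"] C_infinity_on_const)

text \<open>A finite dimensional vector valued function is smooth if its coordinates are; it then has a
  single smooth representative in a chart, which is what makes germs closed under composition
  with smooth functions of several variables.\<close>

definition vgerm :: "'a smooth_space \<Rightarrow> ('a \<Rightarrow> 'v::euclidean_space) \<Rightarrow> 'a \<Rightarrow> bool" where
  "vgerm M F p \<longleftrightarrow> (\<forall>b\<in>Basis. (\<lambda>x. F x \<bullet> b) \<in> germs M p)"

lemma vgerm_chart:
  fixes F :: "'a \<Rightarrow> 'v::euclidean_space"
  assumes M: "smooth_atlas M" and F: "vgerm (mspace M) F p" and c: "(U, \<phi>) \<in> atlas M" "p \<in> U"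
  obtains A G where "open A" "\<phi> p \<in> A" "C_infinity_on A G" "\<And>x. x \<in> U \<Longrightarrow> \<phi> x \<in> A \<Longrightarrow> F x = G (\<phi> x)"
proof -
  have "\<forall>b\<in>Basis. \<exists>A G. open A \<and> \<phi> p \<in> A \<and> C_infinity_on A G \<and> (\<forall>x\<in>U. \<phi> x \<in> A \<longrightarrow> F x \<bullet> b = G (\<phi> x))"
  proof
    fix b :: 'v assume "b \<in> Basis"
    then have b: "(\<lambda>x. F x \<bullet> b) \<in> germs (mspace M) p" using F by (simp add: vgerm_def)
    obtain A G where "open A" "\<phi> p \<in> A" "C_infinity_on A G" "\<And>x. x \<in> U \<Longrightarrow> \<phi> x \<in> A \<Longrightarrow> F x \<bullet> b = G (\<phi> x)"
      by (rule germ_chart[OF M b c]) blast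
    then show "\<exists>A G. open A \<and> \<phi> p \<in> A \<and> C_infinity_on A G \<and> (\<forall>x\<in>U. \<phi> x \<in> A \<longrightarrow> F x \<bullet> b = G (\<phi> x))"
      by blast
  qed
  then obtain A where "\<forall>b\<in>Basis. \<exists>G. open (A b) \<and> \<phi> p \<in> A b \<and> C_infinity_on (A b) G \<and> (\<forall>x\<in>U. \<phi> x \<in> A b \<longrightarrow> F x \<bullet> b = G (\<phi> x))"
    by (auto dest: bchoice)
  then obtain G where G: "\<forall>b\<in>Basis. open (A b) \<and> \<phi> p \<in> A b \<and> C_infinity_on (A b) (G b) \<and> (\<forall>x\<in>U. \<phi> x \<in> A b \<longrightarrow> F x \<bullet> b = G b (\<phi> x))"
    using bchoice[of Basis "\<lambda>b G. open (A b) \<and> \<phi> p \<in> A b \<and> C_infinity_on (A b) G \<and> (\<forall>x\<in>U. \<phi> x \<in> A b \<longrightarrow> F x \<bullet> b = G (\<phi> x))"]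
    by blast
  let ?A = "\<Inter>b\<in>Basis. A b"
  have o: "open ?A" using G by (intro open_INT) auto
  show thesis
  proof (rule that[of ?A "\<lambda>x. \<Sum>b\<in>Basis. G b x *\<^sub>R b"])
    show "C_infinity_on ?A (\<lambda>x. \<Sum>b\<in>Basis. G b x *\<^sub>R b)"
    proof (intro C_infinity_on_sum o finite_Basis)
      fix b :: 'v assume b: "b \<in> Basis"
      then have "C_infinity_on ?A (G b)" using G by (auto intro: C_infinity_on_subset)
      then show "C_infinity_on ?A (\<lambda>x. G b x *\<^sub>R b)"
        by (intro C_infinity_on_bounded_linear_compose[OF o bounded_linear_scaleR_left])
    qed
    show "F x = (\<Sum>b\<in>Basis. G b (\<phi> x) *\<^sub>R b)" if x: "x \<in> U" "\<phi> x \<in> ?A" for x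
    proof -
      have "F x \<bullet> b = G b (\<phi> x)" if "b \<in> Basis" for b using G x that by auto
      then show ?thesis by (subst euclidean_representation[symmetric]) (auto intro: sum.cong)
    qed
  qed (use G o in auto)
qed

lemma germ_compose:
  assumes M: "smooth_atlas M" and p: "p \<in> topspace (mtop M)" and F: "vgerm (mspace M) F p"
    and H: "open B" "F p \<in> B" "C_infinity_on B H"
  shows "(\<lambda>x. H (F x)) \<in> germs (mspace M) p"
proof -
  obtain U \<phi> where c: "(U, \<phi>) \<in> atlas M" "p \<in> U" using smooth_atlasD(1)[OF M p] by auto
  obtain A G where G: "open A" "\<phi> p \<in> A" "C_infinity_on A G" "\<And>x. x \<in> U \<Longrightarrow> \<phi> x \<in> A \<Longrightarrow> F x = G (\<phi> x)"
    by (rule vgerm_chart[OF M F c]) blast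
  let ?A = "A \<inter> G -` B"
  have o: "open ?A" using G H by (intro continuous_open_preimage C_infinity_on_continuous)
  have "C_infinity_on ?A (\<lambda>x. H (G x))"
    by (rule C_infinity_on_compose[OF o H(1) _ H(3) C_infinity_on_subset[OF G(3)]]) auto
  then show ?thesis using c o G H by (intro germI[of U \<phi> M p ?A "\<lambda>x. H (G x)"]) auto
qed

lemma chart_vgerm:
  assumes "(U, \<phi>) \<in> atlas M" "p \<in> U" shows "vgerm (mspace M) \<phi> p"
  unfolding vgerm_def
  using assms by (auto intro!: germI[of U \<phi> M p UNIV] C_infinity_on_bounded_linear bounded_linear_inner_left)

lemma germ_add:
  assumes M: "smooth_atlas M" and f: "f \<in> germs (mspace M) p" and g: "g \<in> germs (mspace M) p"
  shows "(\<lambda>x. f x + g x) \<in> germs (mspace M) p"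
proof -
  obtain U \<phi> A F where c: "(U, \<phi>) \<in> atlas M" "p \<in> U" "open A" "\<phi> p \<in> A" "C_infinity_on A F"
    and F: "\<And>x. x \<in> U \<Longrightarrow> \<phi> x \<in> A \<Longrightarrow> f x = F (\<phi> x)" using f by (elim germE) blast
  obtain B G where B: "open B" "\<phi> p \<in> B" "C_infinity_on B G" "\<And>x. x \<in> U \<Longrightarrow> \<phi> x \<in> B \<Longrightarrow> g x = G (\<phi> x)"
    by (rule germ_chart[OF M g c(1,2)]) blast
  show ?thesis using c B F
    by (intro germI[of U \<phi> M p "A \<inter> B" "\<lambda>x. F x + G x"])
       (auto intro!: C_infinity_on_add intro: C_infinity_on_subset)
qed

lemma germ_continuous:
  assumes M: "smooth_atlas M" and f: "f \<in> germs (mspace M) p" and B: "open B" "f p \<in> B"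
  obtains W where "openin (mtop M) W" "p \<in> W" "\<And>x. x \<in> W \<Longrightarrow> f x \<in> B"
proof -
  obtain U \<phi> A F where c: "(U, \<phi>) \<in> atlas M" "p \<in> U" "open A" "\<phi> p \<in> A" "C_infinity_on A F"
    and F: "\<And>x. x \<in> U \<Longrightarrow> \<phi> x \<in> A \<Longrightarrow> f x = F (\<phi> x)" using f by (elim germE) blast
  have "open (A \<inter> F -` B)" using c B by (intro continuous_open_preimage C_infinity_on_continuous)
  then show thesis using c F B
    by (intro that[of "{x\<in>U. \<phi> x \<in> A \<inter> F -` B}"] smooth_atlasD(3)[OF M c(1)]) auto
qed


section \<open>Smooth maps\<close>

text \<open>Smoothness at a point is the pullback of germs; it determines \<open>f\<close> near the point well enough to
  imply continuity (\<open>smooth_at_continuous\<close>), which is why no topological clause is included.\<close>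

definition smooth_at :: "'a smooth_space \<Rightarrow> 'b smooth_space \<Rightarrow> ('a \<Rightarrow> 'b) \<Rightarrow> 'a \<Rightarrow> bool" where
  "smooth_at M N f x \<longleftrightarrow> x \<in> pts M \<and> f x \<in> pts N \<and> (\<forall>g\<in>germs N (f x). (\<lambda>y. g (f y)) \<in> germs M x)"

lemma smooth_atD: "smooth_at M N f x \<Longrightarrow> g \<in> germs N (f x) \<Longrightarrow> (\<lambda>y. g (f y)) \<in> germs M x"
  by (simp add: smooth_at_def)

text \<open>For a neighbourhood \<open>W\<close> of \<open>f x\<close>, the indicator function of its complement is constant near \<open>f x\<close>,
  hence a germ there; its pullback is continuous and vanishes at \<open>x\<close>, so \<open>f\<close> maps a neighbourhood
  of \<open>x\<close> to \<open>W\<close>.\<close>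

lemma smooth_at_continuous:
  assumes M: "smooth_atlas M" and N: "smooth_atlas N" and f: "smooth_at (mspace M) (mspace N) f x"
    and W: "openin (mtop N) W" "f x \<in> W"
  obtains V where "openin (mtop M) V" "x \<in> V" "\<And>y. y \<in> V \<Longrightarrow> f y \<in> W"
proof -
  let ?g = "\<lambda>y. if y \<in> W then 0 else 1 :: real"
  have "?g \<in> germs (mspace N) (f x)"
    by (rule germ_local[OF N germ_const[OF N, of _ 0] W]) (use f in \<open>auto simp: smooth_at_def\<close>)
  then have "(\<lambda>y. ?g (f y)) \<in> germs (mspace M) x" using f by (rule smooth_atD[rotated])
  then obtain V where V: "openin (mtop M) V" "x \<in> V" "\<And>y. y \<in> V \<Longrightarrow> ?g (f y) \<in> {..<1}"
    using germ_continuous[OF M, of "\<lambda>y. ?g (f y)" x "{..<1}"] W(2) by auto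
  show thesis
  proof (rule that[OF V(1,2)])
    show "f y \<in> W" if "y \<in> V" for y using V(3)[OF that] by (cases "f y \<in> W") auto
  qed
qed

lemma smooth_at_local:
  assumes M: "smooth_atlas M" and f: "smooth_at (mspace M) N f x"
    and W: "openin (mtop M) W" "x \<in> W" "\<And>y. y \<in> W \<Longrightarrow> f y = g y"
  shows "smooth_at (mspace M) N g x"
proof -
  have "(\<lambda>y. h (g y)) \<in> germs (mspace M) x" if "h \<in> germs N (f x)" for h
    by (rule germ_local[OF M smooth_atD[OF f that] W(1,2)]) (simp add: W(3))
  then show ?thesis using f W by (auto simp: smooth_at_def)
qed

lemma smooth_at_compose:
  assumes "smooth_at M N f x" "smooth_at N P g (f x)"
  shows "smooth_at M P (\<lambda>y. g (f y)) x"
  unfolding smooth_at_def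
proof (intro conjI ballI)
  show "x \<in> pts M" "g (f x) \<in> pts P" using assms by (auto simp: smooth_at_def)
  show "(\<lambda>y. h (g (f y))) \<in> germs M x" if "h \<in> germs P (g (f x))" for h
    using smooth_atD[OF assms(1) smooth_atD[OF assms(2) that]] .
qed

lemma smooth_at_id: "x \<in> pts M \<Longrightarrow> smooth_at M M (\<lambda>y. y) x"
  by (simp add: smooth_at_def)

lemma smooth_at_const:
  "smooth_atlas M \<Longrightarrow> x \<in> topspace (mtop M) \<Longrightarrow> k \<in> pts N \<Longrightarrow> smooth_at (mspace M) N (\<lambda>y. k) x"
  by (simp add: smooth_at_def germ_const)

lemma smooth_at_Pair:
  assumes M: "smooth_atlas M" and N: "smooth_atlas N" and P: "smooth_atlas P"
    and f: "smooth_at (mspace M) (mspace N) f x" and g: "smooth_at (mspace M) (mspace P) g x"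
  shows "smooth_at (mspace M) (mspace (prod_manifold N P)) (\<lambda>y. (f y, g y)) x"
  unfolding smooth_at_def
proof (intro conjI ballI)
  show x: "x \<in> pts (mspace M)" "(f x, g x) \<in> pts (mspace (prod_manifold N P))"
    using f g by (auto simp: smooth_at_def)
  fix h assume "h \<in> germs (mspace (prod_manifold N P)) (f x, g x)"
  then obtain U' \<kappa> A H where c: "(U', \<kappa>) \<in> atlas (prod_manifold N P)" "(f x, g x) \<in> U'" "open A" "\<kappa> (f x, g x) \<in> A"
      "C_infinity_on A H" and H: "\<And>z. z \<in> U' \<Longrightarrow> \<kappa> z \<in> A \<Longrightarrow> h z = H (\<kappa> z)" by (elim germE) blast
  obtain U \<phi> V \<psi> where UV: "U' = U \<times> V" "\<kappa> = map_prod \<phi> \<psi>" "(U, \<phi>) \<in> atlas N" "(V, \<psi>) \<in> atlas P"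
    using c(1) by (auto simp: prod_manifold_def)
  have fg: "f x \<in> U" "g x \<in> V" "(\<phi> (f x), \<psi> (g x)) \<in> A" using c UV by auto
  have v: "vgerm (mspace M) (\<lambda>y. (\<phi> (f y), \<psi> (g y))) x"
  proof -
    have "(\<lambda>y. \<phi> (f y) \<bullet> b) \<in> germs (mspace M) x" if "b \<in> Basis" for b
      using smooth_atD[OF f, of "\<lambda>z. \<phi> z \<bullet> b"] chart_vgerm[OF UV(3) fg(1)] that by (simp add: vgerm_def)
    moreover have "(\<lambda>y. \<psi> (g y) \<bullet> b) \<in> germs (mspace M) x" if "b \<in> Basis" for b
      using smooth_atD[OF g, of "\<lambda>z. \<psi> z \<bullet> b"] chart_vgerm[OF UV(4) fg(2)] that by (simp add: vgerm_def)
    ultimately show ?thesis by (auto simp: vgerm_def Basis_prod_def)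
  qed
  obtain A1 A2 where A12: "open A1" "open A2" "\<phi> (f x) \<in> A1" "\<psi> (g x) \<in> A2" "A1 \<times> A2 \<subseteq> A"
    using c(3) fg(3) by (metis open_prod_elim mem_Sigma_iff)
  obtain V1 where V1: "openin (mtop M) V1" "x \<in> V1" "\<And>y. y \<in> V1 \<Longrightarrow> f y \<in> {z\<in>U. \<phi> z \<in> A1}"
    using smooth_at_continuous[OF M N f smooth_atlasD(3)[OF N UV(3) A12(1)]] fg A12 by auto
  obtain V2 where V2: "openin (mtop M) V2" "x \<in> V2" "\<And>y. y \<in> V2 \<Longrightarrow> g y \<in> {z\<in>V. \<psi> z \<in> A2}"
    using smooth_at_continuous[OF M P g smooth_atlasD(3)[OF P UV(4) A12(2)]] fg A12 by auto
  show "(\<lambda>y. h (f y, g y)) \<in> germs (mspace M) x"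
  proof (rule germ_local[OF M germ_compose[OF M _ v c(3) fg(3) c(5)] openin_Int[OF V1(1) V2(1)]])
    show "H (\<phi> (f y), \<psi> (g y)) = h (f y, g y)" if "y \<in> V1 \<inter> V2" for y
    proof -
      have fy: "f y \<in> U" "\<phi> (f y) \<in> A1" and gy: "g y \<in> V" "\<psi> (g y) \<in> A2" using that V1(3) V2(3) by auto
      then have "(\<phi> (f y), \<psi> (g y)) \<in> A" using A12(5) by auto
      then show ?thesis using H[of "(f y, g y)"] UV fy gy by simp
    qed
  qed (use x V1 V2 in auto)
qed

lemma smooth_at_fst:
  assumes N: "smooth_atlas N" and P: "smooth_atlas P" and z: "z \<in> topspace (mtop N) \<times> topspace (mtop P)"
  shows "smooth_at (mspace (prod_manifold N P)) (mspace N) fst z"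
  unfolding smooth_at_def
proof (intro conjI ballI)
  fix h assume "h \<in> germs (mspace N) (fst z)"
  then obtain U \<phi> A H where c: "(U, \<phi>) \<in> atlas N" "fst z \<in> U" "open A" "\<phi> (fst z) \<in> A"
      "C_infinity_on A H" and H: "\<And>z. z \<in> U \<Longrightarrow> \<phi> z \<in> A \<Longrightarrow> h z = H (\<phi> z)" by (elim germE) blast
  obtain V \<psi> where d: "(V, \<psi>) \<in> atlas P" "snd z \<in> V" using smooth_atlasD(1)[OF P, of "snd z"] z by auto
  have "C_infinity_on (A \<times> UNIV) (\<lambda>x. H (fst x))"
    by (rule C_infinity_on_compose[OF _ c(3) _ c(5) C_infinity_on_bounded_linear[OF _ bounded_linear_fst]])
      (auto simp: open_Times c(3))
  then show "(\<lambda>y. h (fst y)) \<in> germs (mspace (prod_manifold N P)) z"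
    using c d H by (intro germI[of "U \<times> V" "map_prod \<phi> \<psi>" _ _ "A \<times> UNIV" "\<lambda>x. H (fst x)"])
      (auto simp: prod_manifold_def open_Times mem_Times_iff)
qed (use z in auto)

lemma smooth_at_snd:
  assumes N: "smooth_atlas N" and P: "smooth_atlas P" and z: "z \<in> topspace (mtop N) \<times> topspace (mtop P)"
  shows "smooth_at (mspace (prod_manifold N P)) (mspace P) snd z"
  unfolding smooth_at_def
proof (intro conjI ballI)
  fix h assume "h \<in> germs (mspace P) (snd z)"
  then obtain U \<phi> A H where c: "(U, \<phi>) \<in> atlas P" "snd z \<in> U" "open A" "\<phi> (snd z) \<in> A"
      "C_infinity_on A H" and H: "\<And>z. z \<in> U \<Longrightarrow> \<phi> z \<in> A \<Longrightarrow> h z = H (\<phi> z)" by (elim germE) blast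
  obtain V \<psi> where d: "(V, \<psi>) \<in> atlas N" "fst z \<in> V" using smooth_atlasD(1)[OF N, of "fst z"] z by auto
  have "C_infinity_on (UNIV \<times> A) (\<lambda>x. H (snd x))"
    by (rule C_infinity_on_compose[OF _ c(3) _ c(5) C_infinity_on_bounded_linear[OF _ bounded_linear_snd]])
      (auto simp: open_Times c(3))
  then show "(\<lambda>y. h (snd y)) \<in> germs (mspace (prod_manifold N P)) z"
    using c d H by (intro germI[of "V \<times> U" "map_prod \<psi> \<phi>" _ _ "UNIV \<times> A" "\<lambda>x. H (snd x)"])
      (auto simp: prod_manifold_def open_Times mem_Times_iff)
qed (use z in auto)

lemma smooth_map_onD:
  assumes "smooth_map_on (mspace M) U N f" "x \<in> U" "U \<subseteq> topspace (mtop M)"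
  shows "smooth_at (mspace M) N f x"
proof -
  have "f x \<in> topspace (topo N)"
    using assms unfolding smooth_map_on_def by (force dest: continuous_map_image_subset_topspace)
  then show ?thesis using assms by (auto simp: smooth_map_on_def smooth_at_def pts_def)
qed

lemma smooth_map_onI:
  assumes M: "smooth_atlas M" and N: "smooth_atlas N" and U: "openin (mtop M) U"
    and f: "\<And>x. x \<in> U \<Longrightarrow> smooth_at (mspace M) (mspace N) f x"
  shows "smooth_map_on (mspace M) U (mspace N) f"
  unfolding smooth_map_on_def
proof (intro conjI ballI)
  show "(\<lambda>y. g (f y)) \<in> germs (mspace M) x" if "x \<in> U" "g \<in> germs (mspace N) (f x)" for x g
    using smooth_atD[OF f] that .
  have "continuous_map (subtopology (mtop M) U) (mtop N) f"
    unfolding continuous_map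
  proof (intro conjI allI impI)
    show "f ` topspace (subtopology (mtop M) U) \<subseteq> topspace (mtop N)"
      using f by (auto simp: smooth_at_def)
    fix W assume W: "openin (mtop N) W"
    have "openin (mtop M) {x \<in> U. f x \<in> W}"
    proof (subst openin_subopen, safe)
      fix x assume x: "x \<in> U" "f x \<in> W"
      obtain V where "openin (mtop M) V" "x \<in> V" "\<And>y. y \<in> V \<Longrightarrow> f y \<in> W"
        using smooth_at_continuous[OF M N f[OF x(1)] W x(2)] by blast
      then show "\<exists>T. openin (mtop M) T \<and> x \<in> T \<and> T \<subseteq> {x \<in> U. f x \<in> W}"
        using U x by (intro exI[of _ "U \<inter> V"]) auto
    qed
    moreover have "{x \<in> topspace (subtopology (mtop M) U). f x \<in> W} = {x \<in> U. f x \<in> W}"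
      using openin_subset[OF U] by auto
    ultimately show "openin (subtopology (mtop M) U) {x \<in> topspace (subtopology (mtop M) U). f x \<in> W}"
      using U by (simp add: openin_open_subtopology)
  qed
  then show "continuous_map (subtopology (topo (mspace M)) U) (topo (mspace N)) f" by simp
qed

text \<open>Seeing the real line as a manifold turns curves into smooth maps between manifolds.\<close>

definition real_mfd :: "(real, real) manifold" where
  "real_mfd = \<lparr>mtop = euclidean, model = UNIV, atlas = {(UNIV, \<lambda>x. x)}\<rparr>"

lemma smooth_atlas_real_mfd: "smooth_atlas real_mfd"
proof -
  have "\<exists>A. open A \<and> x \<in> A \<and> (\<forall>y\<in>UNIV. y \<in> A \<longrightarrow> y \<in> W)" if "open W" "x \<in> W" for W and x :: real
    using that by blast
  moreover have "\<exists>A F. open A \<and> x \<in> A \<and> C_infinity_on A F \<and> (\<forall>y. y \<in> A \<longrightarrow> y = F y)" for x :: real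
    by (intro exI[of _ UNIV] exI[of _ "\<lambda>x. x"]) (auto intro: C_infinity_on_bounded_linear bounded_linear_ident)
  ultimately show ?thesis unfolding smooth_atlas_def real_mfd_def by auto
qed

lemma topspace_real_mfd [simp]: "topspace (mtop real_mfd) = UNIV"
  by (simp add: real_mfd_def)

lemma openin_real_mfd [simp]: "openin (mtop real_mfd) U \<longleftrightarrow> open U"
  by (simp add: real_mfd_def)

lemma real_line_eq: "real_line = mspace real_mfd"
proof -
  have "(\<exists>A. open A \<and> t \<in> A \<and> C_infinity_on A f) \<longleftrightarrow>
      (\<exists>A. open A \<and> t \<in> A \<and> (\<exists>F. C_infinity_on A F \<and> (\<forall>x. x \<in> A \<longrightarrow> f x = F x)))" (is "_ \<longleftrightarrow> ?R")
    for t :: real and f :: "real \<Rightarrow> real"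
  proof
    assume ?R
    then obtain A F where A: "open A" "t \<in> A" "C_infinity_on A F" "\<forall>x. x \<in> A \<longrightarrow> f x = F x" by blast
    then have "C_infinity_on A f" by (intro C_infinity_on_cong[of A F f]) auto
    then show "\<exists>A. open A \<and> t \<in> A \<and> C_infinity_on A f" using A by blast
  qed blast
  then show ?thesis unfolding real_line_def mspace_def real_mfd_def by simp
qed


section \<open>Tangent vectors as derivations\<close>

lemma smooth_curve_iff:
  assumes "smooth_atlas M"
  shows "smooth_curve (mspace M) c \<longleftrightarrow> (\<exists>\<epsilon>>0. \<forall>t\<in>{-\<epsilon><..<\<epsilon>}. smooth_at real_line (mspace M) c t)"
proof -
  have "smooth_map_on real_line {-\<epsilon><..<\<epsilon>} (mspace M) c \<longleftrightarrow> (\<forall>t\<in>{-\<epsilon><..<\<epsilon>}. smooth_at real_line (mspace M) c t)" for \<epsilon>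
    unfolding real_line_eq
    by (auto intro: smooth_map_onD smooth_map_onI[OF smooth_atlas_real_mfd assms])
  then show ?thesis by (simp add: smooth_curve_def)
qed

lemma smooth_curve_smooth_at:
  assumes "smooth_atlas M" "smooth_curve (mspace M) c"
  shows "smooth_at real_line (mspace M) c 0"
proof -
  obtain \<epsilon> :: real where "\<epsilon> > 0" "\<forall>t\<in>{-\<epsilon><..<\<epsilon>}. smooth_at real_line (mspace M) c t"
    using assms smooth_curve_iff by blast
  then show ?thesis by simp
qed

lemma germ_real_line_differentiable: "f \<in> germs real_line t \<Longrightarrow> f differentiable (at t)"
  by (auto simp: real_line_def dest: C_infinity_on_differentiable)

lemma smooth_at_real_line:
  assumes h: "C_infinity_on UNIV h" shows "smooth_at real_line real_line h t"
  unfolding smooth_at_def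
proof (intro conjI ballI)
  fix f assume "f \<in> germs real_line (h t)"
  then obtain A where A: "open A" "h t \<in> A" "C_infinity_on A f" by (auto simp: real_line_def)
  have o: "open (h -` A)" using A(1) C_infinity_on_continuous[OF h] by (simp add: open_vimage continuous_on_eq_continuous_at)
  have "C_infinity_on (h -` A) (\<lambda>s. f (h s))"
    by (rule C_infinity_on_compose[OF o A(1) _ A(3) C_infinity_on_subset[OF h]]) auto
  then show "(\<lambda>s. f (h s)) \<in> germs real_line t" using o A(2) by (auto simp: real_line_def)
qed (simp_all add: real_line_eq)

lemma smooth_at_real_line_shift: "smooth_at real_line real_line (\<lambda>u. s + u) t"
  by (intro smooth_at_real_line C_infinity_on_add C_infinity_on_const C_infinity_on_bounded_linear bounded_linear_ident open_UNIV)

lemma smooth_at_real_line_scale: "smooth_at real_line real_line (\<lambda>u. k * u) t"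
  by (intro smooth_at_real_line C_infinity_on_bounded_linear bounded_linear_mult_right open_UNIV)

lemma curve_has_deriv:
  assumes "smooth_at real_line N c t" "f \<in> germs N (c t)"
  shows "((\<lambda>s. f (c s)) has_real_derivative deriv (\<lambda>s. f (c s)) t) (at t)"
  using germ_real_line_differentiable[OF smooth_atD[OF assms]]
  by (simp add: DERIV_deriv_iff_real_differentiable)

lemma curve_eventually:
  assumes M: "smooth_atlas M" and c: "smooth_at real_line (mspace M) c t" and W: "openin (mtop M) W" "c t \<in> W"
  shows "eventually (\<lambda>s. c s \<in> W) (nhds t)"
proof -
  obtain V where "openin (mtop real_mfd) V" "t \<in> V" "\<And>y. y \<in> V \<Longrightarrow> c y \<in> W"
    using smooth_at_continuous[OF smooth_atlas_real_mfd M c[unfolded real_line_eq] W] by blast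
  then show ?thesis by (auto simp: eventually_nhds)
qed

lemma tangentE:
  assumes "smooth_atlas M" "v \<in> tangent_space (mspace M) p"
  obtains c where "smooth_curve (mspace M) c" "smooth_at real_line (mspace M) c 0" "c 0 = p" "v = velocity (mspace M) c"
  using assms smooth_curve_smooth_at[OF assms(1)] unfolding tangent_space_def by blast

lemma velocity_germ: "f \<in> germs M (c 0) \<Longrightarrow> velocity M c f = deriv (\<lambda>t. f (c t)) 0"
  by (simp add: velocity_def)

lemma tangent_pts: "smooth_atlas M \<Longrightarrow> v \<in> tangent_space (mspace M) p \<Longrightarrow> p \<in> topspace (mtop M)"
  by (elim tangentE) (auto simp: smooth_at_def)

lemma tangent_outside: "v \<in> tangent_space M p \<Longrightarrow> f \<notin> germs M p \<Longrightarrow> v f = 0"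
  by (auto simp: tangent_space_def velocity_def)

lemma tangent_add:
  assumes M: "smooth_atlas M" and v: "v \<in> tangent_space (mspace M) p"
    and f: "f \<in> germs (mspace M) p" and g: "g \<in> germs (mspace M) p"
  shows "v (\<lambda>x. f x + g x) = v f + v g"
proof -
  obtain c where c: "smooth_at real_line (mspace M) c 0" "c 0 = p" "v = velocity (mspace M) c"
    using tangentE[OF M v] by blast
  have "((\<lambda>t. f (c t) + g (c t)) has_real_derivative deriv (\<lambda>t. f (c t)) 0 + deriv (\<lambda>t. g (c t)) 0) (at 0)"
    using f g c by (intro DERIV_add curve_has_deriv) auto
  then show ?thesis using germ_add[OF M f g] f g c by (simp add: velocity_germ DERIV_imp_deriv)
qed

lemma tangent_const:
  assumes M: "smooth_atlas M" and v: "v \<in> tangent_space (mspace M) p"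
  shows "v (\<lambda>x. k) = 0"
  using assms germ_const[OF M tangent_pts[OF M v]] by (auto simp: tangent_space_def velocity_def)

lemma tangent_add_const:
  assumes M: "smooth_atlas M" and v: "v \<in> tangent_space (mspace M) p" and f: "f \<in> germs (mspace M) p"
  shows "v (\<lambda>x. f x + k) = v f"
  using tangent_add[OF M v f germ_const[OF M tangent_pts[OF M v]]] tangent_const[OF M v] by simp

lemma tangent_sum:
  assumes M: "smooth_atlas M" and v: "v \<in> tangent_space (mspace M) p"
    and f: "finite I" "\<And>i. i \<in> I \<Longrightarrow> f i \<in> germs (mspace M) p"
  shows "v (\<lambda>x. \<Sum>i\<in>I. f i x) = (\<Sum>i\<in>I. v (f i))"
proof -
  have "(\<lambda>x. \<Sum>i\<in>I. f i x) \<in> germs (mspace M) p \<and> v (\<lambda>x. \<Sum>i\<in>I. f i x) = (\<Sum>i\<in>I. v (f i))"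
    using f
  proof (induction rule: finite_induct)
    case empty
    show ?case using germ_const[OF M tangent_pts[OF M v]] tangent_const[OF M v] by simp
  next
    case (insert i I)
    then show ?case using germ_add[OF M, of "f i" p "\<lambda>x. \<Sum>i\<in>I. f i x"] tangent_add[OF M v, of "f i" "\<lambda>x. \<Sum>i\<in>I. f i x"]
      by simp
  qed
  then show ?thesis by blast
qed

lemma tangent_local:
  assumes M: "smooth_atlas M" and v: "v \<in> tangent_space (mspace M) p"
    and W: "openin (mtop M) W" "p \<in> W" "\<And>x. x \<in> W \<Longrightarrow> f x = g x"
  shows "v f = v g"
proof -
  obtain c where c: "smooth_at real_line (mspace M) c 0" "c 0 = p" "v = velocity (mspace M) c"
    using tangentE[OF M v] by blast
  have "f \<in> germs (mspace M) p \<longleftrightarrow> g \<in> germs (mspace M) p"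
    using germ_local[OF M _ W(1,2), of f g] germ_local[OF M _ W(1,2), of g f] W(3) by auto
  moreover have "deriv (\<lambda>t. f (c t)) 0 = deriv (\<lambda>t. g (c t)) 0"
    using curve_eventually[OF M c(1) W(1)] W c(2)
    by (intro deriv_cong_ev refl) (auto elim!: eventually_mono)
  ultimately show ?thesis using c by (simp add: velocity_def)
qed

lemma deriv_eq_has_derivative:
  fixes f :: "real \<Rightarrow> real"
  assumes "(f has_derivative D) (at t)" shows "deriv f t = D 1"
proof -
  have "linear D" using assms by (rule has_derivative_linear)
  then have "x * D 1 = D x" for x using linear_scale[of D x 1] by simp
  then show ?thesis
    by (intro DERIV_imp_deriv has_derivative_imp_has_field_derivative[OF assms])
qed

lemma curve_chart_differentiable:
  assumes c: "smooth_at real_line (mspace M) c t" and ch: "(U, \<phi>) \<in> atlas M" "c t \<in> U"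
  shows "(\<lambda>s. \<phi> (c s)) differentiable (at t)"
proof -
  have "(\<lambda>s. \<phi> (c s) \<bullet> b) differentiable (at t)" if "b \<in> Basis" for b
    using smooth_atD[OF c, of "\<lambda>x. \<phi> x \<bullet> b"] chart_vgerm[OF ch] that
    by (auto simp: vgerm_def intro: germ_real_line_differentiable)
  then show ?thesis using differentiable_componentwise_within[of "\<lambda>s. \<phi> (c s)" t UNIV] by simp
qed

lemma deriv_curve_chart:
  assumes M: "smooth_atlas M" and c: "smooth_at real_line (mspace M) c t" and ch: "(U, \<phi>) \<in> atlas M" "c t \<in> U"
    and A: "open A" "\<phi> (c t) \<in> A" and F: "F differentiable (at (\<phi> (c t)))"
    and f: "\<And>x. x \<in> U \<Longrightarrow> \<phi> x \<in> A \<Longrightarrow> f x = F (\<phi> x)"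
    and d: "((\<lambda>s. \<phi> (c s)) has_vector_derivative d) (at t)"
  shows "deriv (\<lambda>s. f (c s)) t = frechet_derivative F (at (\<phi> (c t))) d"
proof -
  have "((\<lambda>s. F (\<phi> (c s))) has_derivative (\<lambda>h. frechet_derivative F (at (\<phi> (c t))) (h *\<^sub>R d))) (at t)"
    using has_derivative_compose[OF d[unfolded has_vector_derivative_def], of F] F
    by (simp add: frechet_derivative_works)
  then have "deriv (\<lambda>s. F (\<phi> (c s))) t = frechet_derivative F (at (\<phi> (c t))) d"
    using deriv_eq_has_derivative by fastforce
  moreover have "deriv (\<lambda>s. f (c s)) t = deriv (\<lambda>s. F (\<phi> (c s))) t"
    using curve_eventually[OF M c smooth_atlasD(3)[OF M ch(1) A(1)]] ch A f
    by (intro deriv_cong_ev refl) (auto elim!: eventually_mono)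
  ultimately show ?thesis by simp
qed

text \<open>In product coordinates, the derivative of the representing function of \<open>f\<close> is linear and
  \<open>(a', b') = (a', 0) + (0, b')\<close>.\<close>

lemma deriv_curve_Pair:
  assumes N: "smooth_atlas N" and P: "smooth_atlas P"
    and a: "smooth_at real_line (mspace N) a t" and b: "smooth_at real_line (mspace P) b t"
    and f: "f \<in> germs (mspace (prod_manifold N P)) (a t, b t)"
  shows "deriv (\<lambda>s. f (a s, b s)) t = deriv (\<lambda>s. f (a s, b t)) t + deriv (\<lambda>s. f (a t, b s)) t"
proof -
  obtain U' \<kappa> A F where c: "(U', \<kappa>) \<in> atlas (prod_manifold N P)" "(a t, b t) \<in> U'" "open A" "\<kappa> (a t, b t) \<in> A"
      "C_infinity_on A F" and F: "\<And>z. z \<in> U' \<Longrightarrow> \<kappa> z \<in> A \<Longrightarrow> f z = F (\<kappa> z)"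
    using f by (elim germE) blast
  obtain U \<phi> V \<psi> where UV: "U' = U \<times> V" "\<kappa> = map_prod \<phi> \<psi>" "(U, \<phi>) \<in> atlas N" "(V, \<psi>) \<in> atlas P"
    using c(1) by (auto simp: prod_manifold_def)
  have ab: "a t \<in> U" "b t \<in> V" "(\<phi> (a t), \<psi> (b t)) \<in> A" using c UV by auto
  obtain A1 A2 where A12: "open A1" "open A2" "\<phi> (a t) \<in> A1" "\<psi> (b t) \<in> A2" "A1 \<times> A2 \<subseteq> A"
    using c(3) ab(3) by (metis open_prod_elim mem_Sigma_iff)
  have ea: "eventually (\<lambda>s. a s \<in> {x\<in>U. \<phi> x \<in> A1}) (nhds t)"
    by (rule curve_eventually[OF N a smooth_atlasD(3)[OF N UV(3) A12(1)]]) (use ab A12 in auto)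
  have eb: "eventually (\<lambda>s. b s \<in> {x\<in>V. \<psi> x \<in> A2}) (nhds t)"
    by (rule curve_eventually[OF P b smooth_atlasD(3)[OF P UV(4) A12(2)]]) (use ab A12 in auto)
  have f_eq: "f (x, y) = F (\<phi> x, \<psi> y)" if "x \<in> {x\<in>U. \<phi> x \<in> A1}" "y \<in> {x\<in>V. \<psi> x \<in> A2}" for x y
  proof -
    have "(\<phi> x, \<psi> y) \<in> A" using that A12(5) by auto
    then show ?thesis using F[of "(x, y)"] UV that by simp
  qed
  have pt: "a t \<in> {x\<in>U. \<phi> x \<in> A1}" "b t \<in> {x\<in>V. \<psi> x \<in> A2}" using ab A12 by auto
  obtain a' b' where d: "((\<lambda>s. \<phi> (a s)) has_derivative a') (at t)" "((\<lambda>s. \<psi> (b s)) has_derivative b') (at t)"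
    using curve_chart_differentiable[OF a UV(3) ab(1)] curve_chart_differentiable[OF b UV(4) ab(2)]
    by (auto simp: differentiable_def)
  obtain F' where F': "(F has_derivative F') (at (\<phi> (a t), \<psi> (b t)))"
    using C_infinity_on_differentiable[OF c(5) ab(3)] by (auto simp: differentiable_def)
  have "((\<lambda>s. F (\<phi> (a s), \<psi> (b s))) has_derivative (\<lambda>h. F' (a' h, b' h))) (at t)"
    "((\<lambda>s. F (\<phi> (a s), \<psi> (b t))) has_derivative (\<lambda>h. F' (a' h, 0))) (at t)"
    "((\<lambda>s. F (\<phi> (a t), \<psi> (b s))) has_derivative (\<lambda>h. F' (0, b' h))) (at t)"
    using has_derivative_compose[where g = F and g' = F', OF has_derivative_Pair[OF d(1) d(2)]]
      has_derivative_compose[where g = F and g' = F', OF has_derivative_Pair[OF d(1) has_derivative_const[of "\<psi> (b t)"]]]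
      has_derivative_compose[where g = F and g' = F', OF has_derivative_Pair[OF has_derivative_const[of "\<phi> (a t)"] d(2)]] F'
    by simp_all
  note D = this[THEN deriv_eq_has_derivative]
  have "deriv (\<lambda>s. f (a s, b s)) t = deriv (\<lambda>s. F (\<phi> (a s), \<psi> (b s))) t"
    "deriv (\<lambda>s. f (a s, b t)) t = deriv (\<lambda>s. F (\<phi> (a s), \<psi> (b t))) t"
    "deriv (\<lambda>s. f (a t, b s)) t = deriv (\<lambda>s. F (\<phi> (a t), \<psi> (b s))) t"
  proof -
    show "deriv (\<lambda>s. f (a s, b s)) t = deriv (\<lambda>s. F (\<phi> (a s), \<psi> (b s))) t"
      using eventually_conj[OF ea eb] by (intro deriv_cong_ev refl) (elim eventually_mono, blast intro: f_eq)
    show "deriv (\<lambda>s. f (a s, b t)) t = deriv (\<lambda>s. F (\<phi> (a s), \<psi> (b t))) t"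
      using ea pt(2) by (intro deriv_cong_ev refl) (elim eventually_mono, blast intro: f_eq)
    show "deriv (\<lambda>s. f (a t, b s)) t = deriv (\<lambda>s. F (\<phi> (a t), \<psi> (b s))) t"
      using eb pt(1) by (intro deriv_cong_ev refl) (elim eventually_mono, blast intro: f_eq)
  qed
  moreover have "F' (a' 1, b' 1) = F' (a' 1, 0) + F' (0, b' 1)"
    using linear_add[OF has_derivative_linear[OF F'], of "(a' 1, 0)" "(0, b' 1)"] by simp
  ultimately show ?thesis by (simp add: D)
qed

text \<open>All computations with partial differentials below are instances of this product rule: it
  splits the effect of a tangent vector on an expression in which the base point occurs twice.\<close>

lemma tangent_Pair:
  assumes M: "smooth_atlas M" and N: "smooth_atlas N" and P: "smooth_atlas P"
    and v: "v \<in> tangent_space (mspace M) p"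
    and a: "smooth_at (mspace M) (mspace N) a p" and b: "smooth_at (mspace M) (mspace P) b p"
    and f: "f \<in> germs (mspace (prod_manifold N P)) (a p, b p)"
  shows "v (\<lambda>x. f (a x, b x)) = v (\<lambda>x. f (a x, b p)) + v (\<lambda>x. f (a p, b x))"
proof -
  obtain c where c: "smooth_at real_line (mspace M) c 0" "c 0 = p" "v = velocity (mspace M) c"
    using tangentE[OF M v] by blast
  have p: "p \<in> topspace (mtop M)" using tangent_pts[OF M v] .
  have ka: "smooth_at (mspace M) (mspace N) (\<lambda>x. a p) p" and kb: "smooth_at (mspace M) (mspace P) (\<lambda>x. b p) p"
    using a b smooth_at_const[OF M p, of _ "mspace N"] smooth_at_const[OF M p, of _ "mspace P"]
    unfolding smooth_at_def[of _ _ a] smooth_at_def[of _ _ b] by simp_all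
  have "(\<lambda>x. f (a x, b x)) \<in> germs (mspace M) p" "(\<lambda>x. f (a x, b p)) \<in> germs (mspace M) p"
    "(\<lambda>x. f (a p, b x)) \<in> germs (mspace M) p"
    using smooth_atD[OF smooth_at_Pair[OF M N P a b] f] smooth_atD[OF smooth_at_Pair[OF M N P a kb] f]
      smooth_atD[OF smooth_at_Pair[OF M N P ka b] f] by auto
  moreover have "smooth_at real_line (mspace N) (\<lambda>t. a (c t)) 0" "smooth_at real_line (mspace P) (\<lambda>t. b (c t)) 0"
    using a b c by (auto intro: smooth_at_compose)
  ultimately show ?thesis
    using deriv_curve_Pair[OF N P, of "\<lambda>t. a (c t)" 0 "\<lambda>t. b (c t)" f] f c
    by (simp add: velocity_germ)
qed

lemma dmap_add: "dmap N f p (v + w) = dmap N f p v + dmap N f p w"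
  by (auto simp: dmap_def fun_eq_iff)

text \<open>The coordinates of \<open>u\<close> in a chart have zero derivative, so \<open>u\<close> is locally constant.\<close>

lemma zero_velocity_imp_constant:
  assumes M: "smooth_manifold M" and J: "open J" "connected J" "s \<in> J" "t \<in> J"
    and u: "\<And>t. t \<in> J \<Longrightarrow> smooth_at real_line (mspace M) u t"
    and z: "\<And>t f. t \<in> J \<Longrightarrow> f \<in> germs (mspace M) (u t) \<Longrightarrow> deriv (\<lambda>s. f (u s)) t = 0"
  shows "u s = u t"
proof (rule connected_local_const[OF J(2,3,4)], rule ballI)
  note At = smooth_manifold_imp_smooth_atlas[OF M]
  fix t assume t: "t \<in> J"
  have "u t \<in> topspace (mtop M)" using u[OF t] by (simp add: smooth_at_def)
  then obtain U \<phi> where c: "(U, \<phi>) \<in> atlas M" "u t \<in> U" using smooth_atlasD(1)[OF At] by blast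
  have "homeomorphic_map (subtopology (mtop M) U) (top_of_set (\<phi> ` U)) \<phi>" and "U \<subseteq> topspace (mtop M)"
    using M c smooth_atlasD(2)[OF At] unfolding smooth_manifold_def by auto
  then have inj: "inj_on \<phi> U"
    using homeomorphic_imp_injective_map[of "subtopology (mtop M) U"] by (simp add: Int_absorb1)
  have "eventually (\<lambda>s. u s \<in> U \<and> s \<in> J) (nhds t)"
    using curve_eventually[OF At u[OF t] chart_open[OF At c(1)] c(2)] eventually_nhds_in_open[OF J(1) t]
    by (rule eventually_conj)
  then obtain S where S: "open S" "t \<in> S" "\<And>s. s \<in> S \<Longrightarrow> u s \<in> U \<and> s \<in> J"
    unfolding eventually_nhds by blast
  obtain e where e: "e > 0" "ball t e \<subseteq> S" using S(1,2) open_contains_ball by blast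
  have "u t = u s" if s: "s \<in> ball t e" for s
  proof -
    have "\<phi> (u t) \<bullet> b = \<phi> (u s) \<bullet> b" if b: "b \<in> Basis" for b
    proof (rule DERIV_zero_connected_constant[of "ball t e" "{}" "\<lambda>s. \<phi> (u s) \<bullet> b"])
      have D: "((\<lambda>s. \<phi> (u s) \<bullet> b) has_real_derivative 0) (at x)" if x: "x \<in> ball t e" for x
      proof -
        have ux: "u x \<in> U" "x \<in> J" using x e S by auto
        have "(\<lambda>x. \<phi> x \<bullet> b) \<in> germs (mspace M) (u x)"
          using chart_vgerm[OF c(1) ux(1)] b by (simp add: vgerm_def)
        then show ?thesis using curve_has_deriv[OF u[OF ux(2)], of "\<lambda>x. \<phi> x \<bullet> b"] z[OF ux(2), of "\<lambda>x. \<phi> x \<bullet> b"] by simp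
      qed
      then show "\<forall>x\<in>ball t e - {}. ((\<lambda>s. \<phi> (u s) \<bullet> b) has_real_derivative 0) (at x)" by blast
      show "continuous_on (ball t e) (\<lambda>s. \<phi> (u s) \<bullet> b)"
        using D by (meson DERIV_isCont continuous_at_imp_continuous_on)
    qed (use s e in auto)
    then have "\<phi> (u t) = \<phi> (u s)" by (rule euclidean_eqI)
    moreover have "u t \<in> U" "u s \<in> U" using s e S c by auto
    ultimately show ?thesis using inj by (auto dest: inj_onD)
  qed
  then show "eventually (\<lambda>s. u t = u s) (at t within J)"
    unfolding eventually_at using e(1) by (auto simp: dist_commute)
qed


section \<open>Integral curves of smooth vector fields\<close>

text \<open>The mean value inequality, with a bound for the derivative on the compact ball.\<close>

lemma C_infinity_on_imp_lipschitz_cball: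
  fixes f :: "'a::euclidean_space \<Rightarrow> 'b::real_normed_vector"
  assumes f: "C_infinity_on A f" and S: "cball y r \<subseteq> A"
  obtains L where "L \<ge> 0" "\<And>u v. u \<in> cball y r \<Longrightarrow> v \<in> cball y r \<Longrightarrow> norm (f u - f v) \<le> L * norm (u - v)"
proof -
  let ?D = "\<lambda>x. frechet_derivative f (at x)"
  have "\<exists>B. \<forall>x\<in>cball y r. norm (?D x b) \<le> B" for b
  proof -
    have "continuous_on (cball y r) (\<lambda>x. ?D x b)"
      using C_infinity_on_continuous[OF C_infinity_on_frechet_derivative[OF f]] S by (rule continuous_on_subset)
    then have "bounded ((\<lambda>x. ?D x b) ` cball y r)" by (intro compact_imp_bounded compact_continuous_image) auto
    then show ?thesis by (auto simp: bounded_iff)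
  qed
  then obtain B where B: "\<And>b x. x \<in> cball y r \<Longrightarrow> norm (?D x b) \<le> B b" by metis
  let ?L = "\<Sum>b\<in>Basis. \<bar>B b\<bar>"
  have der: "(f has_derivative ?D x) (at x)" if "x \<in> cball y r" for x
    using C_infinity_on_differentiable[OF f] S that by (auto simp: frechet_derivative_works[symmetric])
  have on: "onorm (?D x) \<le> ?L" if x: "x \<in> cball y r" for x
  proof (rule onorm_bound)
    fix h :: 'a
    have "linear (?D x)" using der[OF x] by (rule has_derivative_linear)
    then have "?D x h = (\<Sum>b\<in>Basis. (h \<bullet> b) *\<^sub>R ?D x b)"
      using linear_sum[of "?D x" "\<lambda>b. (h \<bullet> b) *\<^sub>R b" Basis] by (simp add: linear_scale euclidean_representation)
    also have "norm \<dots> \<le> (\<Sum>b\<in>Basis. norm h * \<bar>B b\<bar>)"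
    proof (rule sum_norm_le)
      fix b :: 'a assume "b \<in> Basis"
      then show "norm ((h \<bullet> b) *\<^sub>R ?D x b) \<le> norm h * \<bar>B b\<bar>"
        using B[OF x, of b] Basis_le_norm[of b h] by (auto intro!: mult_mono)
    qed
    finally show "norm (?D x h) \<le> ?L * norm h" by (simp add: sum_distrib_left mult.commute)
  qed (simp add: sum_nonneg)
  show thesis
  proof (rule that[of ?L])
    show "norm (f u - f v) \<le> ?L * norm (u - v)" if "u \<in> cball y r" "v \<in> cball y r" for u v
      using differentiable_bound[OF convex_cball, of y r f ?D ?L u v] der on that by (auto intro: has_derivative_at_withinI)
  qed (simp add: sum_nonneg)
qed

text \<open>Picard-Lindelof: the field is extended from a closed ball to a globally Lipschitz field by
  precomposition with the nearest point map, and time is clamped to a short interval, so that the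
  integral operator is a contraction of the space of bounded continuous functions. The solution
  starts at the left end point of its interval and is only used in the interior. The projection
  \<open>P\<close> records that the solution stays in the affine subspace to which the field is tangent.\<close>

lemma integral_curve_exists:
  fixes Y :: "'a::euclidean_space \<Rightarrow> 'a"
  assumes A: "open A" "y0 \<in> A" and Y: "C_infinity_on A Y"
    and P: "bounded_linear P" "\<And>y. P (Y y) = Y y"
  obtains \<epsilon> a where "\<epsilon> > 0" "\<And>t. t \<in> {0<..<\<epsilon>} \<Longrightarrow> a t \<in> A"
    "\<And>t. t \<in> {0<..<\<epsilon>} \<Longrightarrow> (a has_vector_derivative Y (a t)) (at t)"
    "\<And>t. t \<in> {0<..<\<epsilon>} \<Longrightarrow> P (a t - y0) = a t - y0"
proof -
  obtain r where r: "r > 0" "cball y0 r \<subseteq> A" using A open_contains_cball by blast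
  obtain L where L: "L \<ge> 0" "\<And>u v. u \<in> cball y0 r \<Longrightarrow> v \<in> cball y0 r \<Longrightarrow> norm (Y u - Y v) \<le> L * norm (u - v)"
    using C_infinity_on_imp_lipschitz_cball[OF Y r(2)] by blast
  let ?R = "closest_point (cball y0 r)"
  have R: "?R x \<in> cball y0 r" for x using r by (intro closest_point_in_set) auto
  \<comment> \<open>the globally Lipschitz field that agrees with \<open>Y\<close> on the ball\<close>
  define Z where "Z x = Y (?R x)" for x
  have Z_lip: "norm (Z x - Z y) \<le> L * dist x y" for x y
  proof -
    have "norm (Z x - Z y) \<le> L * norm (?R x - ?R y)" unfolding Z_def by (rule L(2)[OF R R])
    also have "\<dots> \<le> L * dist x y"
      using closest_point_lipschitz[of "cball y0 r" x y] r L(1) by (intro mult_left_mono) (auto simp: dist_norm)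
    finally show ?thesis .
  qed
  define K where "K = norm (Y y0) + L * r"
  have K: "norm (Z x) \<le> K" for x
  proof -
    have "norm (Y (?R x) - Y y0) \<le> L * norm (?R x - y0)" using r by (intro L(2)[OF R]) auto
    also have "\<dots> \<le> L * r" using R[of x] L(1) by (intro mult_left_mono) (auto simp: dist_norm norm_minus_commute)
    finally have "norm (Y (?R x) - Y y0) \<le> L * r" .
    moreover have "norm (Y (?R x)) \<le> norm (Y y0) + norm (Y (?R x) - Y y0)" by (rule norm_triangle_sub)
    ultimately show ?thesis unfolding Z_def K_def by linarith
  qed
  have K0: "K \<ge> 0" using K[of y0] norm_ge_zero order_trans by blast
  have Z_cont: "continuous_on UNIV Z"
  proof (rule continuous_onI)
    fix x e assume "(e::real) > 0"
    show "\<exists>d>0. \<forall>x'\<in>UNIV. dist x' x < d \<longrightarrow> dist (Z x') (Z x) \<le> e"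
    proof (intro exI[of _ "e / (L + 1)"] conjI ballI impI)
      fix x' assume "dist x' x < e / (L + 1)"
      then have "(L + 1) * dist x' x < e" using L(1) by (simp add: field_simps)
      then have "L * dist x' x \<le> e" using zero_le_dist[of x' x] unfolding distrib_right by linarith
      then show "dist (Z x') (Z x) \<le> e" using Z_lip[of x' x] by (simp add: dist_norm)
    qed (use \<open>e > 0\<close> L in auto)
  qed
  \<comment> \<open>the first bound makes the integral operator a contraction, the second keeps the curve in the ball\<close>
  define \<epsilon> where "\<epsilon> = min (1 / (2 * (L + 1))) (r / (K + 1))"
  have e0: "\<epsilon> > 0" using L K0 r by (simp add: \<epsilon>_def)
  have "L * \<epsilon> \<le> L * (1 / (2 * (L + 1)))" unfolding \<epsilon>_def using L(1) by (intro mult_left_mono) auto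
  also have "\<dots> \<le> 1/2" using L(1) by (simp add: field_simps)
  finally have eL: "L * \<epsilon> \<le> 1/2" .
  have "K * \<epsilon> \<le> K * (r / (K + 1))" unfolding \<epsilon>_def using K0 by (intro mult_left_mono) auto
  also have "\<dots> \<le> r" using K0 r by (simp add: field_simps)
  finally have eK: "K * \<epsilon> \<le> r" .
  define cl where "cl t = max 0 (min \<epsilon> t)" for t
  have cl: "cl t \<in> {0..\<epsilon>}" for t using e0 by (auto simp: cl_def)
  have cl_cont: "continuous_on UNIV cl" unfolding cl_def by (intro continuous_intros)
  have Za: "continuous_on T (\<lambda>s. Z (apply_bcontfun a s))" for a :: "real \<Rightarrow>\<^sub>C 'a" and T
    by (rule continuous_on_compose2[OF Z_cont]) auto
  define I where "I a t = y0 + integral {0..cl t} (\<lambda>s. Z (apply_bcontfun a s))" for a :: "real \<Rightarrow>\<^sub>C 'a" and t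
  have I_bound: "norm (I a t - y0) \<le> r" for a t
  proof -
    have "norm (I a t - y0) \<le> K * (cl t - 0)" unfolding I_def
      using cl[of t] by (simp, intro order_trans[OF integral_bound[OF _ Za]]) (auto intro: K)
    also have "\<dots> \<le> K * \<epsilon>" using cl[of t] K0 by (intro mult_left_mono) auto
    finally show ?thesis using eK by simp
  qed
  have I_bcontfun: "I a \<in> bcontfun" for a
  proof -
    have "continuous_on {0..\<epsilon>} (\<lambda>x. integral {0..x} (\<lambda>s. Z (apply_bcontfun a s)))"
      by (intro indefinite_integral_continuous_1 integrable_continuous_real Za)
    then have "continuous_on UNIV (\<lambda>t. integral {0..cl t} (\<lambda>s. Z (apply_bcontfun a s)))"
      by (rule continuous_on_compose2[OF _ cl_cont]) (use cl in auto)
    then have "continuous_on UNIV (I a)" unfolding I_def by (intro continuous_intros)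
    moreover have "bounded (range (I a))"
      using I_bound by (intro boundedI[of _ "norm y0 + r"]) (auto, smt (verit) norm_triangle_sub)
    ultimately show ?thesis by (simp add: bcontfun_def)
  qed
  have app: "apply_bcontfun (Bcontfun (I a)) = I a" for a by (rule Bcontfun_inverse[OF I_bcontfun])
  have "\<exists>!a. Bcontfun (I a) = a"
  proof (rule banach_fix_type[of "1/2"])
    show "\<forall>a b. dist (Bcontfun (I a)) (Bcontfun (I b)) \<le> 1/2 * dist a b"
    proof (intro allI dist_bound)
      fix a b :: "real \<Rightarrow>\<^sub>C 'a" and t
      have "I a t - I b t = integral {0..cl t} (\<lambda>s. Z (apply_bcontfun a s) - Z (apply_bcontfun b s))"
        unfolding I_def by (subst integral_diff) (auto intro!: integrable_continuous_real Za)
      also have "norm \<dots> \<le> (L * dist a b) * (cl t - 0)"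
      proof (rule integral_bound)
        show "norm (Z (apply_bcontfun a s) - Z (apply_bcontfun b s)) \<le> L * dist a b" for s
          using Z_lip[of "apply_bcontfun a s" "apply_bcontfun b s"] dist_bounded[of a s b] L(1)
          by (meson mult_left_mono order_trans)
      qed (use cl[of t] in \<open>auto intro!: continuous_intros Za\<close>)
      also have "\<dots> \<le> (L * dist a b) * \<epsilon>" using cl[of t] L(1) by (intro mult_left_mono) auto
      also have "\<dots> = (L * \<epsilon>) * dist a b" by simp
      also have "\<dots> \<le> 1/2 * dist a b" using eL by (intro mult_right_mono) auto
      finally show "dist (apply_bcontfun (Bcontfun (I a)) t) (apply_bcontfun (Bcontfun (I b)) t) \<le> 1/2 * dist a b"
        by (simp add: app dist_norm)
    qed
  qed auto
  then obtain b where "Bcontfun (I b) = b" by blast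
  then have b: "apply_bcontfun b = I b" using app[of b] by simp
  define a where "a = I b"
  have a_ball: "a t \<in> cball y0 r" for t using I_bound[of b t] by (simp add: a_def dist_norm norm_minus_commute)
  have a_eq: "a t = y0 + integral {0..t} (\<lambda>s. Y (a s))" if "t \<in> {0..\<epsilon>}" for t
  proof -
    have "cl t = t" using that by (simp add: cl_def)
    moreover have "Z (a s) = Y (a s)" for s unfolding Z_def using a_ball[of s] by (simp add: closest_point_self)
    ultimately show ?thesis
      unfolding a_def by (subst I_def) (simp add: b flip: a_def)
  qed
  have Ya: "continuous_on T (\<lambda>s. Y (a s))" for T
  proof (rule continuous_on_compose2[of "cball y0 r" Y])
    show "continuous_on (cball y0 r) Y" using C_infinity_on_continuous[OF Y] r(2) by (rule continuous_on_subset)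
    show "continuous_on T a" unfolding a_def b[symmetric] by simp
  qed (use a_ball in auto)
  show thesis
  proof (rule that[OF e0, of a])
    fix t assume t: "t \<in> {0<..<\<epsilon>}"
    then have t': "t \<in> {0..\<epsilon>}" by auto
    show "a t \<in> A" using a_ball r(2) by auto
    have "((\<lambda>u. integral {0..u} (\<lambda>s. Y (a s))) has_vector_derivative Y (a t)) (at t within {0..\<epsilon>})"
      by (rule integral_has_vector_derivative[OF Ya t'])
    then have "((\<lambda>u. integral {0..u} (\<lambda>s. Y (a s))) has_vector_derivative Y (a t)) (at t)"
      using t by (simp add: at_within_Icc_at)
    then have "((\<lambda>u. y0 + integral {0..u} (\<lambda>s. Y (a s))) has_vector_derivative 0 + Y (a t)) (at t)"
      by (intro has_vector_derivative_add has_vector_derivative_const)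
    then have d: "((\<lambda>u. y0 + integral {0..u} (\<lambda>s. Y (a s))) has_vector_derivative Y (a t)) (at t)" by simp
    show "(a has_vector_derivative Y (a t)) (at t)"
      by (rule has_vector_derivative_transform_within_open[OF d open_greaterThanLessThan t], rule a_eq[symmetric]) simp
    have "integral {0..t} (P \<circ> (\<lambda>s. Y (a s))) = P (integral {0..t} (\<lambda>s. Y (a s)))"
      by (rule integral_linear[OF integrable_continuous_real[OF Ya] P(1)])
    then show "P (a t - y0) = a t - y0" using a_eq[OF t'] by (simp add: o_def P(2))
  qed
qed

text \<open>Bootstrapping: if \<open>a\<close> is \<open>k\<close> times continuously differentiable, then so is its derivative \<open>Y \<circ> a\<close>.\<close>

lemma integral_curve_C_infinity:
  fixes a :: "real \<Rightarrow> 'a::euclidean_space"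
  assumes I: "open I" and A: "open A" and Y: "C_infinity_on A Y"
    and a: "\<And>t. t \<in> I \<Longrightarrow> a t \<in> A" "\<And>t. t \<in> I \<Longrightarrow> (a has_vector_derivative Y (a t)) (at t)"
  shows "C_infinity_on I a"
  unfolding C_infinity_on_def
proof
  fix k show "Ck_on k I a"
  proof (induction k)
    case 0
    have "continuous_on I a" using has_vector_derivative_continuous[OF a(2)]
      by (intro continuous_at_imp_continuous_on) blast
    then show ?case by simp
  next
    case (Suc k)
    show ?case
    proof (rule Ck_on_SucI[OF I])
      show "(a has_derivative (\<lambda>h. h *\<^sub>R Y (a t))) (at t)" if "t \<in> I" for t
        using a(2)[OF that] by (simp add: has_vector_derivative_def)
      have "Ck_on k I (\<lambda>t. Y (a t))"
      proof (rule Ck_on_compose[OF I A, where f = a and g = Y])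
        show "a ` I \<subseteq> A" using a(1) by blast
        show "Ck_on k A Y" using Y unfolding C_infinity_on_def by blast
      qed (rule Suc)
      then show "Ck_on k I (\<lambda>t. h *\<^sub>R Y (a t))" for h
        by (intro Ck_on_bounded_linear_compose[OF I bounded_linear_scaleR_right])
    qed
  qed
qed


section \<open>One-parameter subgroups\<close>

locale lie_group_on = group G for G :: "'g monoid" (structure) +
  fixes GM :: "('g, 'h::euclidean_space) manifold"
  assumes lie: "lie_group G GM"
begin

lemma manifold: "smooth_manifold GM" and topspace_carrier [simp]: "topspace (mtop GM) = carrier G"
  using lie by (auto simp: lie_group_def)

lemma atlas: "smooth_atlas GM"
  by (rule smooth_manifold_imp_smooth_atlas[OF manifold])

lemma smooth_at_carrier: "smooth_at M (mspace GM) f x \<Longrightarrow> f x \<in> carrier G"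
  by (simp add: smooth_at_def)

lemma smooth_at_mult:
  assumes M: "smooth_atlas M" and a: "smooth_at (mspace M) (mspace GM) a x" and b: "smooth_at (mspace M) (mspace GM) b x"
  shows "smooth_at (mspace M) (mspace GM) (\<lambda>y. a y \<otimes> b y) x"
proof -
  have "smooth_at (mspace (prod_manifold GM GM)) (mspace GM) (\<lambda>(a, b). a \<otimes> b) (a x, b x)"
    using lie a b by (intro smooth_map_onD[of _ "carrier G \<times> carrier G"]) (auto simp: lie_group_def smooth_at_def)
  from smooth_at_compose[OF smooth_at_Pair[OF M atlas atlas a b] this] show ?thesis by simp
qed

lemma smooth_at_inv:
  assumes a: "smooth_at M (mspace GM) a x"
  shows "smooth_at M (mspace GM) (\<lambda>y. inv (a y)) x"
proof -
  have "smooth_at (mspace GM) (mspace GM) (\<lambda>a. inv a) (a x)"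
    using lie a by (intro smooth_map_onD[of _ "carrier G"]) (auto simp: lie_group_def smooth_at_def)
  from smooth_at_compose[OF a this] show ?thesis by simp
qed

lemma smooth_at_group_const:
  "smooth_atlas M \<Longrightarrow> x \<in> topspace (mtop M) \<Longrightarrow> g \<in> carrier G \<Longrightarrow> smooth_at (mspace M) (mspace GM) (\<lambda>y. g) x"
  by (intro smooth_at_const) simp_all

lemma smooth_at_group_id: "g \<in> carrier G \<Longrightarrow> smooth_at (mspace GM) (mspace GM) (\<lambda>y. y) g"
  by (intro smooth_at_id) simp

lemma smooth_at_mult_left:
  "g \<in> carrier G \<Longrightarrow> x \<in> carrier G \<Longrightarrow> smooth_at (mspace GM) (mspace GM) (\<lambda>y. g \<otimes> y) x"
  by (intro smooth_at_mult atlas smooth_at_group_const smooth_at_group_id) simp_all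

lemma smooth_at_mult_right:
  "g \<in> carrier G \<Longrightarrow> x \<in> carrier G \<Longrightarrow> smooth_at (mspace GM) (mspace GM) (\<lambda>y. y \<otimes> g) x"
  by (intro smooth_at_mult atlas smooth_at_group_const smooth_at_group_id) simp_all

lemma smooth_at_pow:
  assumes M: "smooth_atlas M" and a: "smooth_at (mspace M) (mspace GM) a x"
  shows "smooth_at (mspace M) (mspace GM) (\<lambda>y. a y [^] (n::nat)) x"
proof (induction n)
  case 0
  show ?case using a by (auto intro!: smooth_at_group_const[OF M] simp: smooth_at_def[of _ _ a])
next
  case (Suc n)
  then show ?case using smooth_at_mult[OF M Suc a] by simp
qed

text \<open>\<open>follows \<xi> \<gamma> t\<close>: at time \<open>t\<close> the curve \<open>\<gamma>\<close> has the velocity prescribed by the left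
  invariant vector field that extends \<open>\<xi>\<close>.\<close>

definition follows :: "'g tangent \<Rightarrow> (real \<Rightarrow> 'g) \<Rightarrow> real \<Rightarrow> bool" where
  "follows \<xi> \<gamma> t \<longleftrightarrow> smooth_at real_line (mspace GM) \<gamma> t \<and>
     (\<forall>f\<in>germs (mspace GM) (\<gamma> t). deriv (\<lambda>s. f (\<gamma> s)) t = \<xi> (\<lambda>x. f (\<gamma> t \<otimes> x)))"

lemma followsD:
  "follows \<xi> \<gamma> t \<Longrightarrow> smooth_at real_line (mspace GM) \<gamma> t"
  "follows \<xi> \<gamma> t \<Longrightarrow> f \<in> germs (mspace GM) (\<gamma> t) \<Longrightarrow> deriv (\<lambda>s. f (\<gamma> s)) t = \<xi> (\<lambda>x. f (\<gamma> t \<otimes> x))"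
  by (auto simp: follows_def)

lemma follows_translate:
  assumes \<xi>: "\<xi> \<in> tangent_space (mspace GM) \<one>" and \<gamma>: "follows \<xi> \<gamma> t" and g: "g \<in> carrier G"
  shows "follows \<xi> (\<lambda>s. g \<otimes> \<gamma> s) t"
  unfolding follows_def
proof (intro conjI ballI)
  note s = followsD(1)[OF \<gamma>]
  have \<gamma>t: "\<gamma> t \<in> carrier G" using s by (rule smooth_at_carrier)
  show "smooth_at real_line (mspace GM) (\<lambda>s. g \<otimes> \<gamma> s) t"
    using smooth_at_compose[OF s smooth_at_mult_left[OF g \<gamma>t]] .
  fix f assume "f \<in> germs (mspace GM) (g \<otimes> \<gamma> t)"
  then have "(\<lambda>x. f (g \<otimes> x)) \<in> germs (mspace GM) (\<gamma> t)"
    by (rule smooth_atD[OF smooth_at_mult_left[OF g \<gamma>t]])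
  from followsD(2)[OF \<gamma> this]
  have "deriv (\<lambda>s. f (g \<otimes> \<gamma> s)) t = \<xi> (\<lambda>x. f (g \<otimes> (\<gamma> t \<otimes> x)))" .
  also have "\<dots> = \<xi> (\<lambda>x. f (g \<otimes> \<gamma> t \<otimes> x))"
    by (rule tangent_local[OF atlas \<xi> openin_topspace]) (simp_all add: m_assoc g \<gamma>t)
  finally show "deriv (\<lambda>s. f (g \<otimes> \<gamma> s)) t = \<xi> (\<lambda>x. f (g \<otimes> \<gamma> t \<otimes> x))" .
qed

lemma deriv_shift: "deriv (\<lambda>u. h (s + u)) t = deriv h (s + t :: real)" for h :: "real \<Rightarrow> real"
  unfolding deriv_def using DERIV_shift[of h _ t s] by (simp add: add.commute)

lemma follows_shift:
  assumes \<gamma>: "follows \<xi> \<gamma> (s + t)"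
  shows "follows \<xi> (\<lambda>u. \<gamma> (s + u)) t"
  unfolding follows_def
proof (intro conjI ballI)
  show "smooth_at real_line (mspace GM) (\<lambda>u. \<gamma> (s + u)) t"
    by (rule smooth_at_compose[OF smooth_at_real_line_shift followsD(1)[OF \<gamma>]])
  show "deriv (\<lambda>u. f (\<gamma> (s + u))) t = \<xi> (\<lambda>x. f (\<gamma> (s + t) \<otimes> x))" if "f \<in> germs (mspace GM) (\<gamma> (s + t))" for f
    using followsD(2)[OF \<gamma> that] deriv_shift[of "\<lambda>u. f (\<gamma> u)"] by simp
qed

text \<open>If \<open>a\<close> and \<open>b\<close> follow \<open>\<xi>\<close>, then \<open>a b\<^sup>-\<^sup>1\<close> has velocity zero: the contributions of the two
  factors cancel because \<open>(a \<gamma>) (b \<gamma>)\<^sup>-\<^sup>1\<close> does not depend on \<open>\<gamma>\<close>.\<close>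

lemma follows_unique:
  assumes \<xi>: "\<xi> \<in> tangent_space (mspace GM) \<one>"
    and J: "open J" "connected J" "t0 \<in> J" "t \<in> J"
    and a: "\<And>t. t \<in> J \<Longrightarrow> follows \<xi> a t" and b: "\<And>t. t \<in> J \<Longrightarrow> follows \<xi> b t"
    and eq: "a t0 = b t0"
  shows "a t = b t"
proof -
  let ?u = "\<lambda>t. a t \<otimes> inv (b t)"
  note R = smooth_atlas_real_mfd
  have sm: "smooth_at real_line (mspace GM) ?u t" if "t \<in> J" for t
    unfolding real_line_eq
    by (intro smooth_at_mult[OF R] smooth_at_inv; fold real_line_eq) (rule followsD(1)[OF a[OF that]] followsD(1)[OF b[OF that]])+
  have ca: "a t \<in> carrier G" and cb: "b t \<in> carrier G" if "t \<in> J" for t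
    using followsD(1)[OF a[OF that]] followsD(1)[OF b[OF that]] by (auto intro: smooth_at_carrier)
  have z: "deriv (\<lambda>s. f (?u s)) t = 0" if t: "t \<in> J" and f: "f \<in> germs (mspace GM) (?u t)" for t f
  proof -
    note c = ca[OF t] cb[OF t]
    have quot: "smooth_at (mspace (prod_manifold GM GM)) (mspace GM) (\<lambda>z. fst z \<otimes> inv (snd z)) (a t, b t)"
      using c by (intro smooth_at_mult smooth_at_inv smooth_at_fst smooth_at_snd smooth_atlas_prod atlas) auto
    have g1: "(\<lambda>z. f (fst z \<otimes> inv (snd z))) \<in> germs (mspace (prod_manifold GM GM)) (a t, b t)"
      using smooth_atD[OF quot, of f] f by simp
    have "deriv (\<lambda>s. f (?u s)) t = deriv (\<lambda>s. f (a s \<otimes> inv (b t))) t + deriv (\<lambda>s. f (a t \<otimes> inv (b s))) t"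
      using deriv_curve_Pair[OF atlas atlas followsD(1)[OF a[OF t]] followsD(1)[OF b[OF t]] g1] by simp
    moreover have "deriv (\<lambda>s. f (a s \<otimes> inv (b t))) t = \<xi> (\<lambda>x. f (a t \<otimes> x \<otimes> inv (b t)))"
    proof -
      have "smooth_at (mspace GM) (mspace GM) (\<lambda>x. x \<otimes> inv (b t)) (a t)"
        using c by (intro smooth_at_mult_right) auto
      from smooth_atD[OF this f] show ?thesis by (rule followsD(2)[OF a[OF t]])
    qed
    moreover have "deriv (\<lambda>s. f (a t \<otimes> inv (b s))) t = \<xi> (\<lambda>x. f (a t \<otimes> inv (b t \<otimes> x)))"
    proof -
      have "smooth_at (mspace GM) (mspace GM) (\<lambda>x. a t \<otimes> inv x) (b t)"
        using c by (intro smooth_at_mult smooth_at_inv smooth_at_group_const smooth_at_group_id atlas) auto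
      from smooth_atD[OF this f] show ?thesis by (rule followsD(2)[OF b[OF t]])
    qed
    moreover have "\<xi> (\<lambda>x. f (a t \<otimes> x \<otimes> inv (b t \<otimes> x))) =
        \<xi> (\<lambda>x. f (a t \<otimes> x \<otimes> inv (b t \<otimes> \<one>))) + \<xi> (\<lambda>x. f (a t \<otimes> \<one> \<otimes> inv (b t \<otimes> x)))"
    proof -
      have "smooth_at (mspace (prod_manifold GM GM)) (mspace GM) (\<lambda>z. a t \<otimes> fst z \<otimes> inv (b t \<otimes> snd z)) (\<one>, \<one>)"
        using c by (intro smooth_at_mult smooth_at_inv smooth_at_fst smooth_at_snd smooth_atlas_prod atlas smooth_at_group_const) auto
      from smooth_atD[OF this, of f] f c
      have "(\<lambda>z. f (a t \<otimes> fst z \<otimes> inv (b t \<otimes> snd z))) \<in> germs (mspace (prod_manifold GM GM)) (\<one>, \<one>)" by simp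
      from tangent_Pair[OF atlas atlas atlas \<xi> smooth_at_group_id smooth_at_group_id this] show ?thesis by simp
    qed
    moreover have "\<xi> (\<lambda>x. f (a t \<otimes> x \<otimes> inv (b t \<otimes> x))) = \<xi> (\<lambda>x. f (a t \<otimes> inv (b t)))"
    proof (rule tangent_local[OF atlas \<xi> openin_topspace])
      show "f (a t \<otimes> x \<otimes> inv (b t \<otimes> x)) = f (a t \<otimes> inv (b t))" if "x \<in> topspace (mtop GM)" for x
      proof -
        have x: "x \<in> carrier G" using that by simp
        have "x \<otimes> (inv x \<otimes> inv (b t)) = inv (b t)" using m_assoc[of x "inv x" "inv (b t)"] c x by simp
        then have "a t \<otimes> x \<otimes> inv (b t \<otimes> x) = a t \<otimes> inv (b t)"
          using c x by (simp add: inv_mult_group m_assoc)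
        then show ?thesis using c x by simp
      qed
    qed simp
    moreover have "\<xi> (\<lambda>x. f (a t \<otimes> inv (b t))) = 0" by (rule tangent_const[OF atlas \<xi>])
    ultimately show ?thesis using c by simp
  qed
  have "?u t = ?u t0" by (rule zero_velocity_imp_constant[OF manifold J(1,2,4,3) sm z])
  also have "?u t0 = \<one>" using eq cb[OF J(3)] by simp
  finally show ?thesis using ca[OF J(4)] cb[OF J(4)] by (metis inv_equality inv_inv inv_closed)
qed

text \<open>In a chart \<open>\<phi>\<close> at the identity, the left invariant field at \<open>x\<close> is the derivative of
  \<open>s \<mapsto> \<phi> (x \<otimes> c0 s)\<close> at \<open>0\<close>, where \<open>c0\<close> is a curve with velocity \<open>\<xi>\<close>. As the group multiplication is
  smooth, this expression extends to a smooth field \<open>X\<close> on an open subset of the ambient Euclidean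
  space. The chart takes values in the subspace \<open>model GM\<close>, and \<open>X\<close> is tangent to it at points of the
  chart; composing \<open>X\<close> with a projection onto the subspace makes every solution that starts in the
  subspace stay there.\<close>

lemma local_curve_exists:
  assumes \<xi>: "\<xi> \<in> tangent_space (mspace GM) \<one>"
  obtains \<gamma> t0 \<delta> where "\<delta> > 0" "\<And>t. \<bar>t - t0\<bar> < \<delta> \<Longrightarrow> follows \<xi> \<gamma> t"
proof -
  obtain c0 where c0: "smooth_at real_line (mspace GM) c0 0" "c0 0 = \<one>" "\<xi> = velocity (mspace GM) c0"
    using tangentE[OF atlas \<xi>] by blast
  obtain U \<phi> where ch: "(U, \<phi>) \<in> atlas GM" "\<one> \<in> U" using smooth_atlasD(1)[OF atlas, of \<one>] by auto
  let ?E = "model GM"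
  have E: "subspace ?E" "openin (top_of_set ?E) (\<phi> ` U)" using manifold ch by (auto simp: smooth_manifold_def)
  have UC: "U \<subseteq> carrier G" using smooth_atlasD(2)[OF atlas ch(1)] by simp
  obtain P where P: "range P \<subseteq> ?E" "linear P" "\<And>v. v \<in> ?E \<Longrightarrow> P v = v"
    using linear_exists_left_inverse_on[OF linear_ident E(1)] by auto
  have bP: "bounded_linear P" using P(2) by (simp add: linear_conv_bounded_linear)
  have PP: "P (P v) = P v" for v using P by auto
  let ?m = "\<lambda>z. \<phi> (fst z \<otimes> c0 (snd z))"
  let ?PM = "prod_manifold GM real_mfd"
  have At: "smooth_atlas ?PM" by (intro smooth_atlas_prod atlas smooth_atlas_real_mfd)
  have "vgerm (mspace ?PM) ?m (\<one>, 0)"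
  proof -
    have "smooth_at (mspace ?PM) (mspace GM) (\<lambda>z. fst z \<otimes> c0 (snd z)) (\<one>, 0)"
    proof (intro smooth_at_mult At smooth_at_fst atlas smooth_atlas_real_mfd)
      show "smooth_at (mspace ?PM) (mspace GM) (\<lambda>z. c0 (snd z)) (\<one>, 0)"
        by (rule smooth_at_compose[of _ "mspace real_mfd" snd])
          (use c0 in \<open>auto intro: smooth_at_snd atlas smooth_atlas_real_mfd simp: real_line_eq\<close>)
    qed simp
    note sm = this
    have "(\<lambda>x. \<phi> x \<bullet> b) \<in> germs (mspace GM) (fst (\<one>, 0::real) \<otimes> c0 (snd (\<one>::'g, 0)))" if "b \<in> Basis" for b
      using chart_vgerm[OF ch] that by (simp add: vgerm_def c0(2))
    from smooth_atD[OF sm this] show ?thesis by (simp add: vgerm_def)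
  qed
  moreover have pc: "(U \<times> UNIV, map_prod \<phi> (\<lambda>x. x)) \<in> atlas ?PM" "(\<one>, 0) \<in> U \<times> UNIV"
    using ch by (auto simp: prod_manifold_def real_mfd_def)
  ultimately obtain A H where A: "open A" "map_prod \<phi> (\<lambda>x. x) (\<one>, 0 :: real) \<in> A" "C_infinity_on A H"
    and H: "\<And>z. z \<in> U \<times> UNIV \<Longrightarrow> map_prod \<phi> (\<lambda>x. x) z \<in> A \<Longrightarrow> ?m z = H (map_prod \<phi> (\<lambda>x. x) z)"
    using vgerm_chart[OF At] by blast
  define A0 where "A0 = (\<lambda>y. (y, 0::real)) -` A"
  have A0: "open A0" "\<phi> \<one> \<in> A0" unfolding A0_def using A by (auto intro!: open_vimage continuous_intros)
  \<comment> \<open>the left invariant field in the chart, read off from an extension \<open>H\<close> of the map \<open>(x, s) \<mapsto> x \<otimes> c0 s\<close>\<close>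
  define X where "X y = frechet_derivative H (at (y, 0)) (0, 1)" for y
  have bl: "bounded_linear (\<lambda>y::'h. (y, 0::real))" by (intro bounded_linear_Pair bounded_linear_ident bounded_linear_zero)
  have X: "C_infinity_on A0 X" unfolding X_def
    by (rule C_infinity_on_compose[OF A0(1) A(1) _ C_infinity_on_frechet_derivative[OF A(3)] C_infinity_on_bounded_linear[OF A0(1) bl]])
      (auto simp: A0_def)
  have X_deriv: "((\<lambda>s. \<phi> (x \<otimes> c0 s)) has_vector_derivative X (\<phi> x)) (at 0)" if x: "x \<in> U" "\<phi> x \<in> A0" for x
  proof -
    have "(H has_derivative frechet_derivative H (at (\<phi> x, 0))) (at (\<phi> x, 0))"
      using C_infinity_on_differentiable[OF A(3)] x by (auto simp: A0_def frechet_derivative_works[symmetric])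
    from has_derivative_compose[where g = H, OF has_derivative_Pair[OF has_derivative_const[of "\<phi> x"] has_derivative_ident[of "at (0::real)"]] this]
    have 1: "((\<lambda>s. H (\<phi> x, s)) has_derivative (\<lambda>h. frechet_derivative H (at (\<phi> x, 0)) (0, h))) (at 0)" .
    have "linear (frechet_derivative H (at (\<phi> x, 0)))"
      using \<open>(H has_derivative _) _\<close> by (rule has_derivative_linear)
    then have "frechet_derivative H (at (\<phi> x, 0)) (0, h) = h *\<^sub>R X (\<phi> x)" for h
      using linear_scale[of "frechet_derivative H (at (\<phi> x, 0))" h "(0, 1)"] by (simp add: X_def)
    then have 2: "((\<lambda>s. H (\<phi> x, s)) has_vector_derivative X (\<phi> x)) (at 0)"
      using 1 by (simp add: has_vector_derivative_def)
    have o: "open ((\<lambda>s. (\<phi> x, s)) -` A)" by (intro open_vimage A(1) continuous_intros)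
    show ?thesis
    proof (rule has_vector_derivative_transform_within_open[OF 2 o])
      show "H (\<phi> x, s) = \<phi> (x \<otimes> c0 s)" if "s \<in> (\<lambda>s. (\<phi> x, s)) -` A" for s
        using H[of "(x, s)"] x that by simp
    qed (use x in \<open>auto simp: A0_def\<close>)
  qed
  have curve: "smooth_at real_line (mspace GM) (\<lambda>s. x \<otimes> c0 s) 0" if "x \<in> carrier G" for x
    by (rule smooth_at_compose[OF c0(1) smooth_at_mult_left[OF that]]) (simp add: c0)
  have xc: "x \<otimes> c0 0 = x" if "x \<in> U" for x using that UC c0(2) by auto
  have X_E: "P (X (\<phi> x)) = X (\<phi> x)" if x: "x \<in> U" "\<phi> x \<in> A0" for x
  proof -
    have "eventually (\<lambda>s. x \<otimes> c0 s \<in> U) (nhds 0)"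
      using x UC xc by (intro curve_eventually[OF atlas curve chart_open[OF atlas ch(1)]]) auto
    then obtain S where S: "open S" "0 \<in> S" "\<And>s. s \<in> S \<Longrightarrow> x \<otimes> c0 s \<in> U" by (auto simp: eventually_nhds)
    have "\<phi> ` U \<subseteq> ?E" using openin_imp_subset[OF E(2)] .
    then have Pe: "P (\<phi> (x \<otimes> c0 s)) = \<phi> (x \<otimes> c0 s)" if "s \<in> S" for s using S(3)[OF that] P(3) by blast
    have "((\<lambda>s. P (\<phi> (x \<otimes> c0 s))) has_vector_derivative P (X (\<phi> x))) (at 0)"
      by (rule bounded_linear.has_vector_derivative[OF bP X_deriv[OF x]])
    then have "((\<lambda>s. \<phi> (x \<otimes> c0 s)) has_vector_derivative P (X (\<phi> x))) (at 0)"
      by (rule has_vector_derivative_transform_within_open[OF _ S(1,2) Pe])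
    then show ?thesis using X_deriv[OF x] by (rule vector_derivative_unique_at)
  qed
  obtain B where B: "open B" "\<phi> ` U = ?E \<inter> B" using E(2) by (auto simp: openin_open)
  define Y where "Y y = P (X y)" for y
  let ?A = "A0 \<inter> B"
  have oA: "open ?A" using A0 B by auto
  have Y: "C_infinity_on ?A Y" unfolding Y_def
    by (rule C_infinity_on_bounded_linear_compose[OF oA bP C_infinity_on_subset[OF X]]) auto
  have "\<phi> \<one> \<in> ?A" using A0 B ch by auto
  obtain \<epsilon> a where \<epsilon>: "\<epsilon> > 0" and a: "\<And>t. t \<in> {0<..<\<epsilon>} \<Longrightarrow> a t \<in> ?A"
      "\<And>t. t \<in> {0<..<\<epsilon>} \<Longrightarrow> (a has_vector_derivative Y (a t)) (at t)"
    and aP: "\<And>t. t \<in> {0<..<\<epsilon>} \<Longrightarrow> P (a t - \<phi> \<one>) = a t - \<phi> \<one>"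
    by (rule integral_curve_exists[OF oA \<open>\<phi> \<one> \<in> ?A\<close> Y bP]) (auto simp: Y_def PP)
  have a_smooth: "C_infinity_on {0<..<\<epsilon>} a"
    by (rule integral_curve_C_infinity[OF _ oA Y a]) auto
  define \<gamma> where "\<gamma> t = inv_into U \<phi> (a t)" for t
  have \<gamma>: "\<gamma> t \<in> U" "\<phi> (\<gamma> t) = a t" if t: "t \<in> {0<..<\<epsilon>}" for t
  proof -
    have "a t - \<phi> \<one> \<in> ?E" using aP[OF t] P(1) by (metis rangeI subsetD)
    moreover have "\<phi> \<one> \<in> ?E" using B(2) ch(2) by auto
    ultimately have "a t \<in> ?E" using subspace_add[OF E(1)] by fastforce
    then have "a t \<in> \<phi> ` U" using B(2) a(1)[OF t] by auto
    then show "\<gamma> t \<in> U" "\<phi> (\<gamma> t) = a t" unfolding \<gamma>_def by (auto intro: inv_into_into f_inv_into_f)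
  qed
  have fol: "follows \<xi> \<gamma> t" if t: "t \<in> {0<..<\<epsilon>}" for t
  proof -
    have sm: "smooth_at real_line (mspace GM) \<gamma> t" unfolding smooth_at_def
    proof (intro conjI ballI)
      show "\<gamma> t \<in> pts (mspace GM)" using \<gamma>[OF t] UC by auto
      fix f assume "f \<in> germs (mspace GM) (\<gamma> t)"
      then obtain C F where C: "open C" "\<phi> (\<gamma> t) \<in> C" "C_infinity_on C F" "\<And>x. x \<in> U \<Longrightarrow> \<phi> x \<in> C \<Longrightarrow> f x = F (\<phi> x)"
        by (rule germ_chart[OF atlas _ ch(1) \<gamma>(1)[OF t]]) blast
      let ?I = "{0<..<\<epsilon>} \<inter> a -` C"
      have o: "open ?I" by (intro continuous_open_preimage C_infinity_on_continuous a_smooth C(1)) simp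
      have "C_infinity_on ?I (\<lambda>s. F (a s))"
        by (rule C_infinity_on_compose[OF o C(1) _ C(3) C_infinity_on_subset[OF a_smooth]]) auto
      then have "C_infinity_on ?I (\<lambda>s. f (\<gamma> s))"
        by (rule C_infinity_on_cong[OF o, rotated]) (use C(4) \<gamma> in auto)
      then show "(\<lambda>s. f (\<gamma> s)) \<in> germs real_line t" using o t C(2) \<gamma>[OF t] by (auto simp: real_line_def)
    qed (simp add: real_line_eq)
    moreover have "deriv (\<lambda>s. f (\<gamma> s)) t = \<xi> (\<lambda>x. f (\<gamma> t \<otimes> x))" if f: "f \<in> germs (mspace GM) (\<gamma> t)" for f
    proof -
      obtain C F where C: "open C" "\<phi> (\<gamma> t) \<in> C" "C_infinity_on C F" "\<And>x. x \<in> U \<Longrightarrow> \<phi> x \<in> C \<Longrightarrow> f x = F (\<phi> x)"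
        using f by (rule germ_chart[OF atlas _ ch(1) \<gamma>(1)[OF t]]) blast
      have F: "F differentiable (at (\<phi> (\<gamma> t)))" by (rule C_infinity_on_differentiable[OF C(3,2)])
      have x: "\<gamma> t \<in> U" "\<phi> (\<gamma> t) \<in> A0" using \<gamma>[OF t] a(1)[OF t] by auto
      have "((\<lambda>s. \<phi> (\<gamma> s)) has_vector_derivative Y (a t)) (at t)"
        by (rule has_vector_derivative_transform_within_open[OF a(2)[OF t] open_greaterThanLessThan t]) (simp add: \<gamma>)
      then have d: "((\<lambda>s. \<phi> (\<gamma> s)) has_vector_derivative X (\<phi> (\<gamma> t))) (at t)"
        using X_E[OF x] \<gamma>(2)[OF t] by (simp add: Y_def)
      have 1: "deriv (\<lambda>s. f (\<gamma> s)) t = frechet_derivative F (at (\<phi> (\<gamma> t))) (X (\<phi> (\<gamma> t)))"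
        by (rule deriv_curve_chart[OF atlas sm ch(1) x(1) C(1,2) F _ d]) (rule C(4))
      have gc: "\<gamma> t \<in> carrier G" using x(1) UC by auto
      have 2: "deriv (\<lambda>s. f (\<gamma> t \<otimes> c0 s)) 0 = frechet_derivative F (at (\<phi> (\<gamma> t \<otimes> c0 0))) (X (\<phi> (\<gamma> t)))"
      proof (rule deriv_curve_chart[OF atlas curve[OF gc] ch(1), where A = C])
        show "f x = F (\<phi> x)" if "x \<in> U" "\<phi> x \<in> C" for x using that by (rule C(4))
      qed (use xc[OF x(1)] x C(1,2) F X_deriv[OF x] in auto)
      have "\<xi> (\<lambda>x. f (\<gamma> t \<otimes> x)) = deriv (\<lambda>s. f (\<gamma> t \<otimes> c0 s)) 0"
        unfolding c0(3)
        by (rule velocity_germ, rule smooth_atD[OF smooth_at_mult_left[OF gc]]) (use c0(2) f gc in auto)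
      then show ?thesis using 1 2 xc[OF x(1)] by simp
    qed
    ultimately show ?thesis by (auto simp: follows_def)
  qed
  show thesis
  proof (rule that[of "\<epsilon> / 2" "\<epsilon> / 2" \<gamma>])
    show "follows \<xi> \<gamma> t" if "\<bar>t - \<epsilon> / 2\<bar> < \<epsilon> / 2" for t
    proof (rule fol)
      have "0 < t" "t < \<epsilon>" using that unfolding abs_less_iff by linarith+
      then show "t \<in> {0<..<\<epsilon>}" by simp
    qed
  qed (use \<epsilon> in auto)
qed

lemma one_parameter_subgroup_carrier:
  assumes "one_parameter_subgroup G (mspace GM) c"
  shows "c t \<in> carrier G" "c 0 = \<one>" "smooth_at real_line (mspace GM) c t"
proof -
  show s: "smooth_at real_line (mspace GM) c t" for t
    using assms unfolding one_parameter_subgroup_def real_line_eq by (intro smooth_map_onD[of _ UNIV]) auto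
  show c: "c t \<in> carrier G" for t using s[of t] by (rule smooth_at_carrier)
  have "c (0 + 0) = c 0 \<otimes> c 0" using assms unfolding one_parameter_subgroup_def by blast
  then show "c 0 = \<one>" using c[of 0] by simp
qed

lemma one_parameter_subgroup_follows:
  assumes c: "one_parameter_subgroup G (mspace GM) c"
  shows "follows (velocity (mspace GM) c) c t"
  unfolding follows_def
proof (intro conjI ballI)
  note C = one_parameter_subgroup_carrier[OF c]
  show "smooth_at real_line (mspace GM) c t" by (rule C(3))
  fix f assume f: "f \<in> germs (mspace GM) (c t)"
  have "(\<lambda>x. f (c t \<otimes> x)) \<in> germs (mspace GM) (c 0)"
    by (rule smooth_atD[OF smooth_at_mult_left]) (use C f in auto)
  then have "velocity (mspace GM) c (\<lambda>x. f (c t \<otimes> x)) = deriv (\<lambda>s. f (c t \<otimes> c s)) 0"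
    by (rule velocity_germ)
  also have "\<dots> = deriv (\<lambda>s. f (c (t + s))) 0"
    using c by (simp add: one_parameter_subgroup_def)
  also have "\<dots> = deriv (\<lambda>s. f (c s)) t" using deriv_shift[of "\<lambda>s. f (c s)" t 0] by simp
  finally show "deriv (\<lambda>s. f (c s)) t = velocity (mspace GM) c (\<lambda>x. f (c t \<otimes> x))" by simp
qed

lemma one_parameter_subgroup_velocity:
  assumes c: "one_parameter_subgroup G (mspace GM) c"
  shows "velocity (mspace GM) c \<in> tangent_space (mspace GM) \<one>"
proof -
  have "smooth_curve (mspace GM) c"
    unfolding smooth_curve_iff[OF atlas] using one_parameter_subgroup_carrier[OF c] by (auto intro: exI[of _ 1])
  then show ?thesis using one_parameter_subgroup_carrier(2)[OF c] by (auto simp: tangent_space_def)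
qed

lemma one_parameter_subgroup_unique:
  assumes c: "one_parameter_subgroup G (mspace GM) c" and d: "one_parameter_subgroup G (mspace GM) d"
    and eq: "velocity (mspace GM) c = velocity (mspace GM) d"
  shows "c = d"
proof
  fix t
  show "c t = d t"
    by (rule follows_unique[OF one_parameter_subgroup_velocity[OF c], of UNIV 0])
      (use one_parameter_subgroup_follows[OF c] one_parameter_subgroup_follows[OF d] eq
        one_parameter_subgroup_carrier(2)[OF c] one_parameter_subgroup_carrier(2)[OF d] in auto)
qed

text \<open>A local homomorphism \<open>c\<close> extends to the real line as \<open>t \<mapsto> c (t / n) ^ n\<close> for any \<open>n\<close> so large that
  \<open>t / n\<close> is in the domain of \<open>c\<close>.\<close>

lemma local_homomorphism_extends:
  assumes \<delta>: "\<delta> > 0" and car: "\<And>t. \<bar>t\<bar> < \<delta> \<Longrightarrow> c t \<in> carrier G"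
    and hom: "\<And>s t. \<bar>s\<bar> < \<delta> \<Longrightarrow> \<bar>t\<bar> < \<delta> \<Longrightarrow> \<bar>s + t\<bar> < \<delta> \<Longrightarrow> c (s + t) = c s \<otimes> c t"
  obtains C where "\<And>t n. n > 0 \<Longrightarrow> \<bar>t\<bar> < real n * \<delta> \<Longrightarrow> C t = c (t / real n) [^] n"
    "\<And>s t. C (s + t) = C s \<otimes> C t"
proof -
  have mult: "c (real j * s) = c s [^] j" if "\<bar>real j * s\<bar> < \<delta>" "\<bar>s\<bar> < \<delta>" for j s
    using that(1)
  proof (induction j)
    case 0
    have "c (0 + 0) = c 0 \<otimes> c 0" using \<delta> by (intro hom) auto
    then show ?case using car[of 0] \<delta> by simp
  next
    case (Suc j)
    have *: "real (Suc j) * s = real j * s + s" by (simp add: algebra_simps)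
    have "\<bar>real j * s\<bar> \<le> \<bar>real (Suc j) * s\<bar>" by (simp add: abs_mult mult_right_mono)
    then have "\<bar>real j * s\<bar> < \<delta>" using Suc.prems by linarith
    then show ?case using Suc hom[of "real j * s" s] that(2) unfolding * by simp
  qed
  have refine: "c (t / real n) [^] n = c (t / real (n * m)) [^] (n * m)"
    if n: "n > 0" "m > 0" "\<bar>t\<bar> < real n * \<delta>" for n m t
  proof -
    have 1: "\<bar>t / real n\<bar> < \<delta>" using n by (simp add: field_simps)
    have "\<bar>t / real (n * m)\<bar> \<le> \<bar>t / real n\<bar>"
      using n by (simp add: abs_divide) (intro divide_left_mono, auto)
    then have 2: "\<bar>t / real (n * m)\<bar> < \<delta>" using 1 by linarith
    have "t / real n = real m * (t / real (n * m))" using n by simp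
    then have "c (t / real n) = c (t / real (n * m)) [^] m" using mult[of m "t / real (n * m)"] 1 2 by simp
    then show ?thesis using nat_pow_pow[OF car[OF 2], of m n] by (simp add: mult.commute)
  qed
  have large: "\<exists>n>0. \<bar>t\<bar> < real n * \<delta>" for t
  proof -
    obtain n where n: "\<bar>t\<bar> / \<delta> < real n" using reals_Archimedean2 by blast
    then have "n > 0" using \<delta> by (cases n) (auto simp: divide_less_0_iff)
    then show ?thesis using n \<delta> by (intro exI[of _ n]) (simp add: field_simps)
  qed
  define N where "N t = (SOME n. n > 0 \<and> \<bar>t\<bar> < real n * \<delta>)" for t
  have N: "N t > 0" "\<bar>t\<bar> < real (N t) * \<delta>" for t
    using someI_ex[OF large[of t]] unfolding N_def by auto
  define C where "C t = c (t / real (N t)) [^] N t" for t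
  have C: "C t = c (t / real n) [^] n" if "n > 0" "\<bar>t\<bar> < real n * \<delta>" for t n
    using refine[OF N(1) that(1) N(2), of t] refine[OF that(1) N(1) that(2), of t]
    by (simp add: C_def mult.commute)
  show thesis
  proof (rule that[OF C])
    fix s t :: real
    obtain n where n: "n > 0" "\<bar>s\<bar> + \<bar>t\<bar> < real n * \<delta>" using large[of "\<bar>s\<bar> + \<bar>t\<bar>"] by auto
    then have nn: "\<bar>s\<bar> < real n * \<delta>" "\<bar>t\<bar> < real n * \<delta>" "\<bar>s + t\<bar> < real n * \<delta>" by linarith+
    then have q: "\<bar>s / real n\<bar> < \<delta>" "\<bar>t / real n\<bar> < \<delta>" "\<bar>s / real n + t / real n\<bar> < \<delta>"
      using n(1) by (simp_all add: field_simps flip: add_divide_distrib)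
    have "c (s / real n) \<otimes> c (t / real n) = c (t / real n) \<otimes> c (s / real n)"
      using hom[OF q] hom[OF q(2,1)] q(3) by (simp add: add.commute)
    then have "(c (s / real n) \<otimes> c (t / real n)) [^] n = c (s / real n) [^] n \<otimes> c (t / real n) [^] n"
      using car q by (intro pow_mult_distrib) auto
    then show "C (s + t) = C s \<otimes> C t"
      using C[OF n(1) nn(1)] C[OF n(1) nn(2)] C[OF n(1) nn(3)] hom[OF q] by (simp add: add_divide_distrib)
  qed
qed

text \<open>A curve that follows \<open>\<xi>\<close> is translated so as to pass through the identity at time \<open>0\<close>. By uniqueness
  it is a local homomorphism, since both \<open>t \<mapsto> c (s + t)\<close> and \<open>t \<mapsto> c s \<otimes> c t\<close> follow \<open>\<xi>\<close>.\<close>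

lemma one_parameter_subgroup_exists:
  assumes \<xi>: "\<xi> \<in> tangent_space (mspace GM) \<one>"
  obtains C where "one_parameter_subgroup G (mspace GM) C" "velocity (mspace GM) C = \<xi>"
proof -
  obtain \<gamma> t0 \<delta> where \<delta>: "\<delta> > 0" and \<gamma>: "\<And>t. \<bar>t - t0\<bar> < \<delta> \<Longrightarrow> follows \<xi> \<gamma> t"
    by (rule local_curve_exists[OF \<xi>]) blast
  have \<gamma>0: "\<gamma> t0 \<in> carrier G" using followsD(1)[OF \<gamma>[of t0]] \<delta> by (auto intro: smooth_at_carrier)
  define c where "c t = inv (\<gamma> t0) \<otimes> \<gamma> (t0 + t)" for t
  have c: "follows \<xi> c t" if "\<bar>t\<bar> < \<delta>" for t
    unfolding c_def using \<gamma>[of "t0 + t"] that \<gamma>0 by (intro follows_translate[OF \<xi>] follows_shift) auto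
  have c0: "c 0 = \<one>" using \<gamma>0 by (simp add: c_def)
  have car: "c t \<in> carrier G" if "\<bar>t\<bar> < \<delta>" for t using followsD(1)[OF c[OF that]] by (rule smooth_at_carrier)
  have hom: "c (s + t) = c s \<otimes> c t" if st: "\<bar>s\<bar> < \<delta>" "\<bar>t\<bar> < \<delta>" "\<bar>s + t\<bar> < \<delta>" for s t
  proof -
    \<comment> \<open>the times at which both curves are defined; an interval that contains \<open>0\<close> and \<open>t\<close>\<close>
    let ?J = "{max (-\<delta>) (-\<delta> - s) <..< min \<delta> (\<delta> - s)}"
    show ?thesis
    proof (rule follows_unique[OF \<xi>, of ?J 0])
      show "follows \<xi> (\<lambda>t. c (s + t)) t" if "t \<in> ?J" for t
        using that by (intro follows_shift c) (auto simp: abs_less_iff)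
      show "follows \<xi> (\<lambda>t. c s \<otimes> c t) t" if "t \<in> ?J" for t
        using that by (intro follows_translate[OF \<xi>] c car st) (auto simp: abs_less_iff)
    qed (use st \<delta> c0 car[OF st(1)] in \<open>auto simp: abs_less_iff\<close>)
  qed
  obtain C where C: "\<And>t n. n > 0 \<Longrightarrow> \<bar>t\<bar> < real n * \<delta> \<Longrightarrow> C t = c (t / real n) [^] n"
    and C_hom: "\<And>s t. C (s + t) = C s \<otimes> C t"
    by (rule local_homomorphism_extends[OF \<delta> car hom]) blast+
  have C_local: "C t = c t" if "\<bar>t\<bar> < \<delta>" for t using C[of 1 t] that car[OF that] by simp
  have C_smooth: "smooth_at real_line (mspace GM) C t" for t
  proof -
    obtain n where n0: "(\<bar>t\<bar> + 1) / \<delta> < real n" using reals_Archimedean2 by blast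
    then have n1: "n > 0" using \<delta> by (cases n) (auto simp: divide_less_0_iff)
    have n: "\<bar>t\<bar> + 1 < real n * \<delta>" using n0 \<delta> by (simp add: field_simps)
    have "\<bar>1 / real n * t\<bar> < \<delta>" using n n1 by (simp add: abs_mult field_simps)
    then have 1: "smooth_at real_line (mspace GM) (\<lambda>t. c (1 / real n * t)) t"
      by (intro smooth_at_compose[OF smooth_at_real_line_scale] followsD(1)[OF c])
    then have 2: "smooth_at (mspace real_mfd) (mspace GM) (\<lambda>t. c (1 / real n * t) [^] n) t"
      by (intro smooth_at_pow[OF smooth_atlas_real_mfd]) (simp add: real_line_eq)
    show ?thesis unfolding real_line_eq
    proof (rule smooth_at_local[OF smooth_atlas_real_mfd 2])
      show "c (1 / real n * y) [^] n = C y" if "y \<in> {t - 1 <..< t + 1}" for y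
      proof -
        have "\<bar>y\<bar> < real n * \<delta>" using that n by (auto simp: abs_less_iff)
        then show ?thesis using C[OF n1] by simp
      qed
    qed auto
  qed
  have one: "one_parameter_subgroup G (mspace GM) C"
    unfolding one_parameter_subgroup_def real_line_eq
    using C_smooth C_hom by (auto intro!: smooth_map_onI[OF smooth_atlas_real_mfd atlas] simp: real_line_eq)
  have "velocity (mspace GM) C f = \<xi> f" for f
  proof (cases "f \<in> germs (mspace GM) \<one>")
    case True
    have "velocity (mspace GM) C f = deriv (\<lambda>t. f (C t)) 0"
      using True C_local[of 0] c0 \<delta> by (intro velocity_germ) simp
    also have "\<dots> = deriv (\<lambda>t. f (c t)) 0"
    proof (rule deriv_cong_ev[OF _ refl])
      have "eventually (\<lambda>t. t \<in> {-\<delta><..<\<delta>}) (nhds 0)" using \<delta> by (intro eventually_nhds_in_open) auto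
      then show "eventually (\<lambda>t. f (C t) = f (c t)) (nhds 0)"
        by eventually_elim (use C_local in \<open>auto simp: abs_less_iff\<close>)
    qed
    also have "\<dots> = \<xi> (\<lambda>x. f (\<one> \<otimes> x))" using followsD(2)[OF c[of 0], of f] True c0 \<delta> by simp
    also have "\<dots> = \<xi> f" by (rule tangent_local[OF atlas \<xi> openin_topspace]) simp_all
    finally show ?thesis .
  next
    case False
    then show ?thesis using tangent_outside[OF \<xi>] C_local[of 0] c0 \<delta> by (simp add: velocity_def)
  qed
  then show thesis using that[OF one] by (auto simp: fun_eq_iff)
qed

lemma deriv_scale:
  fixes h :: "real \<Rightarrow> real"
  assumes "h differentiable (at 0)"
  shows "deriv (\<lambda>u. h (k * u)) 0 = k * deriv h 0"
proof (rule DERIV_imp_deriv)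
  have "(h has_real_derivative deriv h 0) (at (k * 0))"
    using assms by (simp add: DERIV_deriv_iff_real_differentiable)
  moreover have "((\<lambda>u. k * u) has_real_derivative k) (at 0)" by (auto intro!: derivative_eq_intros)
  ultimately have "((\<lambda>u. h (k * u)) has_real_derivative deriv h 0 * k) (at 0)" by (rule DERIV_chain2)
  then show "((\<lambda>u. h (k * u)) has_real_derivative k * deriv h 0) (at 0)" by (simp add: mult.commute)
qed

lemma lie_exp_curve:
  assumes C: "one_parameter_subgroup G (mspace GM) C"
  shows "lie_exp G (mspace GM) (t *\<^sub>R velocity (mspace GM) C) = C t"
proof -
  note CC = one_parameter_subgroup_carrier[OF C]
  have scaled: "one_parameter_subgroup G (mspace GM) (\<lambda>u. C (t * u))"
    unfolding one_parameter_subgroup_def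
  proof (intro conjI allI)
    have "smooth_at real_line (mspace GM) (\<lambda>u. C (t * u)) u" for u
      by (rule smooth_at_compose[OF smooth_at_real_line_scale CC(3)])
    then show "smooth_map_on real_line UNIV (mspace GM) (\<lambda>u. C (t * u))"
      unfolding real_line_eq by (intro smooth_map_onI[OF smooth_atlas_real_mfd atlas]) auto
    show "C (t * (s + u)) = C (t * s) \<otimes> C (t * u)" for s u
      using C by (simp add: one_parameter_subgroup_def distrib_left)
  qed
  have v: "velocity (mspace GM) (\<lambda>u. C (t * u)) = t *\<^sub>R velocity (mspace GM) C"
  proof
    fix f show "velocity (mspace GM) (\<lambda>u. C (t * u)) f = (t *\<^sub>R velocity (mspace GM) C) f"
      using deriv_scale[OF germ_real_line_differentiable[OF smooth_atD[OF CC(3)[of 0]]], of f t]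
      by (simp add: velocity_def scaleR_fun_def)
  qed
  have "(THE c. one_parameter_subgroup G (mspace GM) c \<and> velocity (mspace GM) c = t *\<^sub>R velocity (mspace GM) C) = (\<lambda>u. C (t * u))"
  proof (rule the_equality)
    show "c = (\<lambda>u. C (t * u))"
      if "one_parameter_subgroup G (mspace GM) c \<and> velocity (mspace GM) c = t *\<^sub>R velocity (mspace GM) C" for c
      by (rule one_parameter_subgroup_unique[OF conjunct1[OF that] scaled]) (simp only: conjunct2[OF that] v)
  qed (use scaled v in blast)
  then show ?thesis by (simp add: lie_exp_def)
qed

end


section \<open>Orbits and quotients\<close>

text \<open>A map on an orbit space that is given by \<open>the_elem\<close> of the image of a class takes the value \<open>k\<close> as soon
  as all representatives yield \<open>k\<close>.\<close>

lemma the_elem_orbit: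
  assumes "group G" "\<And>g. g \<in> carrier G \<Longrightarrow> f (\<phi> g z) = k"
  shows "the_elem (f ` orbit G \<phi> z) = k"
proof -
  have "\<one>\<^bsub>G\<^esub> \<in> carrier G" using assms(1) by (simp add: group.is_monoid monoid.one_closed)
  then have "f ` orbit G \<phi> z = {k}" using assms(2) by (auto simp: orbit_def image_iff)
  then show ?thesis by simp
qed

text \<open>In contrast to \<^locale>\<open>group_action\<close>, the values of \<open>\<phi> g\<close> outside \<open>E\<close> are unconstrained, so that
  maps given by an explicit formula, such as the conjugation action on a product, qualify.\<close>

locale set_action = group G for G (structure) +
  fixes E and \<phi>
  assumes act_closed: "g \<in> carrier G \<Longrightarrow> x \<in> E \<Longrightarrow> \<phi> g x \<in> E"
    and act_one: "x \<in> E \<Longrightarrow> \<phi> \<one> x = x"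
    and act_mult: "g \<in> carrier G \<Longrightarrow> h \<in> carrier G \<Longrightarrow> x \<in> E \<Longrightarrow> \<phi> (g \<otimes> h) x = \<phi> g (\<phi> h x)"
begin

lemma act_inv_act: "g \<in> carrier G \<Longrightarrow> x \<in> E \<Longrightarrow> \<phi> (inv g) (\<phi> g x) = x"
  using act_mult[of "inv g" g x] act_one by simp

lemma act_act_inv: "g \<in> carrier G \<Longrightarrow> x \<in> E \<Longrightarrow> \<phi> g (\<phi> (inv g) x) = x"
  using act_mult[of g "inv g" x] act_one by simp

lemma mem_orbit_self: "x \<in> E \<Longrightarrow> x \<in> orbit G \<phi> x"
  using act_one[of x] one_closed by (force simp: orbit_def)

lemma orbit_act: "g \<in> carrier G \<Longrightarrow> x \<in> E \<Longrightarrow> orbit G \<phi> (\<phi> g x) = orbit G \<phi> x"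
proof
  assume g: "g \<in> carrier G" and x: "x \<in> E"
  show "orbit G \<phi> (\<phi> g x) \<subseteq> orbit G \<phi> x"
    using g x by (auto simp: orbit_def act_mult[symmetric])
  show "orbit G \<phi> x \<subseteq> orbit G \<phi> (\<phi> g x)"
  proof
    fix y assume "y \<in> orbit G \<phi> x"
    then obtain h where h: "h \<in> carrier G" "y = \<phi> h x" by (auto simp: orbit_def)
    then have "y = \<phi> (h \<otimes> inv g) (\<phi> g x)" using g x by (simp add: act_mult act_closed act_inv_act)
    then show "y \<in> orbit G \<phi> (\<phi> g x)" using g h by (auto simp: orbit_def)
  qed
qed

lemma orbit_eqE:
  assumes "orbit G \<phi> y = orbit G \<phi> x" "y \<in> E"
  obtains g where "g \<in> carrier G" "y = \<phi> g x"
  using mem_orbit_self[OF assms(2)] unfolding assms(1) by (auto simp: orbit_def)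

end

lemma istopology_quotient:
  "istopology (\<lambda>V. V \<subseteq> orbits G (pts M) l \<and> openin (topo M) {x \<in> pts M. orbit G l x \<in> V})"
  unfolding istopology_def
proof (intro conjI allI impI)
  fix V W assume "V \<subseteq> orbits G (pts M) l \<and> openin (topo M) {x \<in> pts M. orbit G l x \<in> V}"
    "W \<subseteq> orbits G (pts M) l \<and> openin (topo M) {x \<in> pts M. orbit G l x \<in> W}"
  moreover have "{x \<in> pts M. orbit G l x \<in> V \<inter> W} = {x \<in> pts M. orbit G l x \<in> V} \<inter> {x \<in> pts M. orbit G l x \<in> W}" by blast
  ultimately show "V \<inter> W \<subseteq> orbits G (pts M) l" "openin (topo M) {x \<in> pts M. orbit G l x \<in> V \<inter> W}" by auto
next
  fix \<K> assume K: "\<forall>V\<in>\<K>. V \<subseteq> orbits G (pts M) l \<and> openin (topo M) {x \<in> pts M. orbit G l x \<in> V}"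
  then show "\<Union>\<K> \<subseteq> orbits G (pts M) l" by blast
  have "{x \<in> pts M. orbit G l x \<in> \<Union>\<K>} = (\<Union>V\<in>\<K>. {x \<in> pts M. orbit G l x \<in> V})" by blast
  then show "openin (topo M) {x \<in> pts M. orbit G l x \<in> \<Union>\<K>}" using K by auto
qed

lemma openin_quotient:
  "openin (topo (quotient_space G l M)) V \<longleftrightarrow> V \<subseteq> orbits G (pts M) l \<and> openin (topo M) {x \<in> pts M. orbit G l x \<in> V}"
  by (simp add: quotient_space_def topology_inverse'[OF istopology_quotient])

lemma pts_quotient: "pts (quotient_space G l M) = orbits G (pts M) l"
proof
  show "pts (quotient_space G l M) \<subseteq> orbits G (pts M) l"
    unfolding pts_def[of "quotient_space G l M"] using openin_quotient[of G l M] openin_topspace by blast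
  have "{x \<in> pts M. orbit G l x \<in> orbits G (pts M) l} = topspace (topo M)"
    by (auto simp: orbits_def pts_def)
  then have "openin (topo (quotient_space G l M)) (orbits G (pts M) l)"
    by (simp add: openin_quotient)
  then show "orbits G (pts M) l \<subseteq> pts (quotient_space G l M)"
    unfolding pts_def[of "quotient_space G l M"] by (rule openin_subset)
qed

lemma germ_quotientI:
  "(\<And>x. x \<in> r \<Longrightarrow> (\<lambda>y. f (orbit G l y)) \<in> germs M x) \<Longrightarrow> f \<in> germs (quotient_space G l M) r"
  by (simp add: quotient_space_def)

lemma direct_sum2D:
  assumes "direct_sum [A, B] V"
  shows "x \<in> V \<longleftrightarrow> (\<exists>a\<in>A. \<exists>b\<in>B. x = a + b)"
proof -
  have "V = sum_list ` listset [A, B]" using assms by (auto simp: direct_sum_def bij_betw_def)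
  then show ?thesis by (force simp: set_Cons_def image_iff)
qed

lemma direct_sum4D:
  assumes "direct_sum [A, B, C, D] V"
  shows "a \<in> A \<Longrightarrow> b \<in> B \<Longrightarrow> c \<in> C \<Longrightarrow> d \<in> D \<Longrightarrow> a + b + c + d \<in> V"
    and "a \<in> A \<Longrightarrow> b \<in> B \<Longrightarrow> c \<in> C \<Longrightarrow> d \<in> D \<Longrightarrow> a' \<in> A \<Longrightarrow> b' \<in> B \<Longrightarrow> c' \<in> C \<Longrightarrow> d' \<in> D \<Longrightarrow>
      a + b + c + d = a' + b' + c' + d' \<Longrightarrow> a = a' \<and> b = b' \<and> c = c' \<and> d = d'"
proof -
  have V: "V = sum_list ` listset [A, B, C, D]" and inj: "inj_on sum_list (listset [A, B, C, D])"
    using assms by (auto simp: direct_sum_def bij_betw_def)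
  have mem: "[a, b, c, d] \<in> listset [A, B, C, D]" if "a \<in> A" "b \<in> B" "c \<in> C" "d \<in> D" for a b c d
    using that by (auto simp: set_Cons_def)
  show "a + b + c + d \<in> V" if "a \<in> A" "b \<in> B" "c \<in> C" "d \<in> D"
    unfolding V using imageI[OF mem[OF that], of sum_list] by (simp add: add.assoc)
  show "a = a' \<and> b = b' \<and> c = c' \<and> d = d'" if "a \<in> A" "b \<in> B" "c \<in> C" "d \<in> D" "a' \<in> A" "b' \<in> B" "c' \<in> C" "d' \<in> D"
      "a + b + c + d = a' + b' + c' + d'"
    using inj_onD[OF inj _ mem[OF that(1-4)] mem[OF that(5-8)]] that(9) by (simp add: add.assoc)
qed


section \<open>Geometry of the reduction data\<close>

locale nh_reduction =
  fixes S :: "('q, 'e::euclidean_space, 'g, 'h::euclidean_space) nh_reduction_data"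
  assumes system: "nh_discrete_system S"
    and symmetry: "symmetry_group S"
    and connection: "connection_data S"
    and discrete_connection: "affine_discrete_connection S"
begin

abbreviation "Q \<equiv> topspace (mtop (config S))"
abbreviation "C \<equiv> carrier (grp S)"
abbreviation gmult (infixl "\<odot>" 70) where "a \<odot> b \<equiv> a \<otimes>\<^bsub>grp S\<^esub> b"
abbreviation "ginv g \<equiv> inv\<^bsub>grp S\<^esub> g"
abbreviation gone ("\<e>") where "\<e> \<equiv> \<one>\<^bsub>grp S\<^esub>"
abbreviation gact (infixr "\<cdot>" 75) where "g \<cdot> q \<equiv> act S g q"
abbreviation "Ad \<equiv> Adisc S"
abbreviation "T q \<equiv> tangent_space (QS S) q"
abbreviation "dpi q \<equiv> dmap (base S) (qproj S) q"
abbreviation "dact g q \<equiv> dmap (QS S) (act S g) q"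

sublocale lie_group_on "grp S" "grp_mfd S"
proof -
  have "lie_group (grp S) (grp_mfd S)" using symmetry by (simp add: symmetry_group_def)
  then show "lie_group_on (grp S) (grp_mfd S)"
    by (simp add: lie_group_on_def lie_group_on_axioms_def lie_group_def)
qed

lemma manifoldQ: "smooth_manifold (config S)" using system by (simp add: nh_discrete_system_def)

lemma atlasQ: "smooth_atlas (config S)"
  by (rule smooth_manifold_imp_smooth_atlas[OF manifoldQ])

lemma action: "smooth_free_proper_action (grp S) (grp_mfd S) (config S) (act S)"
  using symmetry by (simp add: symmetry_group_def)

sublocale pos: set_action "grp S" Q "act S"
proof -
  interpret group_action "grp S" Q "act S" using action by (simp add: smooth_free_proper_action_def)
  show "set_action (grp S) Q (act S)"
  proof unfold_locales
    show "g \<cdot> x \<in> Q" if "g \<in> C" "x \<in> Q" for g x using element_image[OF that refl] .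
    show "\<e> \<cdot> x = x" if "x \<in> Q" for x using that by (metis id_eq_one restrict_apply')
    show "(g \<odot> h) \<cdot> x = g \<cdot> h \<cdot> x" if "g \<in> C" "h \<in> C" "x \<in> Q" for g h x
      using composition_rule that by simp
  qed
qed

lemma act_free:
  assumes "g \<in> C" "h \<in> C" "q \<in> Q" "g \<cdot> q = h \<cdot> q" shows "g = h"
proof -
  have "(ginv h \<odot> g) \<cdot> q = q" using assms by (simp add: pos.act_mult pos.act_inv_act)
  then have "ginv h \<odot> g = \<e>" using action assms by (auto simp: smooth_free_proper_action_def)
  then show ?thesis using assms by (metis inv_equality inv_inv inv_closed)
qed

lemma smooth_at_act:
  assumes M: "smooth_atlas M" and a: "smooth_at (mspace M) (GS S) a x" and b: "smooth_at (mspace M) (QS S) b x"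
  shows "smooth_at (mspace M) (QS S) (\<lambda>y. a y \<cdot> b y) x"
proof -
  have "smooth_at (mspace (prod_manifold (grp_mfd S) (config S))) (QS S) (\<lambda>(g, q). g \<cdot> q) (a x, b x)"
    using action a b by (intro smooth_map_onD[of _ "C \<times> Q"]) (auto simp: smooth_free_proper_action_def smooth_at_def)
  from smooth_at_compose[OF smooth_at_Pair[OF M atlas atlasQ a b] this] show ?thesis by simp
qed

lemma smooth_at_Q_const:
  "smooth_atlas M \<Longrightarrow> x \<in> topspace (mtop M) \<Longrightarrow> q \<in> Q \<Longrightarrow> smooth_at (mspace M) (QS S) (\<lambda>y. q) x"
  by (intro smooth_at_const) simp_all

lemma smooth_at_Q_id: "q \<in> Q \<Longrightarrow> smooth_at (QS S) (QS S) (\<lambda>y. y) q"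
  by (intro smooth_at_id) simp

lemma smooth_at_orbit_map: "g \<in> C \<Longrightarrow> q \<in> Q \<Longrightarrow> smooth_at (GS S) (QS S) (\<lambda>g. g \<cdot> q) g"
  using smooth_at_act[OF atlas smooth_at_group_id smooth_at_Q_const[OF atlas], of g q] by simp

lemma conj_closed [simp]: "g \<in> C \<Longrightarrow> w \<in> C \<Longrightarrow> conj_by S g w \<in> C"
  by (simp add: conj_by_def)

sublocale con: set_action "grp S" "Q \<times> C" "conj_act S"
proof unfold_locales
  show "conj_act S g z \<in> Q \<times> C" if "g \<in> C" "z \<in> Q \<times> C" for g z
    using that by (auto simp: conj_act_def pos.act_closed)
  show "conj_act S \<e> z = z" if "z \<in> Q \<times> C" for z
    using that by (auto simp: conj_act_def conj_by_def pos.act_one)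
  show "conj_act S (g \<odot> h) z = conj_act S g (conj_act S h z)" if "g \<in> C" "h \<in> C" "z \<in> Q \<times> C" for g h z
    using that by (auto simp: conj_act_def conj_by_def pos.act_mult inv_mult_group m_assoc)
qed

lemma qproj_act [simp]: "g \<in> C \<Longrightarrow> q \<in> Q \<Longrightarrow> qproj S (g \<cdot> q) = qproj S q"
  by (simp add: qproj_def pos.orbit_act)

lemma qproj_eqE:
  assumes "qproj S y = qproj S x" "y \<in> Q" obtains g where "g \<in> C" "y = g \<cdot> x"
  using assms pos.orbit_eqE[of y x] by (auto simp: qproj_def)

lemma mem_qproj: "x \<in> qproj S q \<longleftrightarrow> (\<exists>g\<in>C. x = g \<cdot> q)"
  by (auto simp: qproj_def orbit_def)

lemma mem_qproj_self: "q \<in> Q \<Longrightarrow> q \<in> qproj S q"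
  by (simp add: qproj_def pos.mem_orbit_self)

lemma pts_base: "pts (base S) = qproj S ` Q"
  by (auto simp: base_def pts_quotient orbits_def qproj_def)

lemma qproj_continuous: "continuous_map (mtop (config S)) (topo (base S)) (qproj S)"
  unfolding continuous_map
proof (intro conjI allI impI)
  show "qproj S ` topspace (mtop (config S)) \<subseteq> topspace (topo (base S))"
    using pts_base by (simp add: pts_def)
  show "openin (mtop (config S)) {x \<in> Q. qproj S x \<in> U}" if "openin (topo (base S)) U" for U
    using that by (simp add: base_def openin_quotient qproj_def)
qed

lemma germ_baseI:
  assumes "\<And>g. g \<in> C \<Longrightarrow> (\<lambda>y. f (qproj S y)) \<in> germs (QS S) (g \<cdot> q)"
  shows "f \<in> germs (base S) (qproj S q)"
  unfolding base_def using assms by (intro germ_quotientI) (auto simp: mem_qproj qproj_def[symmetric])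

lemma germ_baseD:
  assumes "f \<in> germs (base S) (qproj S q)" "q \<in> Q"
  shows "(\<lambda>y. f (qproj S y)) \<in> germs (QS S) q"
  using assms mem_qproj_self[OF assms(2)] by (auto simp: base_def quotient_space_def qproj_def)

lemma dpi_germ: "f \<in> germs (base S) (qproj S q) \<Longrightarrow> dpi q v f = v (\<lambda>x. f (qproj S x))"
  by (simp add: dmap_def)

lemma dact_germ: "f \<in> germs (QS S) (g \<cdot> q) \<Longrightarrow> dact g q v f = v (\<lambda>x. f (g \<cdot> x))"
  by (simp add: dmap_def)

subsection \<open>The discrete connection form\<close>

lemma UdomD: assumes "(x, y) \<in> Udom S" shows "x \<in> Q" "y \<in> Q"
  using assms by (auto simp: Udom_def)

lemma Udom_act: "(x, y) \<in> Udom S \<Longrightarrow> g \<in> C \<Longrightarrow> h \<in> C \<Longrightarrow> (g \<cdot> x, h \<cdot> y) \<in> Udom S"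
  by (auto simp: Udom_def pos.act_closed)

lemma Udom_diag: "q \<in> Q \<Longrightarrow> (q, q) \<in> Udom S"
  using discrete_connection pts_base by (auto simp: Udom_def affine_discrete_connection_def)

lemma openin_diag_nbhd: "openin (prod_topology (topo (base S)) (topo (base S))) (diag_nbhd S)"
  using discrete_connection by (simp add: affine_discrete_connection_def)

lemma Udom_slice_left:
  assumes y: "y \<in> Q" shows "openin (mtop (config S)) {x \<in> Q. (x, y) \<in> Udom S}"
proof -
  have "qproj S y \<in> topspace (topo (base S))" using y pts_base by (simp add: pts_def)
  then have "continuous_map (mtop (config S)) (prod_topology (topo (base S)) (topo (base S))) (\<lambda>x. (qproj S x, qproj S y))"
    by (intro continuous_map_pairedI qproj_continuous) simp
  from openin_continuous_map_preimage[OF this openin_diag_nbhd] show ?thesis using y by (simp add: Udom_def)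
qed

lemma Udom_slice_right:
  assumes x: "x \<in> Q" shows "openin (mtop (config S)) {y \<in> Q. (x, y) \<in> Udom S}"
proof -
  have "qproj S x \<in> topspace (topo (base S))" using x pts_base by (simp add: pts_def)
  then have "continuous_map (mtop (config S)) (prod_topology (topo (base S)) (topo (base S))) (\<lambda>y. (qproj S x, qproj S y))"
    by (intro continuous_map_pairedI qproj_continuous) simp
  from openin_continuous_map_preimage[OF this openin_diag_nbhd] show ?thesis using x by (simp add: Udom_def)
qed

lemma Ad_ex1:
  assumes "(x, y) \<in> Udom S"
  shows "\<exists>!g. g \<in> C \<and> (x, ginv g \<cdot> y) \<in> hor S \<inter> nbhd S"
proof -
  have "\<forall>(q0, q1)\<in>Udom S. \<exists>!g. g \<in> C \<and> (q0, ginv g \<cdot> q1) \<in> hor S \<inter> nbhd S"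
    using discrete_connection unfolding affine_discrete_connection_def by (elim conjE)
  from bspec[OF this assms] show ?thesis unfolding prod.case .
qed

lemma Ad_props:
  assumes "(x, y) \<in> Udom S"
  shows "Ad (x, y) \<in> C" "(x, ginv (Ad (x, y)) \<cdot> y) \<in> hor S \<inter> nbhd S"
  using theI'[OF Ad_ex1[OF assms]] by (simp_all add: Adisc_def)

lemma Ad_eqI:
  assumes "(x, y) \<in> Udom S" "g \<in> C" "(x, ginv g \<cdot> y) \<in> hor S \<inter> nbhd S"
  shows "Ad (x, y) = g"
  unfolding Adisc_def prod.case by (rule the1_equality[OF Ad_ex1[OF assms(1)]]) (use assms in blast)

text \<open>By invariance of \<open>hor\<close> and \<open>nbhd\<close>, translating the discretely horizontal pair
  \<open>(x, Ad (x, y)\<^sup>-\<^sup>1 y)\<close> by \<open>g\<close> gives the one that defines \<open>Ad (g x, h y)\<close>.\<close>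

lemma Ad_act:
  assumes xy: "(x, y) \<in> Udom S" and g: "g \<in> C" and h: "h \<in> C"
  shows "Ad (g \<cdot> x, h \<cdot> y) = h \<odot> Ad (x, y) \<odot> ginv g"
proof (rule Ad_eqI[OF Udom_act[OF xy g h]])
  let ?a = "Ad (x, y)"
  have a: "?a \<in> C" using Ad_props[OF xy] by simp
  show "h \<odot> ?a \<odot> ginv g \<in> C" using a g h by simp
  have "ginv (h \<odot> ?a \<odot> ginv g) \<cdot> h \<cdot> y = (g \<odot> ginv ?a \<odot> ginv h) \<cdot> h \<cdot> y"
    using a g h by (simp add: inv_mult_group m_assoc)
  also have "\<dots> = g \<cdot> ginv ?a \<cdot> y"
    using a g h UdomD[OF xy] by (simp add: pos.act_mult pos.act_closed pos.act_inv_act)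
  finally have "(g \<cdot> x, ginv (h \<odot> ?a \<odot> ginv g) \<cdot> h \<cdot> y) = diag_act S g (x, ginv ?a \<cdot> y)"
    by (simp add: diag_act_def)
  moreover have "invariant_set S (hor S)" "invariant_set S (nbhd S)"
    using discrete_connection by (auto simp: affine_discrete_connection_def)
  ultimately show "(g \<cdot> x, ginv (h \<odot> ?a \<odot> ginv g) \<cdot> h \<cdot> y) \<in> hor S \<inter> nbhd S"
    using Ad_props(2)[OF xy] g by (auto simp: invariant_set_def)
qed

lemma Ad_act_right: "(x, y) \<in> Udom S \<Longrightarrow> h \<in> C \<Longrightarrow> Ad (x, h \<cdot> y) = h \<odot> Ad (x, y)"
  using Ad_act[of x y \<e> h] UdomD[of x y] Ad_props[of x y] by (simp add: pos.act_one)

lemma Ad_act_conj: "(x, y) \<in> Udom S \<Longrightarrow> g \<in> C \<Longrightarrow> Ad (g \<cdot> x, g \<cdot> y) = conj_by S g (Ad (x, y))"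
  by (simp add: Ad_act conj_by_def)

lemma smooth_at_Ad:
  assumes M: "smooth_atlas M" and a: "smooth_at (mspace M) (QS S) a z" and b: "smooth_at (mspace M) (QS S) b z"
    and U: "(a z, b z) \<in> Udom S"
  shows "smooth_at (mspace M) (GS S) (\<lambda>y. Ad (a y, b y)) z"
proof -
  have "smooth_at (QQS S) (GS S) Ad (a z, b z)"
    using discrete_connection U
    by (intro smooth_map_onD[of _ "Udom S"]) (auto simp: affine_discrete_connection_def Udom_def)
  from smooth_at_compose[OF smooth_at_Pair[OF M atlasQ atlasQ a b] this] show ?thesis .
qed

text \<open>The element of the orbit of \<open>y\<close> that is discretely horizontal over \<open>x\<close>.\<close>

abbreviation "hrep x y \<equiv> ginv (Ad (x, y)) \<cdot> y"

lemma hrep_closed: "(x, y) \<in> Udom S \<Longrightarrow> hrep x y \<in> Q"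
  using Ad_props UdomD by (simp add: pos.act_closed)

lemma Ad_hrep: "(x, y) \<in> Udom S \<Longrightarrow> Ad (x, y) \<cdot> hrep x y = y"
  using Ad_props UdomD by (simp add: pos.act_act_inv)

lemma hrep_act:
  assumes "(x, y) \<in> Udom S" "g \<in> C" shows "hrep x (g \<cdot> y) = hrep x y"
  using assms Ad_props[OF assms(1)] UdomD[OF assms(1)]
  by (simp add: Ad_act_right inv_mult_group pos.act_mult pos.act_closed pos.act_inv_act)

lemma smooth_at_hrep:
  assumes M: "smooth_atlas M" and a: "smooth_at (mspace M) (QS S) a z" and b: "smooth_at (mspace M) (QS S) b z"
    and U: "(a z, b z) \<in> Udom S"
  shows "smooth_at (mspace M) (QS S) (\<lambda>y. hrep (a y) (b y)) z"
  by (intro smooth_at_act[OF M] smooth_at_inv smooth_at_Ad[OF M] a b U)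

text \<open>This formula for the discrete horizontal lift exhibits its smoothness and is used in place of the
  definition from here on.\<close>

lemma hdisc_eq:
  assumes xy: "(x, y) \<in> Udom S" shows "hdisc S x (qproj S y) = hrep x y"
  unfolding hdisc_def
proof (rule the_equality)
  note a = Ad_props(1)[OF xy] and Q = UdomD[OF xy]
  show "hrep x y \<in> pts (QS S) \<and> qproj S (hrep x y) = qproj S y \<and> Ad (x, hrep x y) = \<e>"
    using hrep_closed[OF xy] Ad_act_right[OF xy, of "ginv (Ad (x, y))"] a Q by simp
  fix z assume z: "z \<in> pts (QS S) \<and> qproj S z = qproj S y \<and> Ad (x, z) = \<e>"
  then obtain g where g: "g \<in> C" "z = g \<cdot> y" using qproj_eqE by auto
  then have "g \<odot> Ad (x, y) = \<e>" using z Ad_act_right[OF xy] by simp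
  then have "g = ginv (Ad (x, y))" using a g by (metis inv_equality inv_inv inv_closed)
  then show "z = hrep x y" using g by simp
qed

lemma F1tilde_eq: "(x, y) \<in> Udom S \<Longrightarrow> F1tilde S x w (qproj S y) = w \<cdot> hrep x y"
  by (simp add: F1tilde_def hdisc_eq)

lemma F1tilde_Ad: "(x, y) \<in> Udom S \<Longrightarrow> F1tilde S x (Ad (x, y)) (qproj S y) = y"
  by (simp add: F1tilde_eq Ad_hrep)

lemma Lcheck_eq: "(x, y) \<in> Udom S \<Longrightarrow> Lcheck S x w (qproj S y) = lagr S (x, w \<cdot> hrep x y)"
  by (simp add: Lcheck_def F1tilde_eq)

lemma lagr_act: "g \<in> C \<Longrightarrow> x \<in> Q \<Longrightarrow> y \<in> Q \<Longrightarrow> lagr S (g \<cdot> x, g \<cdot> y) = lagr S (x, y)"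
  using symmetry by (auto simp: symmetry_group_def diag_act_def)

lemma lagr_germ:
  assumes M: "smooth_atlas M" and a: "smooth_at (mspace M) (QS S) a z" and b: "smooth_at (mspace M) (QS S) b z"
  shows "(\<lambda>y. lagr S (a y, b y)) \<in> germs (mspace M) z"
proof -
  have "smooth_at (QQS S) real_line (lagr S) (a z, b z)"
    using system a b
    by (intro smooth_map_onD[of _ "pts (QQS S)"]) (auto simp: nh_discrete_system_def smooth_at_def)
  moreover have "(\<lambda>t. t) \<in> germs real_line (lagr S (a z, b z))"
    by (auto simp: real_line_def intro!: exI[of _ UNIV] C_infinity_on_bounded_linear bounded_linear_ident)
  ultimately have "lagr S \<in> germs (QQS S) (a z, b z)" using smooth_atD by fastforce
  from smooth_atD[OF smooth_at_Pair[OF M atlasQ atlasQ a b] this] show ?thesis .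
qed

lemma hrep_act_act:
  assumes "(x, y) \<in> Udom S" "g \<in> C" shows "hrep (g \<cdot> x) y = g \<cdot> hrep x y"
proof -
  have "hrep (g \<cdot> x) y = hrep (g \<cdot> x) (g \<cdot> y)"
    using hrep_act[OF Udom_act[OF assms(1) assms(2) one_closed] assms(2)] UdomD[OF assms(1)] by (simp add: pos.act_one)
  also have "\<dots> = g \<cdot> hrep x y"
    using assms Ad_props[OF assms(1)] UdomD[OF assms(1)]
    by (simp add: Ad_act inv_mult_group m_assoc pos.act_mult pos.act_closed pos.act_inv_act)
  finally show ?thesis .
qed

lemma F1tilde_act:
  assumes xy: "(x, y) \<in> Udom S" and g: "g \<in> C" and w: "w \<in> C"
  shows "F1tilde S (g \<cdot> x) (conj_by S g w) (qproj S y) = g \<cdot> F1tilde S x w (qproj S y)"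
proof -
  have "(g \<cdot> x, y) \<in> Udom S" using Udom_act[OF xy g one_closed] UdomD[OF xy] by (simp add: pos.act_one)
  then show ?thesis using assms hrep_closed[OF xy]
    by (simp add: F1tilde_eq hrep_act_act conj_by_def pos.act_mult pos.act_closed pos.act_inv_act)
qed

lemma Lcheck_act:
  assumes xy: "(x, y) \<in> Udom S" and g: "g \<in> C" and w: "w \<in> C"
  shows "Lcheck S (g \<cdot> x) (conj_by S g w) (qproj S y) = Lcheck S x w (qproj S y)"
  unfolding Lcheck_def F1tilde_act[OF assms]
  using assms hrep_closed[OF xy] UdomD[OF xy] by (simp add: lagr_act F1tilde_eq pos.act_closed)

subsection \<open>Vertical vectors\<close>

lemma dpi_vert: 
  assumes v: "v \<in> vert S q" and q: "q \<in> Q" shows "dpi q v = 0"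
proof
  fix f
  show "dpi q v f = 0 f"
  proof (cases "f \<in> germs (base S) (qproj S q)")
    case True
    obtain c \<epsilon> where c: "v = velocity (QS S) c" "c 0 = q" and \<epsilon>: "\<epsilon> > 0" "\<forall>t\<in>{-\<epsilon><..<\<epsilon>}. c t \<in> qproj S q"
      using v by (auto simp: vert_def tangent_sub_def qproj_def)
    have "eventually (\<lambda>t::real. t \<in> {-\<epsilon><..<\<epsilon>}) (nhds 0)" using \<epsilon>(1) by (intro eventually_nhds_in_open) auto
    then have "eventually (\<lambda>t. f (qproj S (c t)) = f (qproj S q)) (nhds 0)"
    proof eventually_elim
      case (elim t)
      then obtain g where "g \<in> C" "c t = g \<cdot> q" using \<epsilon>(2) unfolding mem_qproj by blast
      then show ?case using q by simp
    qed
    then have "deriv (\<lambda>t. f (qproj S (c t))) 0 = 0" using deriv_cong_ev[of _ "\<lambda>t. f (qproj S q)" "0::real" 0] by simp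
    then show ?thesis using True germ_baseD[OF True q] c by (simp add: dpi_germ velocity_germ)
  qed (simp add: dmap_def)
qed

text \<open>The map \<open>x \<mapsto> hrep q x\<close> is constant on orbits, so a vector killed by \<open>d\<pi>\<close> is killed by its
  differential. Since \<open>x = Ad (q, x) \<cdot> hrep q x\<close>, such a vector is the velocity of a curve
  \<open>Ad (q, c t) \<cdot> hrep q q\<close>, which runs inside the orbit of \<open>q\<close>.\<close>

lemma vert_if_dpi_zero:
  assumes v: "v \<in> T q" and z: "dpi q v = 0"
  shows "v \<in> vert S q"
proof -
  have q: "q \<in> Q" using tangent_pts[OF atlasQ v] .
  note qq = Udom_diag[OF q]
  note a = Ad_props(1)[OF qq] and h = hrep_closed[OF qq]
  obtain c where c: "smooth_curve (QS S) c" "smooth_at real_line (QS S) c 0" "c 0 = q" "v = velocity (QS S) c"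
    using tangentE[OF atlasQ v] by blast
  define d where "d t = Ad (q, c t) \<cdot> hrep q q" for t
  have d0: "d 0 = q" using c(3) Ad_hrep[OF qq] by (simp add: d_def)
  have Adq: "smooth_at (QS S) (GS S) (\<lambda>x. Ad (q, x)) x" if "(q, x) \<in> Udom S" for x
    using that UdomD[OF that] by (intro smooth_at_Ad[OF atlasQ] smooth_at_Q_const smooth_at_Q_id atlasQ) auto
  have dx: "smooth_at (QS S) (QS S) (\<lambda>x. Ad (q, x) \<cdot> hrep q q) x" if "(q, x) \<in> Udom S" for x
    using that UdomD[OF that] h by (intro smooth_at_act[OF atlasQ] Adq smooth_at_Q_const atlasQ) auto
  obtain \<epsilon>1 where \<epsilon>1: "\<epsilon>1 > 0" "\<And>t. t \<in> {-\<epsilon>1<..<\<epsilon>1} \<Longrightarrow> smooth_at real_line (QS S) c t"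
    using c(1) smooth_curve_iff[OF atlasQ] by blast
  have "eventually (\<lambda>t. c t \<in> {x \<in> Q. (q, x) \<in> Udom S}) (nhds 0)"
    using qq q c by (intro curve_eventually[OF atlasQ] Udom_slice_right) auto
  then obtain \<epsilon>2 where \<epsilon>2: "\<epsilon>2 > 0" "\<And>t. dist t 0 < \<epsilon>2 \<Longrightarrow> (q, c t) \<in> Udom S"
    unfolding eventually_nhds_metric by blast
  let ?\<epsilon> = "min \<epsilon>1 \<epsilon>2"
  have U: "(q, c t) \<in> Udom S" if "t \<in> {-?\<epsilon><..<?\<epsilon>}" for t using \<epsilon>2(2)[of t] that by (auto simp: dist_real_def abs_less_iff)
  have "smooth_at real_line (QS S) d t" if "t \<in> {-?\<epsilon><..<?\<epsilon>}" for t
    unfolding d_def by (rule smooth_at_compose[OF \<epsilon>1(2) dx[OF U[OF that]]]) (use that in auto)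
  then have d_curve: "smooth_curve (QS S) d"
    unfolding smooth_curve_iff[OF atlasQ] using \<epsilon>1(1) \<epsilon>2(1) by (intro exI[of _ ?\<epsilon>]) auto
  have d_orbit: "d t \<in> qproj S q" if "t \<in> {-?\<epsilon><..<?\<epsilon>}" for t
  proof -
    have "d t = (Ad (q, c t) \<odot> ginv (Ad (q, q))) \<cdot> q"
      using Ad_props(1)[OF U[OF that]] a q by (simp add: d_def pos.act_mult)
    then show ?thesis using Ad_props(1)[OF U[OF that]] a by (auto simp: mem_qproj)
  qed
  have "v f = velocity (QS S) d f" for f
  proof (cases "f \<in> germs (QS S) q")
    case True
    have f': "f \<in> germs (QS S) (Ad (q, q) \<cdot> hrep q q)" using True Ad_hrep[OF qq] by simp
    let ?g = "\<lambda>r. f (Ad (q, q) \<cdot> hdisc S q r)"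
    have hr: "(\<lambda>y. f (Ad (q, q) \<cdot> hrep q y)) \<in> germs (QS S) (k \<cdot> q)" if k: "k \<in> C" for k
    proof -
      have kq: "(q, k \<cdot> q) \<in> Udom S" using Udom_act[OF qq one_closed k] q by (simp add: pos.act_one)
      have "smooth_at (QS S) (QS S) (\<lambda>y. Ad (q, q) \<cdot> hrep q y) (k \<cdot> q)"
        using q k a kq
        by (intro smooth_at_act[OF atlasQ] smooth_at_group_const[OF atlasQ] smooth_at_hrep[OF atlasQ] smooth_at_Q_const smooth_at_Q_id atlasQ)
          (auto simp: pos.act_closed)
      from smooth_atD[OF this] f' show ?thesis by (simp add: hrep_act[OF qq k])
    qed
    have g_germ: "?g \<in> germs (base S) (qproj S q)"
    proof (rule germ_baseI)
      fix k assume k: "k \<in> C"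
      have kq: "(q, k \<cdot> q) \<in> Udom S" using Udom_act[OF qq one_closed k] q by (simp add: pos.act_one)
      show "(\<lambda>y. ?g (qproj S y)) \<in> germs (QS S) (k \<cdot> q)"
        by (rule germ_local[OF atlasQ hr[OF k] Udom_slice_right[OF q]])
          (use kq k q in \<open>auto simp: hdisc_eq pos.act_closed\<close>)
    qed
    have "v (\<lambda>x. f (Ad (q, q) \<cdot> hrep q x)) = v (\<lambda>x. ?g (qproj S x))"
      by (rule tangent_local[OF atlasQ v Udom_slice_right[OF q]]) (use q qq in \<open>auto simp: hdisc_eq\<close>)
    also have "\<dots> = 0" using z dpi_germ[OF g_germ, of v] by simp
    finally have 2: "v (\<lambda>x. f (Ad (q, q) \<cdot> hrep q x)) = 0" .
    have F: "(\<lambda>z. f (fst z \<cdot> snd z)) \<in> germs (mspace (prod_manifold (grp_mfd S) (config S))) (Ad (q, q), hrep q q)"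
    proof -
      have "smooth_at (mspace (prod_manifold (grp_mfd S) (config S))) (QS S) (\<lambda>z. fst z \<cdot> snd z) (Ad (q, q), hrep q q)"
        using a h by (intro smooth_at_act smooth_atlas_prod smooth_at_fst smooth_at_snd atlas atlasQ) auto
      from smooth_atD[OF this] f' show ?thesis by simp
    qed
    have "v f = v (\<lambda>x. f (Ad (q, x) \<cdot> hrep q x))"
      by (rule tangent_local[OF atlasQ v Udom_slice_right[OF q]]) (use q qq in \<open>auto simp: Ad_hrep\<close>)
    also have "\<dots> = v (\<lambda>x. f (Ad (q, x) \<cdot> hrep q q)) + v (\<lambda>x. f (Ad (q, q) \<cdot> hrep q x))"
      using tangent_Pair[OF atlasQ atlas atlasQ v Adq[OF qq] smooth_at_hrep[OF atlasQ smooth_at_Q_const[OF atlasQ q q] smooth_at_Q_id[OF q] qq] F]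
      by simp
    also have "v (\<lambda>x. f (Ad (q, x) \<cdot> hrep q q)) = deriv (\<lambda>t. f (d t)) 0"
      using smooth_atD[OF dx[OF qq] f'] c by (simp add: velocity_germ d_def)
    also have "deriv (\<lambda>t. f (d t)) 0 = velocity (QS S) d f" using True d0 by (simp add: velocity_germ)
    finally show ?thesis using 2 by simp
  next
    case False
    then show ?thesis using tangent_outside[OF v] d0 by (simp add: velocity_def)
  qed
  then have "v = velocity (QS S) d" by (rule ext)
  moreover have "\<exists>\<epsilon>>0. \<forall>t\<in>{-\<epsilon><..<\<epsilon>}. d t \<in> orbit (grp S) (act S) q"
    using \<epsilon>1(1) \<epsilon>2(1) d_orbit by (intro exI[of _ ?\<epsilon>]) (auto simp: qproj_def)
  ultimately show ?thesis using d_curve d0 unfolding vert_def tangent_sub_def by blast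
qed

lemma vert_tangent: "v \<in> vert S q \<Longrightarrow> v \<in> T q"
  by (auto simp: vert_def tangent_sub_def tangent_space_def)

lemma inf_gen_eq:
  assumes \<xi>: "\<xi> \<in> lie_alg S" and q: "q \<in> Q"
  shows "inf_gen S \<xi> q = dmap (QS S) (\<lambda>g. g \<cdot> q) \<e> \<xi>" and "inf_gen S \<xi> q \<in> vert S q"
proof -
  obtain c where c: "one_parameter_subgroup (grp S) (GS S) c" "velocity (GS S) c = \<xi>"
    using one_parameter_subgroup_exists \<xi> unfolding lie_alg_def by blast
  note cc = one_parameter_subgroup_carrier[OF c(1)]
  have e: "inf_gen S \<xi> q = velocity (QS S) (\<lambda>t. c t \<cdot> q)"
    unfolding inf_gen_def c(2)[symmetric] lie_exp_curve[OF c(1)] ..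
  show "inf_gen S \<xi> q = dmap (QS S) (\<lambda>g. g \<cdot> q) \<e> \<xi>"
  proof
    fix f
    have "(\<lambda>g. f (g \<cdot> q)) \<in> germs (GS S) (c 0)" if "f \<in> germs (QS S) (\<e> \<cdot> q)"
      using smooth_atD[OF smooth_at_orbit_map[OF one_closed q] that] cc by simp
    then show "inf_gen S \<xi> q f = dmap (QS S) (\<lambda>g. g \<cdot> q) \<e> \<xi> f"
      unfolding e unfolding c(2)[symmetric] by (auto simp: dmap_def velocity_def cc(2))
  qed
  have "smooth_at real_line (QS S) (\<lambda>t. c t \<cdot> q) t" for t
    by (rule smooth_at_compose[OF cc(3) smooth_at_orbit_map[OF cc(1) q]])
  then have "smooth_curve (QS S) (\<lambda>t. c t \<cdot> q)" unfolding smooth_curve_iff[OF atlasQ] by (auto intro: exI[of _ 1])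
  moreover have "c 0 \<cdot> q = q" using cc(2) q by (simp add: pos.act_one)
  moreover have "c t \<cdot> q \<in> orbit (grp S) (act S) q" for t using cc(1) by (auto simp: orbit_def)
  ultimately show "inf_gen S \<xi> q \<in> vert S q"
    unfolding e vert_def tangent_sub_def by (auto intro!: exI[of _ "\<lambda>t. c t \<cdot> q"] exI[of _ 1])
qed

lemma inf_gen_germ:
  "\<xi> \<in> lie_alg S \<Longrightarrow> q \<in> Q \<Longrightarrow> f \<in> germs (QS S) q \<Longrightarrow> inf_gen S \<xi> q f = \<xi> (\<lambda>g. f (g \<cdot> q))"
  by (simp add: inf_gen_eq(1) dmap_def pos.act_one)

text \<open>The group element that carries \<open>q\<close> to a point \<open>x\<close> of its orbit is \<open>Ad (q, x) Ad (q, q)\<^sup>-\<^sup>1\<close>, hence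
  depends smoothly on \<open>x\<close>.\<close>

lemma vertE:
  assumes v: "v \<in> vert S q" and q: "q \<in> Q"
  obtains \<xi> where "\<xi> \<in> lie_alg S" "v = inf_gen S \<xi> q"
proof -
  note qq = Udom_diag[OF q]
  note a = Ad_props(1)[OF qq]
  obtain c \<epsilon>1 where c: "v = velocity (QS S) c" "c 0 = q" "smooth_curve (QS S) c"
    and \<epsilon>1: "\<epsilon>1 > 0" "\<forall>t\<in>{-\<epsilon>1<..<\<epsilon>1}. c t \<in> qproj S q"
    using v by (auto simp: vert_def tangent_sub_def qproj_def)
  obtain \<epsilon>2 where \<epsilon>2: "\<epsilon>2 > 0" "\<And>t. t \<in> {-\<epsilon>2<..<\<epsilon>2} \<Longrightarrow> smooth_at real_line (QS S) c t"
    using c(3) smooth_curve_iff[OF atlasQ] by blast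
  let ?\<epsilon> = "min \<epsilon>1 \<epsilon>2"
  define g where "g t = Ad (q, c t) \<odot> ginv (Ad (q, q))" for t
  have gt: "g t \<in> C" "g t \<cdot> q = c t" "(q, c t) \<in> Udom S" if t: "t \<in> {-?\<epsilon><..<?\<epsilon>}" for t
  proof -
    have "t \<in> {-\<epsilon>1<..<\<epsilon>1}" using t by auto
    then obtain h where h: "h \<in> C" "c t = h \<cdot> q" using \<epsilon>1(2) unfolding mem_qproj by blast
    have "g t = h" using h a by (simp add: g_def Ad_act_right[OF qq] m_assoc)
    then show "g t \<in> C" "g t \<cdot> q = c t" using h by auto
    show "(q, c t) \<in> Udom S" using Udom_act[OF qq one_closed h(1)] h q by (simp add: pos.act_one)
  qed
  have "smooth_at real_line (GS S) g t" if t: "t \<in> {-?\<epsilon><..<?\<epsilon>}" for t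
  proof -
    have "c t \<in> Q" using UdomD gt(3)[OF t] by blast
    then have "smooth_at (QS S) (GS S) (\<lambda>x. Ad (q, x) \<odot> ginv (Ad (q, q))) (c t)"
      using gt(3)[OF t] q a
      by (intro smooth_at_mult[OF atlasQ] smooth_at_Ad[OF atlasQ] smooth_at_group_const[OF atlasQ] smooth_at_Q_const smooth_at_Q_id atlasQ) auto
    then show ?thesis unfolding g_def using t by (intro smooth_at_compose[OF \<epsilon>2(2), of t]) auto
  qed
  then have gc: "smooth_curve (GS S) g"
    unfolding smooth_curve_iff[OF atlas] using \<epsilon>1(1) \<epsilon>2(1) by (intro exI[of _ ?\<epsilon>]) auto
  have g0: "g 0 = \<e>" using a c(2) by (simp add: g_def)
  let ?\<xi> = "velocity (GS S) g"
  have \<xi>: "?\<xi> \<in> lie_alg S" unfolding lie_alg_def tangent_space_def using gc g0 by blast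
  have "v f = inf_gen S ?\<xi> q f" for f
  proof (cases "f \<in> germs (QS S) q")
    case True
    have "(\<lambda>g. f (g \<cdot> q)) \<in> germs (GS S) \<e>"
      using smooth_atD[OF smooth_at_orbit_map[OF one_closed q], of f] True q by (simp add: pos.act_one)
    then have "inf_gen S ?\<xi> q f = deriv (\<lambda>t. f (g t \<cdot> q)) 0"
      using inf_gen_germ[OF \<xi> q True] g0 by (simp add: velocity_germ)
    also have "\<dots> = deriv (\<lambda>t. f (c t)) 0"
    proof (rule deriv_cong_ev[OF _ refl])
      have "eventually (\<lambda>t::real. t \<in> {-?\<epsilon><..<?\<epsilon>}) (nhds 0)"
        using \<epsilon>1(1) \<epsilon>2(1) by (intro eventually_nhds_in_open) auto
      then show "eventually (\<lambda>t. f (g t \<cdot> q) = f (c t)) (nhds 0)"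
        by eventually_elim (simp add: gt(2))
    qed
    finally show ?thesis using True c by (simp add: velocity_germ)
  next
    case False
    then show ?thesis
      using tangent_outside[OF vert_tangent[OF v]] tangent_outside[OF vert_tangent[OF inf_gen_eq(2)[OF \<xi> q]]] by simp
  qed
  then show thesis using that[OF \<xi>] by blast
qed

lemma zero_vert: "q \<in> Q \<Longrightarrow> 0 \<in> vert S q"
proof -
  assume q: "q \<in> Q"
  have "smooth_curve (QS S) (\<lambda>t. q)" unfolding smooth_curve_iff[OF atlasQ] real_line_eq
    using q by (intro exI[of _ 1]) (auto intro: smooth_at_Q_const smooth_atlas_real_mfd)
  moreover have "velocity (QS S) (\<lambda>t. q) = 0" by (auto simp: velocity_def fun_eq_iff)
  moreover have "q \<in> orbit (grp S) (act S) q" by (rule pos.mem_orbit_self[OF q])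
  ultimately show ?thesis unfolding vert_def tangent_sub_def
    by (auto intro!: exI[of _ "\<lambda>t::real. q"] exI[of _ "1::real"])
qed

subsection \<open>The horizontal lift\<close>

lemma bundles:
  assumes "q \<in> Q"
  shows "subspace (bdl_W S q)" "subspace (bdl_U S q)" "subspace (bdl_H S q)" "subspace (cstr S q)"
    "cstr S q \<subseteq> T q"
  using connection system assms by (auto simp: connection_data_def nh_discrete_system_def subbundle_def)

lemma splittings:
  assumes "q \<in> Q"
  shows "direct_sum [vert_distr S q, bdl_H S q] (cstr S q)"
    "direct_sum [vert_distr S q, bdl_U S q] (vert S q)"
    "direct_sum [bdl_W S q, bdl_U S q, vert_distr S q, bdl_H S q] (T q)"
  using connection assms by (auto simp: connection_data_def)

lemma zero_vert_distr: "q \<in> Q \<Longrightarrow> 0 \<in> vert_distr S q"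
  using zero_vert bundles(4) by (auto simp: vert_distr_def subspace_0)

lemma horizontal_tangent:
  assumes "q \<in> Q" "v \<in> horizontal S q" shows "v \<in> T q"
proof -
  obtain w h where "w \<in> bdl_W S q" "h \<in> bdl_H S q" "v = w + h" using assms(2) by (auto simp: horizontal_def)
  then show ?thesis
    using direct_sum4D(1)[OF splittings(3)[OF assms(1)] _ subspace_0[OF bundles(2)[OF assms(1)]] zero_vert_distr[OF assms(1)], of w h]
    by simp
qed

text \<open>Horizontal and vertical vectors lie in complementary summands of the splitting of the tangent space.\<close>

lemma horizontal_vert:
  assumes q: "q \<in> Q" and v: "v \<in> horizontal S q" "v \<in> vert S q" shows "v = 0"
proof -
  obtain w h where wh: "w \<in> bdl_W S q" "h \<in> bdl_H S q" "v = w + h" using v(1) by (auto simp: horizontal_def)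
  obtain s u where su: "s \<in> vert_distr S q" "u \<in> bdl_U S q" "v = s + u"
    using v(2) direct_sum2D[OF splittings(2)[OF q]] by blast
  note z = subspace_0[OF bundles(1)[OF q]] subspace_0[OF bundles(2)[OF q]] zero_vert_distr[OF q] subspace_0[OF bundles(3)[OF q]]
  have "w + 0 + 0 + h = 0 + u + s + 0" using wh su by (simp add: add.commute)
  then have "w = 0 \<and> 0 = u \<and> 0 = s \<and> h = 0"
    by (rule direct_sum4D(2)[OF splittings(3)[OF q] wh(1) z(2,3) wh(2) z(1) su(2,1) z(4)])
  then show ?thesis using wh by simp
qed

lemma dmap_diff: "dmap N f p (v - w) = dmap N f p v - dmap N f p w"
  by (auto simp: dmap_def fun_eq_iff)

text \<open>Two horizontal vectors with the same projection differ by a vertical one, which is horizontal, hence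
  zero.\<close>

lemma hlift_dpi:
  assumes q: "q \<in> Q" and v: "v \<in> horizontal S q" shows "hlift S q (dpi q v) = v"
  unfolding hlift_def
proof (rule the_equality)
  fix v' assume v': "v' \<in> horizontal S q \<and> dpi q v' = dpi q v"
  obtain w h where wh: "w \<in> bdl_W S q" "h \<in> bdl_H S q" "v = w + h" using v by (auto simp: horizontal_def)
  obtain w' h' where wh': "w' \<in> bdl_W S q" "h' \<in> bdl_H S q" "v' = w' + h'" using v' by (auto simp: horizontal_def)
  have "v' - v = (w' - w) + (h' - h)" using wh wh' by simp
  moreover have "w' - w \<in> bdl_W S q" "h' - h \<in> bdl_H S q"
    using wh wh' bundles[OF q] by (auto intro: subspace_diff)
  ultimately have d: "v' - v \<in> horizontal S q" unfolding horizontal_def by blast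
  have "dpi q (v' - v) = 0" using v' by (simp add: dmap_diff)
  then have "v' - v \<in> vert S q" by (rule vert_if_dpi_zero[OF horizontal_tangent[OF q d]])
  then show "v' = v" using horizontal_vert[OF q d] by simp
qed (use v in auto)

lemma bdl_H_horizontal:
  assumes q: "q \<in> Q" and h: "h \<in> bdl_H S q" shows "h \<in> horizontal S q"
proof -
  have "h = 0 + h" by simp
  then show ?thesis using h subspace_0[OF bundles(1)[OF q]] unfolding horizontal_def by blast
qed

lemma bdl_H_cstr:
  assumes q: "q \<in> Q" and h: "h \<in> bdl_H S q" shows "h \<in> cstr S q"
proof -
  have "h = 0 + h" by simp
  then show ?thesis using h zero_vert_distr[OF q] direct_sum2D[OF splittings(1)[OF q]] by blast
qed

lemma cstr_act:
  assumes "g \<in> C" "q \<in> Q" shows "dact g q ` cstr S q = cstr S (g \<cdot> q)"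
  using symmetry assms by (auto simp: symmetry_group_def invariant_distr_def)

lemma bdl_H_act:
  assumes "g \<in> C" "q \<in> Q" shows "dact g q ` bdl_H S q = bdl_H S (g \<cdot> q)"
  using connection assms by (auto simp: connection_data_def invariant_distr_def)

lemma dpi_dact:
  assumes g: "g \<in> C" and v: "v \<in> T q"
  shows "dpi (g \<cdot> q) (dact g q v) = dpi q v"
proof
  fix f
  have q: "q \<in> Q" using tangent_pts[OF atlasQ v] .
  show "dpi (g \<cdot> q) (dact g q v) f = dpi q v f"
  proof (cases "f \<in> germs (base S) (qproj S q)")
    case True
    have "(\<lambda>x. f (qproj S x)) \<in> germs (QS S) (g \<cdot> q)"
      using True g q by (intro germ_baseD) (auto simp: pos.act_closed)
    then have "dpi (g \<cdot> q) (dact g q v) f = v (\<lambda>x. f (qproj S (g \<cdot> x)))"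
      using True g q by (simp add: dpi_germ dact_germ)
    also have "\<dots> = v (\<lambda>x. f (qproj S x))"
      by (rule tangent_local[OF atlasQ v openin_topspace q]) (simp add: g)
    finally show ?thesis using True by (simp add: dpi_germ)
  qed (use g q in \<open>simp add: dmap_def\<close>)
qed

lemma cstr_split:
  assumes q: "q \<in> Q" and v: "v \<in> cstr S q"
  obtains s h where "s \<in> vert S q" "s \<in> cstr S q" "h \<in> bdl_H S q" "v = s + h" "dpi q v = dpi q h"
proof -
  obtain s h where sh: "s \<in> vert_distr S q" "h \<in> bdl_H S q" "v = s + h"
    using v direct_sum2D[OF splittings(1)[OF q]] by blast
  moreover have "dpi q v = dpi q h" using sh dpi_vert[OF _ q, of s] by (simp add: dmap_add vert_distr_def)
  ultimately show thesis using that by (auto simp: vert_distr_def)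
qed

lemma dpi_cstr_hat: "q \<in> Q \<Longrightarrow> v \<in> cstr S q \<Longrightarrow> dpi q v \<in> cstr_hat S (qproj S q)"
  unfolding cstr_hat_def using mem_qproj_self by blast

text \<open>A vector of the reduced distribution may be represented at any point of the fibre, by invariance of
  \<open>cstr\<close>; its lift is the component in \<open>bdl_H\<close> of a representative, the other component being
  vertical. So lifts of reduced admissible vectors are admissible.\<close>

lemma hlift_cstr_hat:
  assumes q: "q \<in> Q" and u: "u \<in> cstr_hat S (qproj S q)"
  shows "hlift S q u \<in> bdl_H S q" "dpi q (hlift S q u) = u"
proof -
  obtain q' v where v: "q' \<in> qproj S q" "v \<in> cstr S q'" "u = dpi q' v" using u by (auto simp: cstr_hat_def)
  obtain g where g: "g \<in> C" "q' = g \<cdot> q" using v(1) by (auto simp: mem_qproj)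
  obtain v0 where v0: "v0 \<in> cstr S q" "v = dact g q v0" using v(2) cstr_act[OF g(1) q] g(2) by blast
  have "u = dpi q v0" using v g v0 dpi_dact[OF g(1), of v0 q] bundles(5)[OF q] by auto
  moreover obtain s h where "h \<in> bdl_H S q" "dpi q v0 = dpi q h" by (rule cstr_split[OF q v0(1)])
  ultimately show "hlift S q u \<in> bdl_H S q" "dpi q (hlift S q u) = u"
    using hlift_dpi[OF q bdl_H_horizontal[OF q]] by auto
qed

lemma hlift_act:
  assumes q: "q \<in> Q" and g: "g \<in> C" and u: "u \<in> cstr_hat S (qproj S q)"
  shows "hlift S (g \<cdot> q) u = dact g q (hlift S q u)"
proof -
  note h = hlift_cstr_hat[OF q u]
  have "dact g q (hlift S q u) \<in> bdl_H S (g \<cdot> q)" using h(1) bdl_H_act[OF g q] by blast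
  then have "hlift S (g \<cdot> q) (dpi (g \<cdot> q) (dact g q (hlift S q u))) = dact g q (hlift S q u)"
    using g q by (intro hlift_dpi bdl_H_horizontal) (auto simp: pos.act_closed)
  moreover have "hlift S q u \<in> T q" using h(1) q by (intro horizontal_tangent bdl_H_horizontal)
  ultimately show ?thesis using dpi_dact[OF g] h(2) by simp
qed

lemma hlift_zero: "q \<in> Q \<Longrightarrow> hlift S q 0 = 0"
  using hlift_dpi[OF _ bdl_H_horizontal, of q 0] subspace_0[OF bundles(3), of q] dpi_vert[OF zero_vert, of q]
  by simp

lemma zero_cstr_hat: "q \<in> Q \<Longrightarrow> 0 \<in> cstr_hat S (qproj S q)"
  using dpi_cstr_hat[OF _ subspace_0[OF bundles(4)], of q] dpi_vert[OF zero_vert, of q] by simp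

lemma gD_fiberD:
  assumes "\<xi> \<in> gD_fiber S q" shows "\<xi> \<in> lie_alg S" "inf_gen S \<xi> q \<in> cstr S q" "q \<in> Q"
  using assms by (auto simp: gD_fiber_def gD_def)

lemma zero_gD_fiber:
  assumes q: "q \<in> Q" shows "0 \<in> gD_fiber S q" "inf_gen S 0 q = 0"
proof -
  have "smooth_curve (GS S) (\<lambda>t. \<e>)" unfolding smooth_curve_iff[OF atlas] real_line_eq
    by (intro exI[of _ 1]) (auto intro: smooth_at_group_const smooth_atlas_real_mfd)
  moreover have "velocity (GS S) (\<lambda>t. \<e>) = 0" by (auto simp: velocity_def fun_eq_iff)
  ultimately have 0: "0 \<in> lie_alg S" unfolding lie_alg_def tangent_space_def by (auto intro!: exI[of _ "\<lambda>t. \<e>"])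
  show z: "inf_gen S 0 q = 0" using inf_gen_eq(1)[OF 0 q] by (auto simp: dmap_def fun_eq_iff)
  show "0 \<in> gD_fiber S q" using 0 z q subspace_0[OF bundles(4)[OF q]] by (simp add: gD_fiber_def gD_def)
qed

text \<open>An admissible velocity splits into an infinitesimal symmetry and a horizontal lift; this is
  what separates the equations of motion into a vertical and a horizontal part.\<close>

lemma cstr_decompose:
  assumes q: "q \<in> Q" and v: "v \<in> cstr S q"
  obtains u \<xi> where "u \<in> cstr_hat S (qproj S q)" "\<xi> \<in> gD_fiber S q" "v = hlift S q u + inf_gen S \<xi> q"
proof -
  obtain s h where sh: "s \<in> vert S q" "s \<in> cstr S q" "h \<in> bdl_H S q" "v = s + h"
    by (rule cstr_split[OF q v])
  obtain \<xi> where \<xi>: "\<xi> \<in> lie_alg S" "s = inf_gen S \<xi> q" by (rule vertE[OF sh(1) q])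
  show thesis
  proof (rule that)
    show "dpi q h \<in> cstr_hat S (qproj S q)" by (rule dpi_cstr_hat[OF q bdl_H_cstr[OF q sh(3)]])
    show "\<xi> \<in> gD_fiber S q" using \<xi> sh(2) q by (simp add: gD_fiber_def gD_def)
    show "v = hlift S q (dpi q h) + inf_gen S \<xi> q"
      using sh \<xi> hlift_dpi[OF q bdl_H_horizontal[OF q sh(3)]] by (simp add: add.commute)
  qed
qed

lemma hlift_cstr: "q \<in> Q \<Longrightarrow> u \<in> cstr_hat S (qproj S q) \<Longrightarrow> hlift S q u \<in> cstr S q"
  using hlift_cstr_hat(1) bdl_H_cstr by blast


subsection \<open>Germs of the reduced Lagrangian\<close>

lemma Lcheck_germ_G:
  assumes xy: "(x, y) \<in> Udom S" and w: "w \<in> C"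
  shows "(\<lambda>k. Lcheck S x k (qproj S y)) \<in> germs (GS S) w"
  unfolding Lcheck_eq[OF xy]
  using UdomD[OF xy] w hrep_closed[OF xy]
  by (intro lagr_germ[OF atlas] smooth_at_act[OF atlas] smooth_at_group_id smooth_at_Q_const atlas) auto

lemma Lcheck_germ_Q:
  assumes xy: "(x, y) \<in> Udom S" and w: "w \<in> C"
  shows "(\<lambda>z. Lcheck S z w (qproj S y)) \<in> germs (QS S) x"
proof (rule germ_local[OF atlasQ _ Udom_slice_left[OF UdomD(2)[OF xy]]])
  show "(\<lambda>z. lagr S (z, w \<cdot> hrep z y)) \<in> germs (QS S) x"
    using UdomD[OF xy] w xy
    by (intro lagr_germ[OF atlasQ] smooth_at_act[OF atlasQ] smooth_at_hrep[OF atlasQ] smooth_at_group_const[OF atlasQ]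
        smooth_at_Q_const smooth_at_Q_id atlasQ) auto
qed (use xy UdomD[OF xy] in \<open>auto simp: Lcheck_eq\<close>)

lemma Lcheck_germ_fiber:
  assumes xy: "(x, y) \<in> Udom S" and w: "w \<in> C"
  shows "(\<lambda>z. Lcheck S x w (qproj S z)) \<in> germs (QS S) y"
proof (rule germ_local[OF atlasQ _ Udom_slice_right[OF UdomD(1)[OF xy]]])
  show "(\<lambda>z. lagr S (x, w \<cdot> hrep x z)) \<in> germs (QS S) y"
    using UdomD[OF xy] w xy
    by (intro lagr_germ[OF atlasQ] smooth_at_act[OF atlasQ] smooth_at_hrep[OF atlasQ] smooth_at_group_const[OF atlasQ]
        smooth_at_Q_const smooth_at_Q_id atlasQ) auto
qed (use xy UdomD[OF xy] in \<open>auto simp: Lcheck_eq\<close>)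

lemma Lcheck_germ_Ad_right:
  assumes xy: "(x, y) \<in> Udom S"
  shows "(\<lambda>z. Lcheck S x (Ad (x, z)) (qproj S y)) \<in> germs (QS S) y"
proof -
  have "smooth_at (QS S) (GS S) (\<lambda>z. Ad (x, z)) y"
    using UdomD[OF xy] xy by (intro smooth_at_Ad[OF atlasQ] smooth_at_Q_const smooth_at_Q_id atlasQ) auto
  from smooth_atD[OF this Lcheck_germ_G[OF xy Ad_props(1)[OF xy]]] show ?thesis .
qed

lemma Lcheck_germ_Ad_left:
  assumes xy: "(x, y) \<in> Udom S"
  shows "(\<lambda>z. Lcheck S x (Ad (z, y)) (qproj S y)) \<in> germs (QS S) x"
proof -
  have "smooth_at (QS S) (GS S) (\<lambda>z. Ad (z, y)) x"
    using UdomD[OF xy] xy by (intro smooth_at_Ad[OF atlasQ] smooth_at_Q_const smooth_at_Q_id atlasQ) auto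
  from smooth_atD[OF this Lcheck_germ_G[OF xy Ad_props(1)[OF xy]]] show ?thesis .
qed

lemma D2Lcheck_D2A:
  assumes xy: "(x, y) \<in> Udom S"
  shows "D2Lcheck S x w (qproj S y) (D2A S x y v) = v (\<lambda>z. Lcheck S x (Ad (x, z)) (qproj S y))"
  using Lcheck_germ_G[OF xy Ad_props(1)[OF xy]] by (simp add: D2Lcheck_def D2A_def dmap_def)

lemma D2Lcheck_D1A:
  assumes xy: "(x, y) \<in> Udom S"
  shows "D2Lcheck S x w (qproj S y) (D1A S x y v) = v (\<lambda>z. Lcheck S x (Ad (z, y)) (qproj S y))"
  using Lcheck_germ_G[OF xy Ad_props(1)[OF xy]] by (simp add: D2Lcheck_def D1A_def dmap_def)

lemma Lcheck_germ_base:
  assumes xy: "(x, y) \<in> Udom S" and w: "w \<in> C"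
  shows "(\<lambda>r. Lcheck S x w r) \<in> germs (base S) (qproj S y)"
proof (rule germ_baseI)
  fix g assume g: "g \<in> C"
  have "(x, g \<cdot> y) \<in> Udom S" using Udom_act[OF xy one_closed g] UdomD[OF xy] by (simp add: pos.act_one)
  then show "(\<lambda>z. Lcheck S x w (qproj S z)) \<in> germs (QS S) (g \<cdot> y)" using w by (rule Lcheck_germ_fiber)
qed

lemma D3Lcheck_dpi:
  assumes xy: "(x, y) \<in> Udom S" and w: "w \<in> C"
  shows "D3Lcheck S x w (qproj S y) (dpi y v) = v (\<lambda>z. Lcheck S x w (qproj S z))"
  unfolding D3Lcheck_def by (rule dpi_germ[OF Lcheck_germ_base[OF assms]])

subsection \<open>Partial differentials of the Lagrangian\<close>

text \<open>The base point enters \<open>L (x, y) = Lcheck x (Ad (x, y)) (\<pi> y)\<close> directly and through \<open>Ad\<close>. The second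
  summand, which differentiates \<open>Ad\<close>, is the reduced force \<open>Fminus\<close> when \<open>v\<close> is a horizontal lift.
  In \<open>D2L_split\<close> below the corresponding term is \<open>Fplus\<close>.\<close>

lemma D1L_split:
  assumes xy: "(x, y) \<in> Udom S" and v: "v \<in> T x"
  shows "D1L S x y v = v (\<lambda>z. Lcheck S z (Ad (x, y)) (qproj S y)) + v (\<lambda>z. Lcheck S x (Ad (z, y)) (qproj S y))"
proof -
  note Q = UdomD[OF xy] and a = Ad_props(1)[OF xy] and At = smooth_atlas_prod[OF atlasQ atlas]
  let ?P = "prod_manifold (config S) (grp_mfd S)"
  let ?f = "\<lambda>z. lagr S (fst z, snd z \<cdot> hrep (fst z) y)"
  have 1: "smooth_at (mspace ?P) (QS S) fst (x, Ad (x, y))" and 2: "smooth_at (mspace ?P) (GS S) snd (x, Ad (x, y))"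
    using Q a by (auto intro!: smooth_at_fst smooth_at_snd atlas atlasQ)
  have f: "?f \<in> germs (mspace ?P) (x, Ad (x, y))"
    using Q a xy by (intro lagr_germ[OF At] smooth_at_act[OF At] smooth_at_hrep[OF At] 1 2 smooth_at_Q_const At) auto
  have A: "smooth_at (QS S) (GS S) (\<lambda>z. Ad (z, y)) x"
    using Q xy by (intro smooth_at_Ad[OF atlasQ] smooth_at_Q_const smooth_at_Q_id atlasQ) auto
  have "v (\<lambda>z. lagr S (z, Ad (z, y) \<cdot> hrep z y)) =
      v (\<lambda>z. lagr S (z, Ad (x, y) \<cdot> hrep z y)) + v (\<lambda>z. lagr S (x, Ad (z, y) \<cdot> hrep x y))"
    using tangent_Pair[OF atlasQ atlasQ atlas v smooth_at_Q_id[OF Q(1)] A f] by simp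
  moreover have "v (\<lambda>z. lagr S (z, Ad (z, y) \<cdot> hrep z y)) = D1L S x y v"
    unfolding D1L_def
    by (rule tangent_local[OF atlasQ v Udom_slice_left[OF Q(2)]]) (use xy Q in \<open>auto simp: Ad_hrep\<close>)
  moreover have "v (\<lambda>z. lagr S (z, Ad (x, y) \<cdot> hrep z y)) = v (\<lambda>z. Lcheck S z (Ad (x, y)) (qproj S y))"
    by (rule tangent_local[OF atlasQ v Udom_slice_left[OF Q(2)]]) (use xy Q in \<open>auto simp: Lcheck_eq\<close>)
  ultimately show ?thesis by (simp add: Lcheck_eq[OF xy])
qed

lemma D2L_split:
  assumes xy: "(x, y) \<in> Udom S" and v: "v \<in> T y"
  shows "D2L S x y v = v (\<lambda>z. Lcheck S x (Ad (x, z)) (qproj S y)) + v (\<lambda>z. Lcheck S x (Ad (x, y)) (qproj S z))"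
proof -
  note Q = UdomD[OF xy] and a = Ad_props(1)[OF xy] and At = smooth_atlas_prod[OF atlas atlasQ]
  let ?P = "prod_manifold (grp_mfd S) (config S)"
  let ?f = "\<lambda>z. lagr S (x, fst z \<cdot> hrep x (snd z))"
  have 1: "smooth_at (mspace ?P) (GS S) fst (Ad (x, y), y)" and 2: "smooth_at (mspace ?P) (QS S) snd (Ad (x, y), y)"
    using Q a by (auto intro!: smooth_at_fst smooth_at_snd atlas atlasQ)
  have f: "?f \<in> germs (mspace ?P) (Ad (x, y), y)"
    using Q a xy by (intro lagr_germ[OF At] smooth_at_act[OF At] smooth_at_hrep[OF At] 1 2 smooth_at_Q_const At) auto
  have A: "smooth_at (QS S) (GS S) (\<lambda>z. Ad (x, z)) y"
    using Q xy by (intro smooth_at_Ad[OF atlasQ] smooth_at_Q_const smooth_at_Q_id atlasQ) auto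
  have "v (\<lambda>z. lagr S (x, Ad (x, z) \<cdot> hrep x z)) =
      v (\<lambda>z. lagr S (x, Ad (x, z) \<cdot> hrep x y)) + v (\<lambda>z. lagr S (x, Ad (x, y) \<cdot> hrep x z))"
    using tangent_Pair[OF atlasQ atlas atlasQ v A smooth_at_Q_id[OF Q(2)] f] by simp
  moreover have "v (\<lambda>z. lagr S (x, Ad (x, z) \<cdot> hrep x z)) = D2L S x y v"
    unfolding D2L_def
    by (rule tangent_local[OF atlasQ v Udom_slice_right[OF Q(1)]]) (use xy Q in \<open>auto simp: Ad_hrep\<close>)
  moreover have "v (\<lambda>z. lagr S (x, Ad (x, y) \<cdot> hrep x z)) = v (\<lambda>z. Lcheck S x (Ad (x, y)) (qproj S z))"
    by (rule tangent_local[OF atlasQ v Udom_slice_right[OF Q(1)]]) (use xy Q in \<open>auto simp: Lcheck_eq\<close>)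
  ultimately show ?thesis by (simp add: Lcheck_eq[OF xy])
qed

lemma lagr_germ_left: "x \<in> Q \<Longrightarrow> y \<in> Q \<Longrightarrow> (\<lambda>z. lagr S (z, y)) \<in> germs (QS S) x"
  by (intro lagr_germ atlasQ smooth_at_Q_id smooth_at_Q_const) auto

lemma lagr_germ_right: "x \<in> Q \<Longrightarrow> y \<in> Q \<Longrightarrow> (\<lambda>z. lagr S (x, z)) \<in> germs (QS S) y"
  by (intro lagr_germ atlasQ smooth_at_Q_id smooth_at_Q_const) auto

lemma D1L_act:
  assumes g: "g \<in> C" and v: "v \<in> T x" and y: "y \<in> Q"
  shows "D1L S (g \<cdot> x) (g \<cdot> y) (dact g x v) = D1L S x y v"
proof -
  have x: "x \<in> Q" using tangent_pts[OF atlasQ v] .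
  have "D1L S (g \<cdot> x) (g \<cdot> y) (dact g x v) = v (\<lambda>z. lagr S (g \<cdot> z, g \<cdot> y))"
    unfolding D1L_def using g x y by (intro dact_germ lagr_germ_left) (auto simp: pos.act_closed)
  also have "\<dots> = D1L S x y v"
    unfolding D1L_def by (rule tangent_local[OF atlasQ v openin_topspace x]) (simp add: lagr_act g y)
  finally show ?thesis .
qed

lemma D2L_act:
  assumes g: "g \<in> C" and v: "v \<in> T y" and x: "x \<in> Q"
  shows "D2L S (g \<cdot> x) (g \<cdot> y) (dact g y v) = D2L S x y v"
proof -
  have y: "y \<in> Q" using tangent_pts[OF atlasQ v] .
  have "D2L S (g \<cdot> x) (g \<cdot> y) (dact g y v) = v (\<lambda>z. lagr S (g \<cdot> x, g \<cdot> z))"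
    unfolding D2L_def using g x y by (intro dact_germ lagr_germ_right) (auto simp: pos.act_closed)
  also have "\<dots> = D2L S x y v"
    unfolding D2L_def by (rule tangent_local[OF atlasQ v openin_topspace y]) (simp add: lagr_act g x)
  finally show ?thesis .
qed

subsection \<open>The vertical equation\<close>

lemma right_translate_D2Lcheck:
  assumes xy: "(x, y) \<in> Udom S" and w: "w \<in> C"
  shows "right_translate S (D2Lcheck S x w (qproj S y)) w \<eta> = \<eta> (\<lambda>k. Lcheck S x (k \<odot> w) (qproj S y))"
  using Lcheck_germ_G[OF xy w] w by (simp add: right_translate_def D2Lcheck_def dmap_def)

text \<open>Moving \<open>y\<close> to \<open>k y\<close> changes \<open>Ad (x, y)\<close> to \<open>k Ad (x, y)\<close> and leaves the other two arguments of \<open>Lcheck\<close>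
  fixed.\<close>

lemma right_translate_D2L:
  assumes xy: "(x, y) \<in> Udom S" and \<xi>: "\<xi> \<in> lie_alg S"
  shows "right_translate S (D2Lcheck S x (Ad (x, y)) (qproj S y)) (Ad (x, y)) \<xi> = D2L S x y (inf_gen S \<xi> y)"
proof -
  note Q = UdomD[OF xy] and a = Ad_props(1)[OF xy]
  have "\<xi> (\<lambda>k. Lcheck S x (k \<odot> Ad (x, y)) (qproj S y)) = \<xi> (\<lambda>k. lagr S (x, k \<cdot> y))"
    by (rule tangent_local[OF atlas \<xi>[unfolded lie_alg_def] openin_topspace])
      (simp_all add: Lcheck_eq[OF xy] pos.act_mult a hrep_closed[OF xy] Ad_hrep[OF xy])
  also have "\<dots> = D2L S x y (inf_gen S \<xi> y)"
    unfolding D2L_def by (rule inf_gen_germ[OF \<xi> Q(2) lagr_germ_right[OF Q], symmetric])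
  finally show ?thesis by (simp add: right_translate_D2Lcheck[OF xy a])
qed

text \<open>Noether's identity: as the Lagrangian is invariant under the diagonal action, the effects of an
  infinitesimal symmetry on its two arguments cancel.\<close>

lemma D1L_inf_gen:
  assumes x: "x \<in> Q" and y: "y \<in> Q" and \<xi>: "\<xi> \<in> lie_alg S"
  shows "D1L S x y (inf_gen S \<xi> x) = - D2L S x y (inf_gen S \<xi> y)"
proof -
  note \<xi>' = \<xi>[unfolded lie_alg_def]
  have At: "smooth_atlas (prod_manifold (grp_mfd S) (grp_mfd S))" by (intro smooth_atlas_prod atlas)
  have "(\<lambda>z. lagr S (fst z \<cdot> x, snd z \<cdot> y)) \<in> germs (mspace (prod_manifold (grp_mfd S) (grp_mfd S))) (\<e>, \<e>)"
    using x y by (intro lagr_germ[OF At] smooth_at_act[OF At] smooth_at_fst smooth_at_snd smooth_at_Q_const At atlas) auto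
  from tangent_Pair[OF atlas atlas atlas \<xi>' smooth_at_group_id[OF one_closed] smooth_at_group_id[OF one_closed] this]
  have "\<xi> (\<lambda>k. lagr S (k \<cdot> x, k \<cdot> y)) = \<xi> (\<lambda>k. lagr S (k \<cdot> x, y)) + \<xi> (\<lambda>k. lagr S (x, k \<cdot> y))"
    using x y by (simp add: pos.act_one)
  moreover have "\<xi> (\<lambda>k. lagr S (k \<cdot> x, k \<cdot> y)) = \<xi> (\<lambda>k. lagr S (x, y))"
    by (rule tangent_local[OF atlas \<xi>' openin_topspace]) (simp_all add: lagr_act x y)
  moreover have "\<xi> (\<lambda>k. lagr S (x, y)) = 0" by (rule tangent_const[OF atlas \<xi>'])
  moreover have "D1L S x y (inf_gen S \<xi> x) = \<xi> (\<lambda>k. lagr S (k \<cdot> x, y))"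
    unfolding D1L_def by (rule inf_gen_germ[OF \<xi> x lagr_germ_left[OF x y]])
  moreover have "D2L S x y (inf_gen S \<xi> y) = \<xi> (\<lambda>k. lagr S (x, k \<cdot> y))"
    unfolding D2L_def by (rule inf_gen_germ[OF \<xi> y lagr_germ_right[OF x y]])
  ultimately show ?thesis by simp
qed

text \<open>The infinitesimal form of the invariance of \<open>Lcheck\<close>, as \<open>(g k g\<^sup>-\<^sup>1) (g w g\<^sup>-\<^sup>1) = g (k w) g\<^sup>-\<^sup>1\<close>. It makes \<open>psi_bar\<close>
  well defined.\<close>

lemma right_translate_conj:
  assumes xy: "(x, y) \<in> Udom S" and w: "w \<in> C" and g: "g \<in> C" and \<xi>: "\<xi> \<in> lie_alg S"
  shows "right_translate S (D2Lcheck S (g \<cdot> x) (conj_by S g w) (qproj S y)) (conj_by S g w) (adjoint S g \<xi>) =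
    right_translate S (D2Lcheck S x w (qproj S y)) w \<xi>"
proof -
  have xy': "(g \<cdot> x, y) \<in> Udom S" using Udom_act[OF xy g one_closed] UdomD[OF xy] by (simp add: pos.act_one)
  have w': "conj_by S g w \<in> C" using g w by simp
  have e: "conj_by S g \<e> = \<e>" using g by (simp add: conj_by_def)
  let ?F = "\<lambda>k. Lcheck S (g \<cdot> x) (k \<odot> conj_by S g w) (qproj S y)"
  have "?F \<in> germs (GS S) \<e>"
    using smooth_atD[OF smooth_at_mult_right[OF w' one_closed], of "\<lambda>k. Lcheck S (g \<cdot> x) k (qproj S y)"]
      Lcheck_germ_G[OF xy' w'] w' by simp
  then have "adjoint S g \<xi> ?F = \<xi> (\<lambda>k. ?F (conj_by S g k))"
    by (simp add: adjoint_def dmap_def e)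
  also have "\<dots> = \<xi> (\<lambda>k. Lcheck S x (k \<odot> w) (qproj S y))"
  proof (rule tangent_local[OF atlas \<xi>[unfolded lie_alg_def] openin_topspace])
    fix k assume "k \<in> topspace (mtop (grp_mfd S))"
    then have k: "k \<in> C" by simp
    have "ginv g \<odot> (g \<odot> (w \<odot> ginv g)) = w \<odot> ginv g" using g w m_assoc[of "ginv g" g "w \<odot> ginv g"] by simp
    then have "conj_by S g k \<odot> conj_by S g w = conj_by S g (k \<odot> w)"
      using g w k by (simp add: conj_by_def m_assoc)
    then show "?F (conj_by S g k) = Lcheck S x (k \<odot> w) (qproj S y)"
      using Lcheck_act[OF xy g, of "k \<odot> w"] k w by simp
  qed simp
  finally show ?thesis by (simp add: right_translate_D2Lcheck[OF xy' w'] right_translate_D2Lcheck[OF xy w])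
qed

subsection \<open>The horizontal equation\<close>

lemma rho_conj: "g \<in> C \<Longrightarrow> x \<in> Q \<Longrightarrow> w \<in> C \<Longrightarrow> rho S (g \<cdot> x, conj_by S g w) = rho S (x, w)"
  using con.orbit_act[of g "(x, w)"] by (simp add: rho_def conj_act_def)

lemma rho_eqE:
  assumes "rho S (x', w') = rho S (x, w)" "x' \<in> Q" "w' \<in> C"
  obtains g where "g \<in> C" "x' = g \<cdot> x" "w' = conj_by S g w"
  using con.orbit_eqE[of "(x', w')" "(x, w)"] assms by (auto simp: rho_def conj_act_def)

lemma the_elem_rho:
  assumes "\<And>g. g \<in> C \<Longrightarrow> f (g \<cdot> x) (conj_by S g w) = k"
  shows "the_elem ((\<lambda>(x, w). f x w) ` rho S (x, w)) = k"
  unfolding rho_def prod.case using assms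
  by (intro the_elem_orbit is_group) (simp add: conj_act_def)

text \<open>The representative \<open>(g x, g w g\<^sup>-\<^sup>1)\<close> leads to the point \<open>g y\<close> and to the translated lift; the translations
  cancel by the equivariance of \<open>Ad\<close> and the invariance of \<open>Lcheck\<close>. The same applies to \<open>Fminus_eq\<close>.\<close>

lemma Fplus_eq:
  assumes xy: "(x, y) \<in> Udom S" and u: "u \<in> cstr_hat S (qproj S y)"
  shows "Fplus S (rho S (x, Ad (x, y))) (qproj S y) u = hlift S y u (\<lambda>z. Lcheck S x (Ad (x, z)) (qproj S y))"
  unfolding Fplus_def Let_def
proof (rule the_elem_rho)
  fix g assume g: "g \<in> C"
  note Q = UdomD[OF xy] and a = Ad_props(1)[OF xy]
  have h: "hlift S y u \<in> T y" using hlift_cstr[OF Q(2) u] bundles(5)[OF Q(2)] by blast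
  have gxy: "(g \<cdot> x, g \<cdot> y) \<in> Udom S" by (rule Udom_act[OF xy g g])
  have gxy': "(g \<cdot> x, y) \<in> Udom S" using Udom_act[OF xy g one_closed] Q by (simp add: pos.act_one)
  have q1: "F1tilde S (g \<cdot> x) (conj_by S g (Ad (x, y))) (qproj S y) = g \<cdot> y"
    by (simp add: F1tilde_act[OF xy g a] F1tilde_Ad[OF xy])
  have r: "qproj S (g \<cdot> y) = qproj S y" using g Q by simp
  have "D2Lcheck S (g \<cdot> x) (conj_by S g (Ad (x, y))) (qproj S y) (D2A S (g \<cdot> x) (g \<cdot> y) (hlift S (g \<cdot> y) u))
      = dact g y (hlift S y u) (\<lambda>z. Lcheck S (g \<cdot> x) (Ad (g \<cdot> x, z)) (qproj S y))"
    using D2Lcheck_D2A[OF gxy] r hlift_act[OF Q(2) g u] by simp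
  also have "\<dots> = hlift S y u (\<lambda>z. Lcheck S (g \<cdot> x) (Ad (g \<cdot> x, g \<cdot> z)) (qproj S y))"
    using Lcheck_germ_Ad_right[OF gxy] r by (intro dact_germ) simp
  also have "\<dots> = hlift S y u (\<lambda>z. Lcheck S x (Ad (x, z)) (qproj S y))"
    by (rule tangent_local[OF atlasQ h Udom_slice_right[OF Q(1)]])
      (use xy Q g in \<open>auto simp: Ad_act_conj Lcheck_act Ad_props\<close>)
  finally show "D2Lcheck S (g \<cdot> x) (conj_by S g (Ad (x, y))) (qproj S y)
      (D2A S (g \<cdot> x) (F1tilde S (g \<cdot> x) (conj_by S g (Ad (x, y))) (qproj S y))
        (hlift S (F1tilde S (g \<cdot> x) (conj_by S g (Ad (x, y))) (qproj S y)) u)) =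
      hlift S y u (\<lambda>z. Lcheck S x (Ad (x, z)) (qproj S y))" unfolding q1 .
qed

lemma Fminus_eq:
  assumes xy: "(x, y) \<in> Udom S" and u: "u \<in> cstr_hat S (qproj S x)"
  shows "Fminus S (rho S (x, Ad (x, y))) (qproj S y) u = hlift S x u (\<lambda>z. Lcheck S x (Ad (z, y)) (qproj S y))"
  unfolding Fminus_def Let_def
proof (rule the_elem_rho)
  fix g assume g: "g \<in> C"
  note Q = UdomD[OF xy] and a = Ad_props(1)[OF xy]
  have h: "hlift S x u \<in> T x" using hlift_cstr[OF Q(1) u] bundles(5)[OF Q(1)] by blast
  have gxy: "(g \<cdot> x, g \<cdot> y) \<in> Udom S" by (rule Udom_act[OF xy g g])
  have q1: "F1tilde S (g \<cdot> x) (conj_by S g (Ad (x, y))) (qproj S y) = g \<cdot> y"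
    by (simp add: F1tilde_act[OF xy g a] F1tilde_Ad[OF xy])
  have r: "qproj S (g \<cdot> y) = qproj S y" using g Q by simp
  have "D2Lcheck S (g \<cdot> x) (conj_by S g (Ad (x, y))) (qproj S y) (D1A S (g \<cdot> x) (g \<cdot> y) (hlift S (g \<cdot> x) u))
      = dact g x (hlift S x u) (\<lambda>z. Lcheck S (g \<cdot> x) (Ad (z, g \<cdot> y)) (qproj S y))"
    using D2Lcheck_D1A[OF gxy] r hlift_act[OF Q(1) g u] by simp
  also have "\<dots> = hlift S x u (\<lambda>z. Lcheck S (g \<cdot> x) (Ad (g \<cdot> z, g \<cdot> y)) (qproj S y))"
    using Lcheck_germ_Ad_left[OF gxy] r by (intro dact_germ) simp
  also have "\<dots> = hlift S x u (\<lambda>z. Lcheck S x (Ad (z, y)) (qproj S y))"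
    by (rule tangent_local[OF atlasQ h Udom_slice_left[OF Q(2)]])
      (use xy Q g in \<open>auto simp: Ad_act_conj Lcheck_act[OF xy] Ad_props\<close>)
  finally show "D2Lcheck S (g \<cdot> x) (conj_by S g (Ad (x, y))) (qproj S y)
      (D1A S (g \<cdot> x) (F1tilde S (g \<cdot> x) (conj_by S g (Ad (x, y))) (qproj S y)) (hlift S (g \<cdot> x) u)) =
      hlift S x u (\<lambda>z. Lcheck S x (Ad (z, y)) (qproj S y))" unfolding q1 .
qed

text \<open>The left hand side of the discrete Euler-Lagrange equations at the middle one of three points.\<close>

definition EL :: "'q \<Rightarrow> 'q \<Rightarrow> 'q \<Rightarrow> 'q tangent \<Rightarrow> real" where
  "EL q0 q1 q2 \<delta> = D1L S q1 q2 \<delta> + D2L S q0 q1 \<delta>"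

lemma horizontal_EL:
  assumes q01: "(q0, q1) \<in> Udom S" and q12: "(q1, q2) \<in> Udom S" and u: "u \<in> cstr_hat S (qproj S q1)"
  shows "D1Lcheck S q1 (Ad (q1, q2)) (qproj S q2) (hlift S q1 u) + D3Lcheck S q0 (Ad (q0, q1)) (qproj S q1) u
      + Fminus S (rho S (q1, Ad (q1, q2))) (qproj S q2) u + Fplus S (rho S (q0, Ad (q0, q1))) (qproj S q1) u
    = EL q0 q1 q2 (hlift S q1 u)"
proof -
  have q1: "q1 \<in> Q" using UdomD[OF q01] by simp
  note h = hlift_cstr_hat[OF q1 u]
  have hT: "hlift S q1 u \<in> T q1" using bdl_H_cstr[OF q1 h(1)] bundles(5)[OF q1] by blast
  show ?thesis
    using D3Lcheck_dpi[OF q01 Ad_props(1)[OF q01], of "hlift S q1 u"] h(2)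
    by (simp add: EL_def D1L_split[OF q12 hT] D2L_split[OF q01 hT] Fminus_eq[OF q12 u] Fplus_eq[OF q01 u] D1Lcheck_def)
qed

lemma vertical_EL:
  assumes q01: "(q0, q1) \<in> Udom S" and q12: "(q1, q2) \<in> Udom S" and \<xi>: "\<xi> \<in> lie_alg S"
  shows "right_translate S (D2Lcheck S q0 (Ad (q0, q1)) (qproj S q1)) (Ad (q0, q1)) \<xi>
      - right_translate S (D2Lcheck S q1 (Ad (q1, q2)) (qproj S q2)) (Ad (q1, q2)) \<xi> = EL q0 q1 q2 (inf_gen S \<xi> q1)"
  using D1L_inf_gen[OF UdomD[OF q12] \<xi>]
  by (simp add: right_translate_D2L[OF q01 \<xi>] right_translate_D2L[OF q12 \<xi>] EL_def)

lemma EL_act: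
  assumes g: "g \<in> C" and Q: "q0 \<in> Q" "q2 \<in> Q" and v: "v \<in> T q1"
  shows "EL (g \<cdot> q0) (g \<cdot> q1) (g \<cdot> q2) (dact g q1 v) = EL q0 q1 q2 v"
  by (simp add: EL_def D1L_act[OF g v Q(2)] D2L_act[OF g v Q(1)])

lemma EL_add: "EL q0 q1 q2 (v + w) = EL q0 q1 q2 v + EL q0 q1 q2 w"
  by (simp add: EL_def D1L_def D2L_def)

text \<open>The splitting of the equations of motion, by \<open>cstr_decompose\<close> and linearity.\<close>

lemma EL_cstr_iff:
  assumes q1: "q1 \<in> Q"
  shows "(\<forall>v\<in>cstr S q1. EL q0 q1 q2 v = 0) \<longleftrightarrow>
    (\<forall>u\<in>cstr_hat S (qproj S q1). EL q0 q1 q2 (hlift S q1 u) = 0) \<and>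
    (\<forall>\<xi>\<in>gD_fiber S q1. EL q0 q1 q2 (inf_gen S \<xi> q1) = 0)"
proof (intro iffI conjI ballI)
  fix v assume *: "(\<forall>u\<in>cstr_hat S (qproj S q1). EL q0 q1 q2 (hlift S q1 u) = 0) \<and>
    (\<forall>\<xi>\<in>gD_fiber S q1. EL q0 q1 q2 (inf_gen S \<xi> q1) = 0)" and v: "v \<in> cstr S q1"
  obtain u \<xi> where "u \<in> cstr_hat S (qproj S q1)" "\<xi> \<in> gD_fiber S q1" "v = hlift S q1 u + inf_gen S \<xi> q1"
    by (rule cstr_decompose[OF q1 v])
  then show "EL q0 q1 q2 v = 0" using * by (simp add: EL_add)
qed (auto simp: hlift_cstr[OF q1] gD_fiberD)

subsection \<open>The intrinsic conditions\<close>

lemma w1_of_conj: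
  assumes g: "g \<in> C" and x: "x \<in> Q" and w: "w \<in> C"
  shows "w1_of S (g \<cdot> x) (rho S (x, w)) = conj_by S g w"
  unfolding w1_of_def
proof (rule the_equality)
  show "conj_by S g w \<in> C \<and> rho S (g \<cdot> x, conj_by S g w) = rho S (x, w)"
    using assms by (simp add: rho_conj)
  fix w' assume w': "w' \<in> C \<and> rho S (g \<cdot> x, w') = rho S (x, w)"
  then obtain h where h: "h \<in> C" "g \<cdot> x = h \<cdot> x" "w' = conj_by S h w"
    using rho_eqE[of "g \<cdot> x" w' x w] g x by (auto simp: pos.act_closed)
  then show "w' = conj_by S g w" using act_free[OF g h(1) x] by simp
qed

text \<open>As for the forces, all representatives of the class yield the same value, which \<open>horizontal_EL\<close>
  evaluates at the representative \<open>(q0, Ad (q0, q1))\<close>.\<close>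

lemma phi_bar_EL:
  assumes q01: "(q0, q1) \<in> Udom S" and q12: "(q1, q2) \<in> Udom S" and u: "u \<in> cstr_hat S (qproj S q1)"
  shows "phi_bar S (rho S (q0, Ad (q0, q1)), qproj S q1, rho S (q1, Ad (q1, q2)), qproj S q2) u
    = EL q0 q1 q2 (hlift S q1 u)"
  unfolding phi_bar_def Let_def prod.case
proof (rule the_elem_rho)
  fix g assume g: "g \<in> C"
  note Q = UdomD[OF q01] UdomD[OF q12] and a = Ad_props(1)[OF q01] Ad_props(1)[OF q12]
  note h = hlift_cstr_hat[OF Q(2) u]
  have hT: "hlift S q1 u \<in> T q1" using bdl_H_cstr[OF Q(2) h(1)] bundles(5)[OF Q(2)] by blast
  have gq12: "(g \<cdot> q1, q2) \<in> Udom S" using Udom_act[OF q12 g one_closed] Q by (simp add: pos.act_one)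
  have gq01: "(g \<cdot> q0, q1) \<in> Udom S" using Udom_act[OF q01 g one_closed] Q by (simp add: pos.act_one)
  have q1: "F1 S (g \<cdot> q0, conj_by S g (Ad (q0, q1)), qproj S q1, rho S (q1, Ad (q1, q2)), qproj S q2) = g \<cdot> q1"
    by (simp add: F1_def F1tilde_act[OF q01 g a(1)] F1tilde_Ad[OF q01])
  have "D1Lcheck S (g \<cdot> q1) (conj_by S g (Ad (q1, q2))) (qproj S q2) (hlift S (g \<cdot> q1) u)
      = hlift S q1 u (\<lambda>z. Lcheck S (g \<cdot> z) (conj_by S g (Ad (q1, q2))) (qproj S q2))"
    unfolding D1Lcheck_def hlift_act[OF Q(2) g u]
    using Lcheck_germ_Q[OF gq12] a g by (intro dact_germ) simp
  also have "\<dots> = D1Lcheck S q1 (Ad (q1, q2)) (qproj S q2) (hlift S q1 u)"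
    unfolding D1Lcheck_def
    by (rule tangent_local[OF atlasQ hT Udom_slice_left[OF Q(4)]]) (use q12 Q g a in \<open>auto simp: Lcheck_act\<close>)
  finally have 1: "D1Lcheck S (g \<cdot> q1) (conj_by S g (Ad (q1, q2))) (qproj S q2) (hlift S (g \<cdot> q1) u)
      = D1Lcheck S q1 (Ad (q1, q2)) (qproj S q2) (hlift S q1 u)" .
  have "D3Lcheck S (g \<cdot> q0) (conj_by S g (Ad (q0, q1))) (qproj S q1) u =
      hlift S q1 u (\<lambda>z. Lcheck S (g \<cdot> q0) (conj_by S g (Ad (q0, q1))) (qproj S z))"
    using D3Lcheck_dpi[OF gq01, of "conj_by S g (Ad (q0, q1))" "hlift S q1 u"] h(2) a g by simp
  also have "\<dots> = hlift S q1 u (\<lambda>z. Lcheck S q0 (Ad (q0, q1)) (qproj S z))"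
    by (rule tangent_local[OF atlasQ hT Udom_slice_right[OF Q(1)]]) (use q01 Q g a in \<open>auto simp: Lcheck_act\<close>)
  also have "\<dots> = D3Lcheck S q0 (Ad (q0, q1)) (qproj S q1) u"
    using D3Lcheck_dpi[OF q01 a(1), of "hlift S q1 u"] h(2) by simp
  finally have 2: "D3Lcheck S (g \<cdot> q0) (conj_by S g (Ad (q0, q1))) (qproj S q1) u = D3Lcheck S q0 (Ad (q0, q1)) (qproj S q1) u" .
  show "D1Lcheck S (F1 S (g \<cdot> q0, conj_by S g (Ad (q0, q1)), qproj S q1, rho S (q1, Ad (q1, q2)), qproj S q2))
        (w1_of S (F1 S (g \<cdot> q0, conj_by S g (Ad (q0, q1)), qproj S q1, rho S (q1, Ad (q1, q2)), qproj S q2))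
          (rho S (q1, Ad (q1, q2)))) (qproj S q2)
        (hlift S (F1 S (g \<cdot> q0, conj_by S g (Ad (q0, q1)), qproj S q1, rho S (q1, Ad (q1, q2)), qproj S q2)) u) +
      D3Lcheck S (g \<cdot> q0) (conj_by S g (Ad (q0, q1))) (qproj S q1) u +
      Fminus S (rho S (q1, Ad (q1, q2))) (qproj S q2) u + Fplus S (rho S (q0, Ad (q0, q1))) (qproj S q1) u =
      EL q0 q1 q2 (hlift S q1 u)"
    unfolding q1 w1_of_conj[OF g Q(2) a(2)] 1 2 by (rule horizontal_EL[OF assms])
qed

lemma psi_bar_EL:
  assumes q01: "(q0, q1) \<in> Udom S" and q12: "(q1, q2) \<in> Udom S" and \<xi>: "\<xi> \<in> lie_alg S"
  shows "psi_bar S (orbit (grp S) (check_act S)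
      ((q0, Ad (q0, q1), qproj S q1, rho S (q1, Ad (q1, q2)), qproj S q2), \<xi>)) = EL q0 q1 q2 (inf_gen S \<xi> q1)"
  unfolding psi_bar_def
proof (rule the_elem_orbit[OF is_group])
  fix g assume g: "g \<in> C"
  note Q = UdomD[OF q01] UdomD[OF q12] and a = Ad_props(1)[OF q01] Ad_props(1)[OF q12]
  have "F1 S (g \<cdot> q0, conj_by S g (Ad (q0, q1)), qproj S q1, rho S (q1, Ad (q1, q2)), qproj S q2) = g \<cdot> q1"
    by (simp add: F1_def F1tilde_act[OF q01 g a(1)] F1tilde_Ad[OF q01])
  then show "(case check_act S g ((q0, Ad (q0, q1), qproj S q1, rho S (q1, Ad (q1, q2)), qproj S q2), \<xi>) of
      (x, \<xi>) \<Rightarrow> (case x of (q0, w0, r1, v1, r2) \<Rightarrow> \<lambda>\<xi>.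
        let q1 = F1 S (q0, w0, r1, v1, r2); w1 = w1_of S q1 v1
        in right_translate S (D2Lcheck S q0 w0 r1) w0 \<xi> - right_translate S (D2Lcheck S q1 w1 r2) w1 \<xi>) \<xi>) =
      EL q0 q1 q2 (inf_gen S \<xi> q1)"
    using vertical_EL[OF assms]
    by (simp add: check_act_def w1_of_conj[OF g Q(2) a(2)] right_translate_conj[OF q01 a(1) g \<xi>]
        right_translate_conj[OF q12 a(2) g \<xi>])
qed

lemma Gtilde_proj_rho: "x \<in> Q \<Longrightarrow> w \<in> C \<Longrightarrow> Gtilde_proj S (rho S (x, w)) = qproj S x"
  unfolding Gtilde_proj_def by (rule the_elem_rho) simp

lemma rho_pts: "x \<in> Q \<Longrightarrow> w \<in> C \<Longrightarrow> rho S (x, w) \<in> pts (Gtilde S)"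
  by (auto simp: Gtilde_def pts_quotient orbits_def rho_def)

lemma Udom_diag_nbhd: "(x, y) \<in> Udom S \<Longrightarrow> (qproj S x, qproj S y) \<in> diag_nbhd S"
  by (simp add: Udom_def)

text \<open>The vertical condition ranges over all representatives of the first component, that is over the translates
  of the three points by \<open>g\<close>. Every vertical admissible vector at \<open>g q1\<close> is the translate of an
  admissible vector at \<open>q1\<close>, so equivariance of \<open>EL\<close> brings the condition back to \<open>q1\<close>.\<close>

lemma intrinsic_iff_EL:
  assumes q01: "(q0, q1) \<in> Udom S" and q12: "(q1, q2) \<in> Udom S"
  shows "horizontal_condition S (rho S (q0, Ad (q0, q1)), qproj S q1, rho S (q1, Ad (q1, q2)), qproj S q2) \<and>
      vertical_condition S (rho S (q0, Ad (q0, q1)), qproj S q1, rho S (q1, Ad (q1, q2)), qproj S q2) \<longleftrightarrow>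
    (\<forall>v\<in>cstr S q1. EL q0 q1 q2 v = 0)" (is "?H \<and> ?V \<longleftrightarrow> ?E")
proof -
  note Q = UdomD[OF q01] UdomD[OF q12] and a = Ad_props(1)[OF q01] Ad_props(1)[OF q12]
  have pb: "qproj S q1 \<in> pts (base S)" "qproj S q2 \<in> pts (base S)" using Q by (auto simp: pts_base)
  have "(rho S (q0, Ad (q0, q1)), qproj S q1, rho S (q1, Ad (q1, q2)), qproj S q2) \<in> Q2G S"
    using Q a pb by (simp add: Q2G_def rho_pts Gtilde_proj_rho Udom_diag_nbhd q01 q12)
  then have H: "?H \<longleftrightarrow> (\<forall>u\<in>cstr_hat S (qproj S q1). EL q0 q1 q2 (hlift S q1 u) = 0)"
    by (auto simp: horizontal_condition_def pullback_cstr_hat_def phi_bar_EL[OF q01 q12])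
  have V1: "EL q0 q1 q2 (inf_gen S \<xi> q1) = 0" if V: ?V and \<xi>: "\<xi> \<in> gD_fiber S q1" for \<xi>
  proof -
    have "(q0, Ad (q0, q1), qproj S q1, rho S (q1, Ad (q1, q2)), qproj S q2) \<in> Q2G_check S"
      using Q a pb by (simp add: Q2G_check_def rho_pts Gtilde_proj_rho Udom_diag_nbhd q01 q12)
    then have "((q0, Ad (q0, q1), qproj S q1, rho S (q1, Ad (q1, q2)), qproj S q2), \<xi>) \<in> pullback_gD S"
      using \<xi> by (simp add: pullback_gD_def F1_def F1tilde_Ad[OF q01] gD_fiber_def)
    then have "psi_bar S (orbit (grp S) (check_act S)
      ((q0, Ad (q0, q1), qproj S q1, rho S (q1, Ad (q1, q2)), qproj S q2), \<xi>)) = 0"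
      using V unfolding vertical_condition_def prod.case by blast
    then show ?thesis using psi_bar_EL[OF q01 q12 gD_fiberD(1)[OF \<xi>]] by simp
  qed
  have V2: ?V if E: ?E
    unfolding vertical_condition_def prod.case
  proof (intro allI impI, elim conjE)
    fix x w \<xi> assume eq: "rho S (x, w) = rho S (q0, Ad (q0, q1))"
      and mem: "((x, w, qproj S q1, rho S (q1, Ad (q1, q2)), qproj S q2), \<xi>) \<in> pullback_gD S"
    have xw: "x \<in> Q" "w \<in> C" using mem by (auto simp: pullback_gD_def Q2G_check_def)
    obtain g where g: "g \<in> C" "x = g \<cdot> q0" "w = conj_by S g (Ad (q0, q1))"
      by (rule rho_eqE[OF eq xw])
    have gq: "(g \<cdot> q0, g \<cdot> q1) \<in> Udom S" "(g \<cdot> q1, g \<cdot> q2) \<in> Udom S" using Udom_act q01 q12 g by auto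
    have w: "w = Ad (g \<cdot> q0, g \<cdot> q1)" using Ad_act_conj[OF q01 g(1)] g(3) by simp
    have v1: "rho S (q1, Ad (q1, q2)) = rho S (g \<cdot> q1, Ad (g \<cdot> q1, g \<cdot> q2))"
      using rho_conj[OF g(1) Q(2) a(2)] Ad_act_conj[OF q12 g(1)] by simp
    have r: "qproj S q1 = qproj S (g \<cdot> q1)" "qproj S q2 = qproj S (g \<cdot> q2)" using g Q by auto
    have mem': "((g \<cdot> q0, Ad (g \<cdot> q0, g \<cdot> q1), qproj S (g \<cdot> q1), rho S (g \<cdot> q1, Ad (g \<cdot> q1, g \<cdot> q2)), qproj S (g \<cdot> q2)), \<xi>) \<in> pullback_gD S"
      using mem unfolding g(2) w v1 r .
    then have \<xi>: "\<xi> \<in> gD_fiber S (g \<cdot> q1)"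
      by (simp add: pullback_gD_def F1_def F1tilde_Ad[OF gq(1)] gD_fiber_def)
    have "inf_gen S \<xi> (g \<cdot> q1) \<in> dact g q1 ` cstr S q1"
      using gD_fiberD(2)[OF \<xi>] cstr_act[OF g(1) Q(2)] by simp
    then obtain v where v: "v \<in> cstr S q1" "inf_gen S \<xi> (g \<cdot> q1) = dact g q1 v" by blast
    have "EL (g \<cdot> q0) (g \<cdot> q1) (g \<cdot> q2) (inf_gen S \<xi> (g \<cdot> q1)) = 0"
      unfolding v(2) using EL_act[OF g(1) Q(1,4), of v q1] v(1) bundles(5)[OF Q(2)] E by auto
    then show "psi_bar S (orbit (grp S) (check_act S) ((x, w, qproj S q1, rho S (q1, Ad (q1, q2)), qproj S q2), \<xi>)) = 0"
      unfolding g(2) w v1 r psi_bar_EL[OF gq gD_fiberD(1)[OF \<xi>]] .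
  qed
  show ?thesis using H V1 V2 EL_cstr_iff[OF Q(2), of q0 q2] by blast
qed

lemma reduced_iff_EL:
  assumes q01: "(q0, q1) \<in> Udom S" and q12: "(q1, q2) \<in> Udom S"
  shows "(\<lambda>\<delta>. D1Lcheck S q1 (Ad (q1, q2)) (qproj S q2) (hlift S q1 \<delta>) + D3Lcheck S q0 (Ad (q0, q1)) (qproj S q1) \<delta>
        + Fminus S (rho S (q1, Ad (q1, q2))) (qproj S q2) \<delta> + Fplus S (rho S (q0, Ad (q0, q1))) (qproj S q1) \<delta>)
        \<in> annihilator (cstr_hat S (qproj S q1)) \<and>
      (\<lambda>\<xi>. right_translate S (D2Lcheck S q0 (Ad (q0, q1)) (qproj S q1)) (Ad (q0, q1)) \<xi>
        - right_translate S (D2Lcheck S q1 (Ad (q1, q2)) (qproj S q2)) (Ad (q1, q2)) \<xi>)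
        \<in> annihilator (gD_fiber S q1) \<longleftrightarrow>
    (\<forall>v\<in>cstr S q1. EL q0 q1 q2 v = 0)"
  unfolding EL_cstr_iff[OF UdomD(2)[OF q01]] annihilator_def mem_Collect_eq
  by (simp add: horizontal_EL[OF q01 q12] vertical_EL[OF q01 q12] gD_fiberD(1) cong: ball_cong)

text \<open>If \<open>(x, y)\<close> and \<open>(x', y')\<close> have the same image under \<open>Phi\<close>, then \<open>x = g x'\<close> and \<open>y = h y'\<close>, and comparing
  \<open>Ad (x, y) = h Ad (x', y') g\<^sup>-\<^sup>1\<close> with \<open>g Ad (x', y') g\<^sup>-\<^sup>1\<close> gives \<open>g = h\<close>.\<close>

lemma kin_hat_iff:
  assumes xy: "(x, y) \<in> Udom S"
  shows "(rho S (x, Ad (x, y)), qproj S y) \<in> kin_hat S \<longleftrightarrow> (x, y) \<in> kin S"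
proof -
  have Phi: "Phi S (orbit (grp S) (diag_act S) (x, y)) = (rho S (x, Ad (x, y)), qproj S y)" if "(x, y) \<in> Udom S" for x y
    unfolding Phi_def using that
    by (intro the_elem_orbit is_group) (simp add: diag_act_def Ad_act_conj rho_conj Ad_props UdomD)
  show ?thesis
  proof
    assume "(x, y) \<in> kin S"
    then show "(rho S (x, Ad (x, y)), qproj S y) \<in> kin_hat S"
      using Phi[OF xy] xy unfolding kin_hat_def by (metis IntI imageI)
  next
    assume "(rho S (x, Ad (x, y)), qproj S y) \<in> kin_hat S"
    then obtain x' y' where xy': "(x', y') \<in> kin S" "(x', y') \<in> Udom S"
      and eq: "(rho S (x, Ad (x, y)), qproj S y) = Phi S (orbit (grp S) (diag_act S) (x', y'))"
      unfolding kin_hat_def by auto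
    have eq': "rho S (x, Ad (x, y)) = rho S (x', Ad (x', y'))" "qproj S y = qproj S y'"
      using eq Phi[OF xy'(2)] by simp_all
    note Q = UdomD[OF xy] UdomD[OF xy'(2)]
    obtain g where g: "g \<in> C" "x = g \<cdot> x'" "Ad (x, y) = conj_by S g (Ad (x', y'))"
      by (rule rho_eqE[OF eq'(1) Q(1) Ad_props(1)[OF xy]])
    obtain h where h: "h \<in> C" "y = h \<cdot> y'" by (rule qproj_eqE[OF eq'(2) Q(2)])
    have "h \<odot> Ad (x', y') \<odot> ginv g = g \<odot> Ad (x', y') \<odot> ginv g"
      using Ad_act[OF xy'(2) g(1) h(1)] g h by (simp add: conj_by_def)
    then have "h = g" using g(1) h(1) Ad_props(1)[OF xy'(2)] by simp
    then have "(x, y) = diag_act S g (x', y')" using g h by (simp add: diag_act_def)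
    then show "(x, y) \<in> kin S"
      using symmetry xy'(1) g(1) by (simp add: symmetry_group_def invariant_set_def)
  qed
qed


section \<open>Discrete actions\<close>

text \<open>The differential of the action, ordered by edges instead of vertices of the discrete curve; both the
  unreduced and the reduced action are brought to this form.\<close>

definition dS :: "nat \<Rightarrow> (nat \<Rightarrow> 'q) \<Rightarrow> (nat \<Rightarrow> 'q tangent) \<Rightarrow> real" where
  "dS N q \<delta> = (\<Sum>k<N. D1L S (q k) (q (Suc k)) (\<delta> k) + D2L S (q k) (q (Suc k)) (\<delta> (Suc k)))"

lemma dSd_eq_dS:
  assumes q: "\<And>k. k \<le> N \<Longrightarrow> q k \<in> Q" and \<delta>: "\<And>k. k \<le> N \<Longrightarrow> \<delta> k \<in> T (q k)"
  shows "dSd S N q \<delta> = dS N q \<delta>"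
proof -
  have summand: "\<delta> j (\<lambda>x. lagr S ((q(j := x)) k, (q(j := x)) (Suc k))) =
      (if k = j then D1L S (q k) (q (Suc k)) (\<delta> j) else 0) + (if Suc k = j then D2L S (q k) (q (Suc k)) (\<delta> j) else 0)"
    and germ: "(\<lambda>x. lagr S ((q(j := x)) k, (q(j := x)) (Suc k))) \<in> germs (QS S) (q j)"
    if "k < N" "j \<le> N" for k j
  proof -
    have qs: "q k \<in> Q" "q (Suc k) \<in> Q" "q j \<in> Q" using q that by auto
    consider "k = j" | "Suc k = j" | "k \<noteq> j" "Suc k \<noteq> j" by blast
    then show "\<delta> j (\<lambda>x. lagr S ((q(j := x)) k, (q(j := x)) (Suc k))) =
      (if k = j then D1L S (q k) (q (Suc k)) (\<delta> j) else 0) + (if Suc k = j then D2L S (q k) (q (Suc k)) (\<delta> j) else 0)"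
      using tangent_const[OF atlasQ \<delta>[OF that(2)]] by cases (auto simp: D1L_def D2L_def)
    show "(\<lambda>x. lagr S ((q(j := x)) k, (q(j := x)) (Suc k))) \<in> germs (QS S) (q j)"
      using qs lagr_germ_left[OF qs(1,2)] lagr_germ_right[OF qs(1,2)]
        germ_const[OF atlasQ qs(3)]
      by (cases "k = j"; cases "Suc k = j") auto
  qed
  have "dSd S N q \<delta> = (\<Sum>j\<le>N. \<Sum>k<N. (if k = j then D1L S (q k) (q (Suc k)) (\<delta> j) else 0)
      + (if Suc k = j then D2L S (q k) (q (Suc k)) (\<delta> j) else 0))"
    unfolding dSd_def Sd_def
  proof (rule sum.cong[OF refl])
    fix j assume j: "j \<in> {..N}"
    have "\<delta> j (\<lambda>x. \<Sum>k<N. lagr S ((q(j := x)) k, (q(j := x)) (Suc k))) =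
        (\<Sum>k<N. \<delta> j (\<lambda>x. lagr S ((q(j := x)) k, (q(j := x)) (Suc k))))"
      using j by (intro tangent_sum[OF atlasQ \<delta>] germ) auto
    also have "\<dots> = (\<Sum>k<N. (if k = j then D1L S (q k) (q (Suc k)) (\<delta> j) else 0)
        + (if Suc k = j then D2L S (q k) (q (Suc k)) (\<delta> j) else 0))"
      using j by (intro sum.cong refl summand) auto
    finally show "\<delta> j (\<lambda>x. \<Sum>k<N. lagr S ((q(j := x)) k, (q(j := x)) (Suc k))) =
        (\<Sum>k<N. (if k = j then D1L S (q k) (q (Suc k)) (\<delta> j) else 0) + (if Suc k = j then D2L S (q k) (q (Suc k)) (\<delta> j) else 0))" .
  qed
  also have "\<dots> = (\<Sum>k<N. \<Sum>j\<le>N. (if k = j then D1L S (q k) (q (Suc k)) (\<delta> j) else 0)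
      + (if Suc k = j then D2L S (q k) (q (Suc k)) (\<delta> j) else 0))"
    by (rule sum.swap)
  also have "\<dots> = dS N q \<delta>"
    unfolding dS_def by (intro sum.cong) (auto simp: sum.distrib)
  finally show ?thesis .
qed

text \<open>Summation by parts collects the contributions of each interior vertex into \<open>EL\<close>; conversely a variation
  supported at one vertex isolates its equation.\<close>

lemma dS_zero_iff_EL:
  assumes q: "\<And>k. k \<le> N \<Longrightarrow> q k \<in> Q"
  shows "(\<forall>\<delta>. (\<forall>k\<le>N. \<delta> k \<in> cstr S (q k)) \<and> \<delta> 0 = 0 \<and> \<delta> N = 0 \<longrightarrow> dS N q \<delta> = 0) \<longleftrightarrow>
    (\<forall>k. 1 \<le> k \<and> k < N \<longrightarrow> (\<forall>v\<in>cstr S (q k). EL (q (k - 1)) (q k) (q (Suc k)) v = 0))" (is "?L \<longleftrightarrow> ?R")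
proof
  assume L: ?L
  show ?R
  proof (intro allI impI ballI, elim conjE)
    fix k v assume k: "1 \<le> k" "k < N" and v: "v \<in> cstr S (q k)"
    let ?\<delta> = "\<lambda>j. if j = k then v else 0"
    have "\<forall>j\<le>N. ?\<delta> j \<in> cstr S (q j)" using v q by (auto intro: subspace_0[OF bundles(4)])
    then have "dS N q ?\<delta> = 0" using L k by auto
    moreover have "D1L S x y 0 = 0" "D2L S x y 0 = 0" for x y by (simp_all add: D1L_def D2L_def)
    then have "dS N q ?\<delta> = (\<Sum>j<N. (if j = k then D1L S (q j) (q (Suc j)) v else 0)
        + (if j = k - 1 then D2L S (q j) (q (Suc j)) v else 0))"
      unfolding dS_def using k by (intro sum.cong) auto
    then have "dS N q ?\<delta> = D1L S (q k) (q (Suc k)) v + D2L S (q (k - 1)) (q (Suc (k - 1))) v"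
      using k by (simp add: sum.distrib)
    ultimately show "EL (q (k - 1)) (q k) (q (Suc k)) v = 0" using k by (simp add: EL_def)
  qed
next
  assume R: ?R
  show ?L
  proof (intro allI impI, elim conjE)
    fix \<delta> assume \<delta>: "\<forall>k\<le>N. \<delta> k \<in> cstr S (q k)" "\<delta> 0 = 0" "\<delta> N = 0"
    show "dS N q \<delta> = 0"
    proof (cases N)
      case (Suc n)
      have z: "D1L S x y 0 = 0" "D2L S x y 0 = 0" for x y by (simp_all add: D1L_def D2L_def)
      have "dS N q \<delta> = (\<Sum>k<Suc n. D1L S (q k) (q (Suc k)) (\<delta> k)) + (\<Sum>k<Suc n. D2L S (q k) (q (Suc k)) (\<delta> (Suc k)))"
        by (simp add: dS_def Suc sum.distrib)
      also have "\<dots> = (\<Sum>k<n. D1L S (q (Suc k)) (q (Suc (Suc k))) (\<delta> (Suc k))) + (\<Sum>k<n. D2L S (q k) (q (Suc k)) (\<delta> (Suc k)))"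
        unfolding sum.lessThan_Suc_shift[of "\<lambda>k. D1L S (q k) (q (Suc k)) (\<delta> k)"] using \<delta> Suc by (simp add: z)
      also have "\<dots> = (\<Sum>k<n. EL (q k) (q (Suc k)) (q (Suc (Suc k))) (\<delta> (Suc k)))"
        by (simp add: EL_def sum.distrib)
      also have "\<dots> = 0"
      proof (rule sum.neutral, rule ballI)
        fix k assume "k \<in> {..<n}"
        then have k: "1 \<le> Suc k \<and> Suc k < N" using Suc by simp
        then have "\<delta> (Suc k) \<in> cstr S (q (Suc k))" using \<delta>(1) by simp
        then show "EL (q k) (q (Suc k)) (q (Suc (Suc k))) (\<delta> (Suc k)) = 0" using R[rule_format, OF k] by simp
      qed
      finally show ?thesis .
    qed (simp add: dS_def)
  qed
qed

lemma Lhat_rho: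
  assumes xy: "(x, y) \<in> Udom S" and w: "w \<in> C"
  shows "Lhat S (rho S (x, w)) (qproj S y) = Lcheck S x w (qproj S y)"
  unfolding Lhat_def by (rule the_elem_rho) (simp add: Lcheck_act[OF xy _ w])

lemma Lhat_rho_germ:
  assumes xy: "(x, y) \<in> Udom S" and w: "w \<in> C"
  shows "(\<lambda>z. Lhat S (rho S z) (qproj S y) + K) \<in> germs (QGS S) (x, w)"
proof -
  note Q = UdomD[OF xy] and At = smooth_atlas_prod[OF atlasQ atlas]
  let ?P = "prod_manifold (config S) (grp_mfd S)"
  let ?W = "{x \<in> Q. (x, y) \<in> Udom S} \<times> C"
  have 1: "smooth_at (mspace ?P) (QS S) fst (x, w)" and 2: "smooth_at (mspace ?P) (GS S) snd (x, w)"
    using Q w by (auto intro!: smooth_at_fst smooth_at_snd atlas atlasQ)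
  have "(\<lambda>z. lagr S (fst z, snd z \<cdot> hrep (fst z) y)) \<in> germs (mspace ?P) (x, w)"
    using Q w xy by (intro lagr_germ[OF At] smooth_at_act[OF At] smooth_at_hrep[OF At] 1 2 smooth_at_Q_const At) auto
  then have g: "(\<lambda>z. lagr S (fst z, snd z \<cdot> hrep (fst z) y) + K) \<in> germs (mspace ?P) (x, w)"
    using Q w by (intro germ_add germ_const At) auto
  have "openin (mtop (grp_mfd S)) C" using openin_topspace[of "mtop (grp_mfd S)"] by simp
  then have o: "openin (mtop ?P) ?W"
    using Udom_slice_left[OF Q(2)] by (simp add: mtop_prod_manifold openin_prod_Times_iff)
  show ?thesis
    by (rule germ_local[OF At g o]) (use xy w Q in \<open>auto simp: Lhat_rho Lcheck_eq\<close>)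
qed

lemma rho_orbit: "rho S z = orbit (grp S) (conj_act S) z"
  by (cases z) (simp add: rho_def)

lemma Lhat_germ_Gtilde:
  assumes xy: "(x, y) \<in> Udom S" and w: "w \<in> C"
  shows "(\<lambda>z. Lhat S z (qproj S y) + K) \<in> germs (Gtilde S) (rho S (x, w))"
  unfolding Gtilde_def
proof (rule germ_quotientI)
  fix z assume "z \<in> rho S (x, w)"
  then obtain g where g: "g \<in> C" "z = (g \<cdot> x, conj_by S g w)" by (auto simp: rho_def orbit_def conj_act_def)
  have "(g \<cdot> x, y) \<in> Udom S" using Udom_act[OF xy g(1) one_closed] UdomD[OF xy] by (simp add: pos.act_one)
  from Lhat_rho_germ[OF this conj_closed[OF g(1) w], of K]
  show "(\<lambda>z. Lhat S (orbit (grp S) (conj_act S) z) (qproj S y) + K) \<in> germs (QGS S) z"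
    using g(2) by (simp add: rho_orbit)
qed

text \<open>Along the image of \<open>(a, dA (a, b))\<close> the reduced Lagrangian changes by the effect of \<open>a\<close> on the first
  argument of \<open>Lcheck\<close>, and of \<open>a\<close> and \<open>b\<close> on the second through \<open>Ad\<close>. The additive constant stands for
  the remaining terms of the reduced action. What is missing to \<open>D2L b\<close> is supplied by \<open>dLhat_base\<close>.\<close>

lemma dLhat_fiber:
  assumes xy: "(x, y) \<in> Udom S" and a: "a \<in> T x" and b: "b \<in> T y"
  shows "dmap (Gtilde S) (rho S) (x, Ad (x, y)) (tangent_pair (QGS S) x (Ad (x, y)) a (dA S x y a b))
      (\<lambda>z. Lhat S z (qproj S y) + K)
    = D1L S x y a + b (\<lambda>z. Lcheck S x (Ad (x, z)) (qproj S y))"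
proof -
  note Q = UdomD[OF xy] and w = Ad_props(1)[OF xy]
  let ?w = "Ad (x, y)" and ?F = "\<lambda>z. Lhat S z (qproj S y) + K"
  let ?\<phi> = "\<lambda>w'. ?F (rho S (x, w'))"
  have \<phi>: "?\<phi> w' = Lcheck S x w' (qproj S y) + K" if "w' \<in> C" for w' using Lhat_rho[OF xy that] by simp
  have \<phi>_germ: "?\<phi> \<in> germs (GS S) ?w"
    by (rule germ_local[OF atlas germ_add[OF atlas Lcheck_germ_G[OF xy w] germ_const[OF atlas]] openin_topspace])
      (use w \<phi> in auto)
  have "smooth_at (QQS S) (GS S) (\<lambda>z. Ad (fst z, snd z)) (x, y)"
    using Q xy by (intro smooth_at_Ad smooth_atlas_prod smooth_at_fst smooth_at_snd atlasQ) auto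
  from smooth_atD[OF this, of ?\<phi>] \<phi>_germ have \<phi>Ad: "(\<lambda>z. ?\<phi> (Ad z)) \<in> germs (QQS S) (x, y)" by simp
  have "dmap (Gtilde S) (rho S) (x, ?w) (tangent_pair (QGS S) x ?w a (dA S x y a b)) ?F
      = a (\<lambda>x'. ?F (rho S (x', ?w))) + dA S x y a b ?\<phi>"
    using Lhat_germ_Gtilde[OF xy w] Lhat_rho_germ[OF xy w] by (simp add: dmap_def tangent_pair_def)
  also have "dA S x y a b ?\<phi> = a (\<lambda>x'. ?\<phi> (Ad (x', y))) + b (\<lambda>y'. ?\<phi> (Ad (x, y')))"
    using \<phi>_germ \<phi>Ad by (simp add: dA_def dmap_def tangent_pair_def)
  also have "a (\<lambda>x'. ?F (rho S (x', ?w))) = a (\<lambda>x'. Lcheck S x' ?w (qproj S y) + K)"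
    by (rule tangent_local[OF atlasQ a Udom_slice_left[OF Q(2)]]) (use xy Q w in \<open>auto simp: Lhat_rho\<close>)
  also have "\<dots> = a (\<lambda>x'. Lcheck S x' ?w (qproj S y))"
    by (rule tangent_add_const[OF atlasQ a Lcheck_germ_Q[OF xy w]])
  also have "a (\<lambda>x'. ?\<phi> (Ad (x', y))) = a (\<lambda>x'. Lcheck S x (Ad (x', y)) (qproj S y) + K)"
    by (rule tangent_local[OF atlasQ a Udom_slice_left[OF Q(2)]]) (use xy Q in \<open>auto simp: Lhat_rho[OF xy] Ad_props\<close>)
  also have "\<dots> = a (\<lambda>x'. Lcheck S x (Ad (x', y)) (qproj S y))"
    by (rule tangent_add_const[OF atlasQ a Lcheck_germ_Ad_left[OF xy]])
  also have "b (\<lambda>y'. ?\<phi> (Ad (x, y'))) = b (\<lambda>y'. Lcheck S x (Ad (x, y')) (qproj S y) + K)"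
    by (rule tangent_local[OF atlasQ b Udom_slice_right[OF Q(1)]]) (use xy Q in \<open>auto simp: Lhat_rho[OF xy] Ad_props\<close>)
  also have "\<dots> = b (\<lambda>y'. Lcheck S x (Ad (x, y')) (qproj S y))"
    by (rule tangent_add_const[OF atlasQ b Lcheck_germ_Ad_right[OF xy]])
  finally show ?thesis by (simp add: D1L_split[OF xy a])
qed

lemma dLhat_base:
  assumes xy: "(x, y) \<in> Udom S" and b: "b \<in> T y"
  shows "dpi y b (\<lambda>r. Lhat S (rho S (x, Ad (x, y))) r + K) = b (\<lambda>z. Lcheck S x (Ad (x, y)) (qproj S z))"
proof -
  note Q = UdomD[OF xy] and w = Ad_props(1)[OF xy]
  let ?w = "Ad (x, y)"
  have "(\<lambda>r. Lhat S (rho S (x, ?w)) r + K) \<in> germs (base S) (qproj S y)"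
  proof (rule germ_baseI)
    fix g assume g: "g \<in> C"
    have xgy: "(x, g \<cdot> y) \<in> Udom S" using Udom_act[OF xy one_closed g] Q by (simp add: pos.act_one)
    have gy: "g \<cdot> y \<in> topspace (mtop (config S))" using UdomD[OF xgy] by simp
    show "(\<lambda>z. Lhat S (rho S (x, ?w)) (qproj S z) + K) \<in> germs (QS S) (g \<cdot> y)"
      by (rule germ_local[OF atlasQ germ_add[OF atlasQ Lcheck_germ_fiber[OF xgy w] germ_const[OF atlasQ gy]] Udom_slice_right[OF Q(1)]])
        (use xgy gy w in \<open>auto simp: Lhat_rho\<close>)
  qed
  then have "dpi y b (\<lambda>r. Lhat S (rho S (x, ?w)) r + K) = b (\<lambda>z. Lhat S (rho S (x, ?w)) (qproj S z) + K)"
    by (rule dpi_germ)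
  also have "\<dots> = b (\<lambda>z. Lcheck S x ?w (qproj S z) + K)"
    by (rule tangent_local[OF atlasQ b Udom_slice_right[OF Q(1)]]) (use xy Q w in \<open>auto simp: Lhat_rho\<close>)
  also have "\<dots> = b (\<lambda>z. Lcheck S x ?w (qproj S z))"
    by (rule tangent_add_const[OF atlasQ b Lcheck_germ_fiber[OF xy w]])
  finally show ?thesis .
qed

text \<open>The reduced variations are exactly the images of the admissible variations
  \<open>hlift (\<delta>r k) + inf_gen (\<xi> k)\<close>, and the reduced action has the same differential on them.\<close>

lemma dShat_eq_dS:
  assumes q: "\<And>k. k \<le> N \<Longrightarrow> q k \<in> Q" and U: "\<And>k. k < N \<Longrightarrow> (q k, q (Suc k)) \<in> Udom S"
    and \<delta>r: "\<And>k. k \<le> N \<Longrightarrow> \<delta>r k \<in> cstr_hat S (qproj S (q k))" and \<xi>: "\<And>k. k \<le> N \<Longrightarrow> \<xi> k \<in> gD_fiber S (q k)"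
    and 0: "\<delta>r 0 = 0"
    and \<delta>v: "\<And>k. k < N \<Longrightarrow> \<delta>v k =
            dmap (Gtilde S) (rho S) (q k, Ad (q k, q (Suc k)))
              (tangent_pair (QGS S) (q k) (Ad (q k, q (Suc k)))
                (hlift S (q k) (\<delta>r k))
                (dA S (q k) (q (Suc k)) (hlift S (q k) (\<delta>r k)) (hlift S (q (Suc k)) (\<delta>r (Suc k))))) +
            dmap (Gtilde S) (rho S) (q k, Ad (q k, q (Suc k)))
              (tangent_pair (QGS S) (q k) (Ad (q k, q (Suc k)))
                (inf_gen S (\<xi> k) (q k))
                (dA S (q k) (q (Suc k)) (inf_gen S (\<xi> k) (q k)) (inf_gen S (\<xi> (Suc k)) (q (Suc k)))))"
  shows "dShat S N (\<lambda>k. rho S (q k, Ad (q k, q (Suc k)))) (\<lambda>k. qproj S (q k)) \<delta>v \<delta>r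
    = dS N q (\<lambda>k. hlift S (q k) (\<delta>r k) + inf_gen S (\<xi> k) (q k))"
proof -
  let ?w = "\<lambda>k. Ad (q k, q (Suc k))"
  let ?v = "\<lambda>k. rho S (q k, ?w k)" and ?r = "\<lambda>k. qproj S (q k)"
  let ?h = "\<lambda>k. hlift S (q k) (\<delta>r k)" and ?i = "\<lambda>k. inf_gen S (\<xi> k) (q k)"
  let ?\<delta> = "\<lambda>k. ?h k + ?i k"
  define K where "K j = (\<Sum>i\<in>{..<N} - {j}. Lhat S (?v i) (?r (Suc i)))" for j
  have hT: "?h k \<in> T (q k)" and iT: "?i k \<in> T (q k)" and \<delta>T: "?\<delta> k \<in> T (q k)" and dpi: "dpi (q k) (?\<delta> k) = \<delta>r k" if k: "k \<le> N" for k
  proof -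
    have c: "?h k \<in> cstr S (q k)" "?i k \<in> cstr S (q k)"
      using hlift_cstr[OF q[OF k] \<delta>r[OF k]] gD_fiberD(2)[OF \<xi>[OF k]] by auto
    then show "?h k \<in> T (q k)" "?i k \<in> T (q k)" "?\<delta> k \<in> T (q k)"
      using bundles(5)[OF q[OF k]] subspace_add[OF bundles(4)[OF q[OF k]]] by blast+
    show "dpi (q k) (?\<delta> k) = \<delta>r k"
      using hlift_cstr_hat(2)[OF q[OF k] \<delta>r[OF k]] dpi_vert[OF inf_gen_eq(2)[OF gD_fiberD(1)[OF \<xi>[OF k]] q[OF k]] q[OF k]]
      by (simp add: dmap_add)
  qed
  have 1: "\<delta>v j (\<lambda>x. Shat S N (?v(j := x)) ?r) =
      D1L S (q j) (q (Suc j)) (?\<delta> j) + ?\<delta> (Suc j) (\<lambda>z. Lcheck S (q j) (Ad (q j, z)) (?r (Suc j)))" if j: "j < N" for j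
  proof -
    have "Shat S N (?v(j := x)) ?r = Lhat S x (?r (Suc j)) + K j" for x
      unfolding Shat_def K_def using j by (subst sum.remove[of _ j]) (auto intro!: sum.cong)
    then show ?thesis
      using j dLhat_fiber[OF U[OF j] hT hT, of "K j"] dLhat_fiber[OF U[OF j] iT iT, of "K j"]
      by (simp add: \<delta>v D1L_def)
  qed
  have 2: "\<delta>r (Suc j) (\<lambda>x. Shat S N ?v (?r(Suc j := x))) = ?\<delta> (Suc j) (\<lambda>z. Lcheck S (q j) (?w j) (qproj S z))" if j: "j < N" for j
  proof -
    have "Shat S N ?v (?r(Suc j := x)) = Lhat S (?v j) x + K j" for x
      unfolding Shat_def K_def using j by (subst sum.remove[of _ j]) (auto intro!: sum.cong)
    moreover have "\<delta>r (Suc j) = dpi (q (Suc j)) (?\<delta> (Suc j))" using dpi[of "Suc j"] j by simp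
    ultimately show ?thesis
      using j dLhat_base[OF U[OF j] \<delta>T, of "K j"] by simp
  qed
  have "(\<Sum>j\<le>N. \<delta>r j (\<lambda>x. Shat S N ?v (?r(j := x)))) = (\<Sum>j<N. \<delta>r (Suc j) (\<lambda>x. Shat S N ?v (?r(Suc j := x))))"
    using 0 by (simp add: sum.atMost_shift)
  then have "dShat S N ?v ?r \<delta>v \<delta>r =
      (\<Sum>j<N. D1L S (q j) (q (Suc j)) (?\<delta> j) + (?\<delta> (Suc j) (\<lambda>z. Lcheck S (q j) (Ad (q j, z)) (?r (Suc j)))
        + ?\<delta> (Suc j) (\<lambda>z. Lcheck S (q j) (?w j) (qproj S z))))"
    unfolding dShat_def by (simp add: 1 2 sum.distrib)
  also have "\<dots> = dS N q ?\<delta>"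
    unfolding dS_def
  proof (intro sum.cong refl)
    fix j assume "j \<in> {..<N}"
    then have j: "j < N" by simp
    show "D1L S (q j) (q (Suc j)) (?\<delta> j) + (?\<delta> (Suc j) (\<lambda>z. Lcheck S (q j) (Ad (q j, z)) (?r (Suc j)))
        + ?\<delta> (Suc j) (\<lambda>z. Lcheck S (q j) (?w j) (qproj S z)))
      = D1L S (q j) (q (Suc j)) (?\<delta> j) + D2L S (q j) (q (Suc j)) (?\<delta> (Suc j))"
      using D2L_split[OF U[OF j] \<delta>T[of "Suc j"]] j by simp
  qed
  finally show ?thesis .
qed

end

section \<open>The equivalence of the five conditions\<close>

theorem corollary6p5:
  fixes S :: "('q, 'e::euclidean_space, 'g, 'h::euclidean_space) nh_reduction_data"
    and q :: "nat \<Rightarrow> 'q" and N :: nat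
    and r :: "nat \<Rightarrow> 'q set" and w :: "nat \<Rightarrow> 'g" and v :: "nat \<Rightarrow> ('q \<times> 'g) set"
    and cond1 cond2 cond3 cond4 cond5 :: bool
  assumes system: "nh_discrete_system S"
    and symmetry: "symmetry_group S"
    and connection: "connection_data S"
    and discrete_connection: "affine_discrete_connection S"
    and curve: "\<forall>k\<le>N. q k \<in> pts (QS S)"
    and in_domain: "\<forall>k<N. (q k, q (Suc k)) \<in> Udom S"
  defines "r \<equiv> \<lambda>k. qproj S (q k)"
    and "w \<equiv> \<lambda>k. Adisc S (q k, q (Suc k))"
    and "v \<equiv> \<lambda>k. rho S (q k, w k)"
  defines "cond1 \<equiv>
      (\<forall>k<N. (q k, q (Suc k)) \<in> kin S) \<and>
      (\<forall>\<delta>q. (\<forall>k\<le>N. \<delta>q k \<in> cstr S (q k)) \<and> \<delta>q 0 = 0 \<and> \<delta>q N = 0 \<longrightarrow> dSd S N q \<delta>q = 0)"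
    and "cond2 \<equiv>
      (\<forall>k. 1 \<le> k \<and> k < N \<longrightarrow>
         (\<lambda>\<delta>. D1L S (q k) (q (Suc k)) \<delta> + D2L S (q (k - 1)) (q k) \<delta>) \<in> annihilator (cstr S (q k))) \<and>
      (\<forall>k<N. (q k, q (Suc k)) \<in> kin S)"
    and "cond3 \<equiv>
      (\<forall>k<N. (v k, r (Suc k)) \<in> kin_hat S) \<and>
      (\<forall>\<delta>v \<delta>r \<xi>.
         (\<forall>k\<le>N. \<delta>r k \<in> cstr_hat S (r k) \<and> (q k, \<xi> k) \<in> gD S) \<and>
         \<delta>r 0 = 0 \<and> \<delta>r N = 0 \<and> \<xi> 0 = 0 \<and> \<xi> N = 0 \<and>
         (\<forall>k<N. \<delta>v k =
            dmap (Gtilde S) (rho S) (q k, w k)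
              (tangent_pair (QGS S) (q k) (w k)
                (hlift S (q k) (\<delta>r k))
                (dA S (q k) (q (Suc k)) (hlift S (q k) (\<delta>r k)) (hlift S (q (Suc k)) (\<delta>r (Suc k))))) +
            dmap (Gtilde S) (rho S) (q k, w k)
              (tangent_pair (QGS S) (q k) (w k)
                (inf_gen S (\<xi> k) (q k))
                (dA S (q k) (q (Suc k)) (inf_gen S (\<xi> k) (q k)) (inf_gen S (\<xi> (Suc k)) (q (Suc k)))))) \<longrightarrow>
         dShat S N v r \<delta>v \<delta>r = 0)"
    and "cond4 \<equiv>
      (\<forall>k<N. (v k, r (Suc k)) \<in> kin_hat S) \<and>
      (\<forall>k. 1 \<le> k \<and> k < N \<longrightarrow>
         (\<lambda>\<delta>. D1Lcheck S (q k) (w k) (r (Suc k)) (hlift S (q k) \<delta>)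
             + D3Lcheck S (q (k - 1)) (w (k - 1)) (r k) \<delta>
             + Fminus S (v k) (r (Suc k)) \<delta> + Fplus S (v (k - 1)) (r k) \<delta>)
           \<in> annihilator (cstr_hat S (r k)) \<and>
         (\<lambda>\<xi>. right_translate S (D2Lcheck S (q (k - 1)) (w (k - 1)) (r k)) (w (k - 1)) \<xi>
             - right_translate S (D2Lcheck S (q k) (w k) (r (Suc k))) (w k) \<xi>)
           \<in> annihilator (gD_fiber S (q k)))"
    and "cond5 \<equiv>
      (\<forall>k<N. (v k, r (Suc k)) \<in> kin_hat S) \<and>
      (\<forall>k. 1 \<le> k \<and> k < N \<longrightarrow>
         horizontal_condition S (v (k - 1), r k, v k, r (Suc k)) \<and>
         vertical_condition S (v (k - 1), r k, v k, r (Suc k)))"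
  shows "(cond1 \<longleftrightarrow> cond5) \<and> (cond2 \<longleftrightarrow> cond5) \<and> (cond3 \<longleftrightarrow> cond5) \<and> (cond4 \<longleftrightarrow> cond5)"
proof -
  interpret nh_reduction S
    using system symmetry connection discrete_connection by (simp add: nh_reduction_def)
  have q: "q k \<in> topspace (mtop (config S))" if "k \<le> N" for k using curve that by simp
  have U: "(q k, q (Suc k)) \<in> Udom S" if "k < N" for k using in_domain that by blast
  \<comment> \<open>the common form of the dynamical part of all five conditions\<close>
  define ELs where "ELs \<longleftrightarrow> (\<forall>k. 1 \<le> k \<and> k < N \<longrightarrow> (\<forall>\<delta>\<in>cstr S (q k). EL (q (k - 1)) (q k) (q (Suc k)) \<delta> = 0))"
  have pred: "(q (k - 1), q k) \<in> Udom S" if "1 \<le> k \<and> k < N" for k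
  proof -
    have "k - 1 < N" "Suc (k - 1) = k" using that by linarith+
    then show ?thesis using U[of "k - 1"] by simp
  qed
  have wp: "w (k - 1) = Adisc S (q (k - 1), q k)" if "1 \<le> k \<and> k < N" for k using that by (simp add: w_def)
  have kin: "(\<forall>k<N. (v k, r (Suc k)) \<in> kin_hat S) \<longleftrightarrow> (\<forall>k<N. (q k, q (Suc k)) \<in> kin S)"
    using kin_hat_iff[OF U] by (simp add: v_def r_def w_def)
  have ELs: "ELs \<longleftrightarrow> (\<forall>\<delta>. (\<forall>k\<le>N. \<delta> k \<in> cstr S (q k)) \<and> \<delta> 0 = 0 \<and> \<delta> N = 0 \<longrightarrow> dS N q \<delta> = 0)"
    unfolding ELs_def by (rule dS_zero_iff_EL[symmetric]) (rule q)
  have c1: "cond1 \<longleftrightarrow> (\<forall>k<N. (q k, q (Suc k)) \<in> kin S) \<and> ELs"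
  proof -
    have "dSd S N q \<delta>q = dS N q \<delta>q" if "\<forall>k\<le>N. \<delta>q k \<in> cstr S (q k)" for \<delta>q
      using that bundles(5)[OF q] by (intro dSd_eq_dS q) blast+
    then show ?thesis
      unfolding cond1_def ELs by auto
  qed
  have c2: "cond2 \<longleftrightarrow> (\<forall>k<N. (q k, q (Suc k)) \<in> kin S) \<and> ELs"
    unfolding cond2_def ELs_def by (auto simp: annihilator_def EL_def)
  have c4: "cond4 \<longleftrightarrow> (\<forall>k<N. (q k, q (Suc k)) \<in> kin S) \<and> ELs"
    unfolding cond4_def kin ELs_def
  proof (intro conj_cong refl all_cong)
    fix k assume k: "1 \<le> k \<and> k < N"
    show "(\<lambda>\<delta>. D1Lcheck S (q k) (w k) (r (Suc k)) (hlift S (q k) \<delta>)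
             + D3Lcheck S (q (k - 1)) (w (k - 1)) (r k) \<delta>
             + Fminus S (v k) (r (Suc k)) \<delta> + Fplus S (v (k - 1)) (r k) \<delta>)
           \<in> annihilator (cstr_hat S (r k)) \<and>
         (\<lambda>\<xi>. right_translate S (D2Lcheck S (q (k - 1)) (w (k - 1)) (r k)) (w (k - 1)) \<xi>
             - right_translate S (D2Lcheck S (q k) (w k) (r (Suc k))) (w k) \<xi>)
           \<in> annihilator (gD_fiber S (q k)) \<longleftrightarrow>
       (\<forall>\<delta>\<in>cstr S (q k). EL (q (k - 1)) (q k) (q (Suc k)) \<delta> = 0)"
      using reduced_iff_EL[OF pred[OF k] U[OF conjunct2[OF k]]]
      unfolding v_def wp[OF k] unfolding w_def r_def .
  qed
  have c5: "cond5 \<longleftrightarrow> (\<forall>k<N. (q k, q (Suc k)) \<in> kin S) \<and> ELs"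
    unfolding cond5_def kin ELs_def
  proof (intro conj_cong refl all_cong)
    fix k assume k: "1 \<le> k \<and> k < N"
    show "horizontal_condition S (v (k - 1), r k, v k, r (Suc k)) \<and> vertical_condition S (v (k - 1), r k, v k, r (Suc k)) \<longleftrightarrow>
       (\<forall>\<delta>\<in>cstr S (q k). EL (q (k - 1)) (q k) (q (Suc k)) \<delta> = 0)"
      using intrinsic_iff_EL[OF pred[OF k] U[OF conjunct2[OF k]]]
      unfolding v_def wp[OF k] unfolding w_def r_def .
  qed
  have c3: "cond3 \<longleftrightarrow> (\<forall>k<N. (q k, q (Suc k)) \<in> kin S) \<and> ELs"
  proof -
    let ?var = "\<lambda>\<delta>r \<xi> k. hlift S (q k) (\<delta>r k) + inf_gen S (\<xi> k) (q k)"
    let ?\<delta>v = "\<lambda>\<delta>r \<xi> k.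
            dmap (Gtilde S) (rho S) (q k, w k)
              (tangent_pair (QGS S) (q k) (w k)
                (hlift S (q k) (\<delta>r k))
                (dA S (q k) (q (Suc k)) (hlift S (q k) (\<delta>r k)) (hlift S (q (Suc k)) (\<delta>r (Suc k))))) +
            dmap (Gtilde S) (rho S) (q k, w k)
              (tangent_pair (QGS S) (q k) (w k)
                (inf_gen S (\<xi> k) (q k))
                (dA S (q k) (q (Suc k)) (inf_gen S (\<xi> k) (q k)) (inf_gen S (\<xi> (Suc k)) (q (Suc k)))))"
    have eq: "dShat S N v r \<delta>v \<delta>r = dS N q (?var \<delta>r \<xi>)"
      if "\<forall>k\<le>N. \<delta>r k \<in> cstr_hat S (r k) \<and> (q k, \<xi> k) \<in> gD S" "\<delta>r 0 = 0" "\<forall>k<N. \<delta>v k = ?\<delta>v \<delta>r \<xi> k" for \<delta>v \<delta>r \<xi>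
      unfolding v_def r_def w_def
      by (rule dShat_eq_dS[where q = q and N = N and \<xi> = \<xi>]) (use that q U in \<open>auto simp: r_def w_def gD_fiber_def\<close>)
    have "(\<forall>\<delta>v \<delta>r \<xi>.
         (\<forall>k\<le>N. \<delta>r k \<in> cstr_hat S (r k) \<and> (q k, \<xi> k) \<in> gD S) \<and>
         \<delta>r 0 = 0 \<and> \<delta>r N = 0 \<and> \<xi> 0 = 0 \<and> \<xi> N = 0 \<and> (\<forall>k<N. \<delta>v k = ?\<delta>v \<delta>r \<xi> k) \<longrightarrow> dShat S N v r \<delta>v \<delta>r = 0) \<longleftrightarrow>
      (\<forall>\<delta>. (\<forall>k\<le>N. \<delta> k \<in> cstr S (q k)) \<and> \<delta> 0 = 0 \<and> \<delta> N = 0 \<longrightarrow> dS N q \<delta> = 0)" (is "?L \<longleftrightarrow> ?R")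
    proof
      assume R: ?R
      show ?L
      proof (intro allI impI, elim conjE)
        fix \<delta>v \<delta>r \<xi>
        assume mem: "\<forall>k\<le>N. \<delta>r k \<in> cstr_hat S (r k) \<and> (q k, \<xi> k) \<in> gD S"
          and z: "\<delta>r 0 = 0" "\<delta>r N = 0" "\<xi> 0 = 0" "\<xi> N = 0" and \<delta>v: "\<forall>k<N. \<delta>v k = ?\<delta>v \<delta>r \<xi> k"
        have "?var \<delta>r \<xi> k \<in> cstr S (q k)" if k: "k \<le> N" for k
          using mem k by (intro subspace_add[OF bundles(4)[OF q[OF k]]] hlift_cstr[OF q[OF k]])
            (auto simp: r_def gD_def)
        moreover have "?var \<delta>r \<xi> 0 = 0" "?var \<delta>r \<xi> N = 0"
          using z hlift_zero[OF q] zero_gD_fiber(2)[OF q] by simp_all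
        ultimately have "dS N q (?var \<delta>r \<xi>) = 0" using R by simp
        then show "dShat S N v r \<delta>v \<delta>r = 0" using eq[OF mem z(1) \<delta>v] by simp
      qed
    next
      assume L: ?L
      show ?R
      proof (intro allI impI, elim conjE)
        fix \<delta> assume \<delta>: "\<forall>k\<le>N. \<delta> k \<in> cstr S (q k)" "\<delta> 0 = 0" "\<delta> N = 0"
        have "\<forall>k. \<exists>p. k \<le> N \<longrightarrow> fst p \<in> cstr_hat S (r k) \<and> (q k, snd p) \<in> gD S \<and>
            \<delta> k = hlift S (q k) (fst p) + inf_gen S (snd p) (q k) \<and> (k = 0 \<or> k = N \<longrightarrow> fst p = 0 \<and> snd p = 0)"
        proof
          fix k
          show "\<exists>p. k \<le> N \<longrightarrow> fst p \<in> cstr_hat S (r k) \<and> (q k, snd p) \<in> gD S \<and>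
            \<delta> k = hlift S (q k) (fst p) + inf_gen S (snd p) (q k) \<and> (k = 0 \<or> k = N \<longrightarrow> fst p = 0 \<and> snd p = 0)"
          proof (cases "k \<le> N \<and> k \<noteq> 0 \<and> k \<noteq> N")
            case True
            then obtain u \<xi> where "u \<in> cstr_hat S (qproj S (q k))" "\<xi> \<in> gD_fiber S (q k)" "\<delta> k = hlift S (q k) u + inf_gen S \<xi> (q k)"
              using cstr_decompose[OF q, of k "\<delta> k"] \<delta>(1) by blast
            then show ?thesis using True by (intro exI[of _ "(u, \<xi>)"]) (simp add: r_def gD_fiber_def)
          next
            case False
            then show ?thesis
              using \<delta> zero_cstr_hat[OF q[of k]] zero_gD_fiber[OF q[of k]] hlift_zero[OF q[of k]]
              by (intro exI[of _ "(0, 0)"]) (auto simp: r_def gD_fiber_def)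
          qed
        qed
        then obtain p where p: "\<And>k. k \<le> N \<Longrightarrow> fst (p k) \<in> cstr_hat S (r k) \<and> (q k, snd (p k)) \<in> gD S \<and>
            \<delta> k = hlift S (q k) (fst (p k)) + inf_gen S (snd (p k)) (q k) \<and> (k = 0 \<or> k = N \<longrightarrow> fst (p k) = 0 \<and> snd (p k) = 0)"
          by metis
        \<comment> \<open>the components of \<open>\<delta>\<close>; they are chosen to be zero at the end points\<close>
        define \<delta>r \<xi> where "\<delta>r k = fst (p k)" and "\<xi> k = snd (p k)" for k
        have mem: "\<forall>k\<le>N. \<delta>r k \<in> cstr_hat S (r k) \<and> (q k, \<xi> k) \<in> gD S" using p by (simp add: \<delta>r_def \<xi>_def)
        have z: "\<delta>r 0 = 0" "\<delta>r N = 0" "\<xi> 0 = 0" "\<xi> N = 0" using p[of 0] p[of N] by (auto simp: \<delta>r_def \<xi>_def)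
        have "(\<forall>k\<le>N. \<delta>r k \<in> cstr_hat S (r k) \<and> (q k, \<xi> k) \<in> gD S) \<and>
            \<delta>r 0 = 0 \<and> \<delta>r N = 0 \<and> \<xi> 0 = 0 \<and> \<xi> N = 0 \<and> (\<forall>k<N. ?\<delta>v \<delta>r \<xi> k = ?\<delta>v \<delta>r \<xi> k)"
          using mem z by (intro conjI) simp_all
        then have "dShat S N v r (?\<delta>v \<delta>r \<xi>) \<delta>r = 0"
          by (rule L[THEN spec, THEN spec, THEN spec, THEN mp])
        then have "dS N q (?var \<delta>r \<xi>) = 0" using eq[OF mem z(1)] by simp
        moreover have "dS N q (?var \<delta>r \<xi>) = dS N q \<delta>"
          unfolding dS_def using p by (intro sum.cong) (auto simp: \<delta>r_def \<xi>_def)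
        ultimately show "dS N q \<delta> = 0" by simp
      qed
    qed
    then show ?thesis unfolding cond3_def kin ELs by simp
  qed
  show ?thesis using c1 c2 c3 c4 c5 by blast
qed

end
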